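(* Let $\ell$ be a prime number, and let $K$ be a discrete valuation field of characteristic zero and residue characteristic $\ell$. Let $\mathcal{O}$ denote the valuation ring of $K$, let $\lambda$ denote its maximal ideal, and let $k = \mathcal{O}/\lambda$ denote the residue field. Let $e$ denote the ramification index of $K$ (i.e., $\ell\mathcal{O}=\lambda^e$), and suppose $2e<\ell-1$. Suppose $V$ is a $K$-vector space of finite dimension $N$, $f:V\times V\to K$ is a nondegenerate alternating (respectively, symmetric) $K$-bilinear form, $G$ is a finite group, and $\rho: G\hookrightarrow \mathrm{Aut}_K(V,f)$ is a faithful representation of $G$ on $V$ that preserves the form $f$. Then there exist a nondegenerate alternating (respectively, symmetric) $k$-valued $k$-bilinear form $f_0$ on $k^N$, and a faithful representation $\bar\rho: G\hookrightarrow \mathrm{Aut}_k(k^N,f_0)$, such that for every $g\in G$, the characteristic polynomial of $\bar\rho(g)$ is the reduction modulo $\lambda$ of the characteristic polynomial of $\rho(g)$.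
   Context: For a field $F$, a finite-dimensional $F$-vector space $W$ and a form $b$ on $W$, $\mathrm{Aut}_F(W,b)$ denotes the group of $F$-linear automorphisms $\sigma$ of $W$ with $b(\sigma x,\sigma y)=b(x,y)$ for all $x,y\in W$. A discrete valuation field is a field equipped with a (rank one) discrete valuation; it is not assumed to be complete. Since $G$ is finite, the characteristic polynomial of each $\rho(g)$ has coefficients in $\mathcal{O}$, so its reduction modulo $\lambda$ is a polynomial over $k$. *)

theory Defs
  imports
    "HOL-Algebra.Bij"
    "HOL-Algebra.QuotRing"
    "HOL-Algebra.Ideal_Product"
    "HOL-Computational_Algebra.Primes"
    "Jordan_Normal_Form.VS_Connect"
    "Jordan_Normal_Form.Char_Poly"
begin

text \<open>
  Valuations are normalised: the value group is all of \<open>\<int>\<close>, so the valuation is discrete of rank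
  one and nontrivial. The conventional value \<open>\<infinity>\<close> at \<open>0\<close> is replaced by leaving \<open>v 0\<close> unconstrained
  and treating \<open>0\<close> separately.
\<close>

definition discrete_valuation :: "('a::field \<Rightarrow> int) \<Rightarrow> bool" where
  "discrete_valuation v \<longleftrightarrow>
     (\<forall>x y. x \<noteq> 0 \<longrightarrow> y \<noteq> 0 \<longrightarrow> v (x * y) = v x + v y) \<and>
     (\<forall>x y. x \<noteq> 0 \<longrightarrow> y \<noteq> 0 \<longrightarrow> x + y \<noteq> 0 \<longrightarrow> min (v x) (v y) \<le> v (x + y)) \<and>
     v ` {x. x \<noteq> 0} = UNIV"

definition val_ring :: "('a::field \<Rightarrow> int) \<Rightarrow> 'a ring" where
  "val_ring v = class_ring \<lparr>carrier := {x. x = 0 \<or> 0 \<le> v x}\<rparr>"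

definition max_ideal :: "('a::field \<Rightarrow> int) \<Rightarrow> 'a set" where
  "max_ideal v = {x. x = 0 \<or> 0 < v x}"

text \<open>
  The residue field is the quotient ring below. Vectors, matrices and polynomials need their
  coefficients in a type, so the quotient is identified with a field type by a ring isomorphism
  \<open>\<phi>\<close>; the reduction map is the quotient projection followed by \<open>\<phi>\<close>. It is meaningful only on the
  valuation ring.
\<close>

definition residue_ring_of :: "('a::field \<Rightarrow> int) \<Rightarrow> 'a set ring" where
  "residue_ring_of v = val_ring v Quot max_ideal v"

definition reduction :: "('a::field \<Rightarrow> int) \<Rightarrow> ('a set \<Rightarrow> 'k::field) \<Rightarrow> 'a \<Rightarrow> 'k" where
  "reduction v \<phi> x = \<phi> (max_ideal v +>\<^bsub>val_ring v\<^esub> x)"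

definition bilinear_form ::
    "('a::field, 'v, 'm) module_scheme \<Rightarrow> ('v \<Rightarrow> 'v \<Rightarrow> 'a) \<Rightarrow> bool" where
  "bilinear_form W b \<longleftrightarrow>
     (\<forall>x\<in>carrier W. \<forall>y\<in>carrier W. \<forall>z\<in>carrier W.
        b (x \<oplus>\<^bsub>W\<^esub> y) z = b x z + b y z \<and> b x (y \<oplus>\<^bsub>W\<^esub> z) = b x y + b x z) \<and>
     (\<forall>c. \<forall>x\<in>carrier W. \<forall>y\<in>carrier W.
        b (c \<odot>\<^bsub>W\<^esub> x) y = c * b x y \<and> b x (c \<odot>\<^bsub>W\<^esub> y) = c * b x y)"

definition nondegenerate_form ::
    "('a::field, 'v, 'm) module_scheme \<Rightarrow> ('v \<Rightarrow> 'v \<Rightarrow> 'a) \<Rightarrow> bool" where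
  "nondegenerate_form W b \<longleftrightarrow>
     (\<forall>x\<in>carrier W. (\<forall>y\<in>carrier W. b x y = 0) \<longrightarrow> x = \<zero>\<^bsub>W\<^esub>) \<and>
     (\<forall>y\<in>carrier W. (\<forall>x\<in>carrier W. b x y = 0) \<longrightarrow> y = \<zero>\<^bsub>W\<^esub>)"

definition alternating_form ::
    "('a::field, 'v, 'm) module_scheme \<Rightarrow> ('v \<Rightarrow> 'v \<Rightarrow> 'a) \<Rightarrow> bool" where
  "alternating_form W b \<longleftrightarrow> (\<forall>x\<in>carrier W. b x x = 0)"

definition symmetric_form ::
    "('a::field, 'v, 'm) module_scheme \<Rightarrow> ('v \<Rightarrow> 'v \<Rightarrow> 'a) \<Rightarrow> bool" where
  "symmetric_form W b \<longleftrightarrow> (\<forall>x\<in>carrier W. \<forall>y\<in>carrier W. b x y = b y x)"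

definition form_aut_group ::
    "('a::field, 'v, 'm) module_scheme \<Rightarrow> ('v \<Rightarrow> 'v \<Rightarrow> 'a) \<Rightarrow> ('v \<Rightarrow> 'v) monoid" where
  "form_aut_group W b = (BijGroup (carrier W))
     \<lparr>carrier := {\<sigma> \<in> Bij (carrier W). \<sigma> \<in> LinearCombinations.module_hom class_ring W W \<and>
        (\<forall>x\<in>carrier W. \<forall>y\<in>carrier W. b (\<sigma> x) (\<sigma> y) = b x y)}\<rparr>"

definition represents ::
    "('a::field, 'v, 'm) module_scheme \<Rightarrow> ('v \<Rightarrow> 'v) \<Rightarrow> 'a mat \<Rightarrow> bool" where
  "represents W T A \<longleftrightarrow>
     (\<exists>bs. distinct bs \<and> vectorspace.basis class_ring W (set bs) \<and>
        A \<in> carrier_mat (length bs) (length bs) \<and>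
        (\<forall>j<length bs. T (bs ! j) = (\<Oplus>\<^bsub>W\<^esub> i\<in>{..<length bs}. A $$ (i, j) \<odot>\<^bsub>W\<^esub> (bs ! i))))"

text \<open>
  Matrices representing the same endomorphism in different bases are similar, so the
  characteristic polynomial does not depend on the choice.
\<close>

definition endo_char_poly ::
    "('a::field, 'v, 'm) module_scheme \<Rightarrow> ('v \<Rightarrow> 'v) \<Rightarrow> 'a poly" where
  "endo_char_poly W T = char_poly (SOME A. represents W T A)"

end

theory Submission
  imports Defs "HOL-Algebra.Multiplicative_Group"
begin

text \<open>
  Let \<open>\<O>\<close> be the valuation ring and \<open>\<pi>\<close> a uniformizer. A finite group stabilises lattices in \<open>V\<close>,
  and after scaling the form is integral on them. Let \<open>L\<close> be maximal among the stable lattices on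
  which the form \<open>f\<close> is integral, and let \<open>L*\<close> be its dual lattice. Maximality forces
  \<open>\<pi> L* \<subseteq> L \<subseteq> L*\<close>: if \<open>x\<close> is in \<open>L\<close> and \<open>f x\<close> takes values in \<open>\<pi>\<^sup>2 \<O>\<close> on \<open>L\<close>, then adding all
  such \<open>\<pi>\<^sup>-\<^sup>1 x\<close> to \<open>L\<close> gives another stable integral lattice (\<open>reduced_rep_primitive\<close>).

  So \<open>f\<close> induces a nondegenerate form on \<open>L / \<pi> L*\<close>, and \<open>\<pi>\<^sup>-\<^sup>1 f\<close> induces one on \<open>\<pi> L* / \<pi> L\<close>.
  Both spaces over the residue field are acted on by the group; they are the two graded pieces of
  \<open>L / \<pi> L\<close>, so their orthogonal sum has dimension \<open>N\<close> and the same characteristic polynomials as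
  \<open>L / \<pi> L\<close>. In a basis of \<open>L\<close> adapted to the radical \<open>\<pi> L* / \<pi> L\<close> the Gram matrix has the form
  \<open>(A, \<pi> B; \<pi> C, \<pi> D)\<close>, the group acts by matrices that are block lower triangular modulo \<open>\<pi>\<close>, and
  the new form and the new representation are the reductions of \<open>A\<close>, \<open>D\<close> and of the diagonal
  blocks (\<open>residual_form_invariant\<close>, \<open>residual_form_nondegenerate\<close>, \<open>char_poly_block_diag_part\<close>).

  An element \<open>g\<close> that acts trivially on both pieces satisfies \<open>(g - 1)\<^sup>2 L \<subseteq> \<pi> L\<close>. For \<open>g\<close> of prime
  order \<open>p\<close> the binomial expansion of \<open>g\<^sup>p = 1\<close> then shows that \<open>g - 1\<close> is divisible by every power
  of \<open>\<pi>\<close>, provided that \<open>2 v(p) + 2 \<le> p\<close>; for the residue characteristic this is the hypothesis on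
  the ramification index, and for other primes \<open>v(p) = 0\<close> (\<open>unipotent_torsion_trivial\<close>). Hence the
  new representation is faithful.

  Lattices are handled through their basis matrices. Maximality is minimality of the valuation of
  the determinant, and the existence of bases is itself an extremal argument with Cramer's rule
  (\<open>lattice_has_basis\<close>).
\<close>

section \<open>Ring homomorphisms defined on a subring\<close>

definition mat_over :: "'a set \<Rightarrow> 'a mat \<Rightarrow> bool" where
  "mat_over S A \<longleftrightarrow> (\<forall>i<dim_row A. \<forall>j<dim_col A. A $$ (i, j) \<in> S)"

definition vec_over :: "'a set \<Rightarrow> 'a vec \<Rightarrow> bool" where
  "vec_over S x \<longleftrightarrow> (\<forall>i<dim_vec x. x $ i \<in> S)"

text \<open>
  The reduction map is defined on the whole field but is a homomorphism only on the valuation ring,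
  and likewise for its extension to polynomials. Working with a subset of a type, closed under the
  ring operations, keeps matrices over the valuation ring inside the type of matrices over the
  field.
\<close>

locale partial_hom =
  fixes S :: "'a::comm_ring_1 set" and h :: "'a \<Rightarrow> 'b::comm_ring_1"
  assumes one_mem: "1 \<in> S"
    and add_mem: "\<And>x y. x \<in> S \<Longrightarrow> y \<in> S \<Longrightarrow> x + y \<in> S"
    and mult_mem: "\<And>x y. x \<in> S \<Longrightarrow> y \<in> S \<Longrightarrow> x * y \<in> S"
    and uminus_mem: "\<And>x. x \<in> S \<Longrightarrow> - x \<in> S"
    and h_one: "h 1 = 1"
    and h_add: "\<And>x y. x \<in> S \<Longrightarrow> y \<in> S \<Longrightarrow> h (x + y) = h x + h y"
    and h_mult: "\<And>x y. x \<in> S \<Longrightarrow> y \<in> S \<Longrightarrow> h (x * y) = h x * h y"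
begin

lemma zero_mem: "0 \<in> S"
  using add_mem[OF one_mem uminus_mem[OF one_mem]] by simp

lemma h_zero: "h 0 = 0"
  using h_add[OF zero_mem zero_mem] by simp

lemma h_uminus: "x \<in> S \<Longrightarrow> h (- x) = - h x"
  using h_add[of x "- x"] uminus_mem[of x] h_zero by (simp add: eq_neg_iff_add_eq_0 add.commute)

lemma sum_mem: "(\<And>i. i \<in> A \<Longrightarrow> f i \<in> S) \<Longrightarrow> sum f A \<in> S"
  by (induction A rule: infinite_finite_induct) (auto simp: zero_mem add_mem)

lemma h_sum: "(\<And>i. i \<in> A \<Longrightarrow> f i \<in> S) \<Longrightarrow> h (sum f A) = (\<Sum>i\<in>A. h (f i))"
  by (induction A rule: infinite_finite_induct) (auto simp: h_zero h_add sum_mem)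

lemma prod_mem: "(\<And>i. i \<in> A \<Longrightarrow> f i \<in> S) \<Longrightarrow> prod f A \<in> S"
  by (induction A rule: infinite_finite_induct) (auto simp: one_mem mult_mem)

lemma h_prod: "(\<And>i. i \<in> A \<Longrightarrow> f i \<in> S) \<Longrightarrow> h (prod f A) = (\<Prod>i\<in>A. h (f i))"
  by (induction A rule: infinite_finite_induct) (auto simp: h_one h_mult prod_mem)

lemma of_int_mem: "of_int k \<in> S"
proof -
  have nat: "of_nat n \<in> S" for n
    by (induction n) (auto simp: zero_mem one_mem add_mem)
  show ?thesis
    by (cases k rule: int_cases2) (auto simp: nat uminus_mem)
qed

lemma h_of_int: "h (of_int k) = of_int k"
proof -
  have "of_nat n \<in> S \<and> h (of_nat n) = of_nat n" for n
    by (induction n) (auto simp: zero_mem one_mem add_mem h_zero h_one h_add)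
  then show ?thesis
    by (cases k rule: int_cases2) (auto simp: h_uminus)
qed

lemma det_mem:
  assumes "A \<in> carrier_mat n n" "mat_over S A"
  shows "det A \<in> S"
proof -
  have "A $$ (i, p i) \<in> S" if "p permutes {0..<n}" "i < n" for p i
    using assms that permutes_in_image[of p "{0..<n}" i] by (auto simp: mat_over_def)
  then show ?thesis
    using assms(1) unfolding det_def'[OF assms(1)]
    by (intro sum_mem mult_mem prod_mem)
      (auto simp: sign_def one_mem uminus_mem)
qed

lemma h_det:
  assumes A: "A \<in> carrier_mat n n" and S: "mat_over S A"
  shows "h (det A) = det (map_mat h A)"
proof -
  have m: "map_mat h A \<in> carrier_mat n n" using A by simp
  have el: "A $$ (i, p i) \<in> S" if "p permutes {0..<n}" "i < n" for p i
    using assms that permutes_in_image[of p "{0..<n}" i] by (auto simp: mat_over_def)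
  have sgn: "signof p \<in> S" "h (signof p) = signof p" for p :: "nat \<Rightarrow> nat"
    by (auto simp: sign_def one_mem uminus_mem h_one h_uminus)
  have "h (det A) = (\<Sum>p\<in>{p. p permutes {0..<n}}. h (signof p * (\<Prod>i=0..<n. A $$ (i, p i))))"
    unfolding det_def'[OF A] by (intro h_sum mult_mem prod_mem sgn) (auto simp: el)
  also have "\<dots> = (\<Sum>p\<in>{p. p permutes {0..<n}}. signof p * (\<Prod>i=0..<n. map_mat h A $$ (i, p i)))"
  proof (intro sum.cong refl)
    fix p assume p: "p \<in> {p. p permutes {0..<n}}"
    have "h (signof p * (\<Prod>i=0..<n. A $$ (i, p i))) = signof p * (\<Prod>i=0..<n. h (A $$ (i, p i)))"
      using p el h_prod[of "{0..<n}" "\<lambda>i. A $$ (i, p i)"]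
      by (subst h_mult) (auto simp: sgn(2) intro!: prod_mem sgn(1))
    also have "(\<Prod>i=0..<n. h (A $$ (i, p i))) = (\<Prod>i=0..<n. map_mat h A $$ (i, p i))"
      using p A permutes_in_image[of p "{0..<n}"] by (intro prod.cong refl) auto
    finally show "h (signof p * (\<Prod>i=0..<n. A $$ (i, p i))) = signof p * (\<Prod>i=0..<n. map_mat h A $$ (i, p i))" .
  qed
  also have "\<dots> = det (map_mat h A)" by (rule det_def'[OF m, symmetric])
  finally show ?thesis .
qed

lemma one_mat_over: "mat_over S (1\<^sub>m n)"
  by (auto simp: mat_over_def one_mem zero_mem)

lemma map_mat_one: "map_mat h (1\<^sub>m n) = 1\<^sub>m n"
  by (intro eq_matI) (auto simp: h_one h_zero)

lemma scalar_prod_mem: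
  assumes "dim_vec x = dim_vec y" "vec_over S x" "vec_over S y"
  shows "x \<bullet> y \<in> S"
  using assms unfolding scalar_prod_def vec_over_def by (auto intro!: sum_mem mult_mem)

lemma h_scalar_prod:
  assumes "dim_vec x = dim_vec y" "vec_over S x" "vec_over S y"
  shows "h (x \<bullet> y) = map_vec h x \<bullet> map_vec h y"
  using assms unfolding scalar_prod_def vec_over_def
  by (subst h_sum) (auto intro!: sum.cong mult_mem simp: h_mult)

lemma mult_mat_over:
  assumes "dim_col A = dim_row B" "mat_over S A" "mat_over S B"
  shows "mat_over S (A * B)"
  using assms unfolding mat_over_def
  by (auto intro!: scalar_prod_mem simp: vec_over_def)

lemma map_mat_mult:
  assumes "dim_col A = dim_row B" "mat_over S A" "mat_over S B"
  shows "map_mat h (A * B) = map_mat h A * map_mat h B"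
proof (rule eq_matI)
  fix i j assume ij: "i < dim_row (map_mat h A * map_mat h B)" "j < dim_col (map_mat h A * map_mat h B)"
  then have "h (row A i \<bullet> col B j) = map_vec h (row A i) \<bullet> map_vec h (col B j)"
    using assms by (intro h_scalar_prod) (auto simp: vec_over_def mat_over_def)
  moreover have "row (map_mat h A) i = map_vec h (row A i)" using ij by (intro eq_vecI) auto
  moreover have "col (map_mat h B) j = map_vec h (col B j)" using ij by (intro eq_vecI) auto
  ultimately show "map_mat h (A * B) $$ (i, j) = (map_mat h A * map_mat h B) $$ (i, j)"
    using ij by simp
qed auto

lemma mult_vec_over:
  assumes "dim_col A = dim_vec x" "mat_over S A" "vec_over S x"
  shows "vec_over S (A *\<^sub>v x)"
  using assms unfolding mat_over_def
  by (auto intro!: scalar_prod_mem simp: vec_over_def)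

lemma adj_mat_over:
  assumes "A \<in> carrier_mat n n" "mat_over S A"
  shows "mat_over S (adj_mat A)"
proof -
  have "det (mat_delete A j i) \<in> S" if "i < n" "j < n" for i j
  proof (rule det_mem)
    show "mat_delete A j i \<in> carrier_mat (n - 1) (n - 1)" using assms(1) by (simp add: mat_delete_def)
    show "mat_over S (mat_delete A j i)"
      using assms that by (auto simp: mat_over_def mat_delete_def)
  qed
  moreover have "(-1) ^ k \<in> S" for k
    by (cases "even k") (auto simp: one_mem uminus_mem)
  ultimately show ?thesis
    using assms(1) by (auto simp: mat_over_def adj_mat_def cofactor_def intro!: mult_mem)
qed

text \<open>
  A characteristic polynomial is a determinant over the polynomial ring, so compatibility of the
  homomorphism with determinants, applied to polynomials with coefficients in the subring, gives
  compatibility with characteristic polynomials.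
\<close>

lemma partial_hom_poly: "partial_hom {p. \<forall>i. Polynomial.coeff p i \<in> S} (map_poly h)"
proof
  fix p q assume p: "p \<in> {p. \<forall>i. Polynomial.coeff p i \<in> S}" and q: "q \<in> {p. \<forall>i. Polynomial.coeff p i \<in> S}"
  show "p * q \<in> {p. \<forall>i. Polynomial.coeff p i \<in> S}"
    using p q by (auto simp: coeff_mult intro!: sum_mem mult_mem)
  show "map_poly h (p + q) = map_poly h p + map_poly h q"
    using p q by (intro poly_eqI) (simp add: coeff_map_poly h_zero h_add)
  show "map_poly h (p * q) = map_poly h p * map_poly h q"
    using p q by (intro poly_eqI)
      (auto simp: coeff_map_poly h_zero coeff_mult h_sum h_mult mult_mem)
qed (auto simp: one_mem zero_mem add_mem uminus_mem h_one h_zero coeff_1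
       intro!: poly_eqI simp: coeff_map_poly split: if_splits)

lemma map_poly_char_poly:
  assumes A: "A \<in> carrier_mat n n" and S: "mat_over S A"
  shows "map_poly h (char_poly A) = char_poly (map_mat h A)"
proof -
  interpret P: partial_hom "{p. \<forall>i. Polynomial.coeff p i \<in> S}" "map_poly h" by (rule partial_hom_poly)
  have "map_poly h (char_poly A) = det (map_mat (map_poly h) (char_poly_matrix A))"
    unfolding char_poly_def
  proof (rule P.h_det)
    show "char_poly_matrix A \<in> carrier_mat n n" using A by simp
    show "mat_over {p. \<forall>i. Polynomial.coeff p i \<in> S} (char_poly_matrix A)"
      using A S by (auto simp: char_poly_matrix_def mat_over_def coeff_pCons
        intro!: zero_mem one_mem add_mem uminus_mem split: nat.splits)
  qed
  also have "map_mat (map_poly h) (char_poly_matrix A) = char_poly_matrix (map_mat h A)"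
    using A S by (intro eq_matI poly_eqI)
      (auto simp: char_poly_matrix_def mat_over_def coeff_map_poly h_zero coeff_pCons h_uminus h_one
        split: nat.splits)
  finally show ?thesis by (simp add: char_poly_def)
qed

end

section \<open>Discretely valued fields and lattices\<close>

lemma smult_smult_mat: "a \<cdot>\<^sub>m (b \<cdot>\<^sub>m A) = (a * b) \<cdot>\<^sub>m (A :: 'a::semigroup_mult mat)"
  by (intro eq_matI) (auto simp: mult.assoc)

lemma one_smult_mat: "1 \<cdot>\<^sub>m A = (A :: 'a::monoid_mult mat)"
  by (intro eq_matI) auto

text \<open>
  With \<open>S\<close> a valuation ring, this says that a lattice contains the span of any of its vectors; with
  \<open>S\<close> the whole field and \<open>P\<close> the identity matrix, it becomes an induction rule for coordinate
  vectors.
\<close>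

lemma mult_mat_vec_mem:
  fixes P :: "'a::comm_semiring_1 mat"
  assumes P: "P \<in> carrier_mat n n" and M: "M \<subseteq> carrier_vec n" "0\<^sub>v n \<in> M"
    and add: "\<And>x y. x \<in> M \<Longrightarrow> y \<in> M \<Longrightarrow> x + y \<in> M"
    and smult: "\<And>c x. c \<in> S \<Longrightarrow> x \<in> M \<Longrightarrow> c \<cdot>\<^sub>v x \<in> M"
    and cols: "\<And>j. j < n \<Longrightarrow> col P j \<in> M"
    and y: "y \<in> carrier_vec n" "vec_over S y"
  shows "P *\<^sub>v y \<in> M"
proof -
  define w where "w j = P *\<^sub>v vec n (\<lambda>i. if i < j then y $ i else 0)" for j
  have "w j \<in> M" if "j \<le> n" for j
    using that
  proof (induction j)
    case 0
    have "w 0 = 0\<^sub>v n" using P by (intro eq_vecI) (auto simp: w_def scalar_prod_def)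
    then show ?case using M by simp
  next
    case (Suc j)
    have "w (Suc j) = w j + y $ j \<cdot>\<^sub>v col P j"
    proof (intro eq_vecI)
      fix i assume i: "i < dim_vec (w j + y $ j \<cdot>\<^sub>v col P j)"
      have "(\<Sum>k = 0..<n. P $$ (i, k) * (if k < Suc j then y $ k else 0))
         = (\<Sum>k = 0..<n. P $$ (i, k) * (if k < j then y $ k else 0) + (if k = j then y $ k * P $$ (i, k) else 0))"
        by (intro sum.cong) (auto simp: mult.commute)
      also have "\<dots> = (\<Sum>k = 0..<n. P $$ (i, k) * (if k < j then y $ k else 0)) + y $ j * P $$ (i, j)"
        using Suc.prems by (simp add: sum.distrib)
      finally show "w (Suc j) $ i = (w j + y $ j \<cdot>\<^sub>v col P j) $ i"
        using i P Suc.prems by (simp add: w_def scalar_prod_def)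
    qed (use P in \<open>simp add: w_def\<close>)
    then show ?case using Suc y by (auto intro!: add smult cols simp: vec_over_def)
  qed
  moreover have "w n = P *\<^sub>v y"
  proof -
    have "vec n (\<lambda>i. if i < n then y $ i else 0) = y" using y by (intro eq_vecI) auto
    then show ?thesis by (simp add: w_def)
  qed
  ultimately show ?thesis by force
qed

lemma det_nonzero_inverse:
  assumes P: "P \<in> carrier_mat n n" and det: "det P \<noteq> (0::'f::field)"
  obtains Q where "Q \<in> carrier_mat n n" "P * Q = 1\<^sub>m n" "Q * P = 1\<^sub>m n"
proof
  let ?Q = "inverse (det P) \<cdot>\<^sub>m adj_mat P"
  note adj = adj_mat[OF P]
  show "?Q \<in> carrier_mat n n" using adj by simp
  show "P * ?Q = 1\<^sub>m n" using adj P det by (simp add: mult_smult_distrib[of _ n n _ n] smult_smult_mat one_smult_mat)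
  show "?Q * P = 1\<^sub>m n" using adj P det by (simp add: mult_smult_assoc_mat[of _ n n _ n] smult_smult_mat one_smult_mat)
qed

locale valued_field =
  fixes v :: "'a::field_char_0 \<Rightarrow> int"
  assumes valuation: "discrete_valuation v"
begin

text \<open>
  These are the powers, positive and negative, of the maximal ideal.
\<close>

definition frac_ideal :: "int \<Rightarrow> 'a set" where
  "frac_ideal n = {x. x = 0 \<or> n \<le> v x}"

abbreviation \<O> :: "'a set" where "\<O> \<equiv> frac_ideal 0"

lemma v_mult: "x \<noteq> 0 \<Longrightarrow> y \<noteq> 0 \<Longrightarrow> v (x * y) = v x + v y"
  using valuation by (simp add: discrete_valuation_def)

lemma v_add: "x \<noteq> 0 \<Longrightarrow> y \<noteq> 0 \<Longrightarrow> x + y \<noteq> 0 \<Longrightarrow> min (v x) (v y) \<le> v (x + y)"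
  using valuation by (simp add: discrete_valuation_def)

lemma v_one: "v 1 = 0"
  using v_mult[of 1 1] by simp

lemma v_uminus: "v (- x) = v x"
proof (cases "x = 0")
  case False
  have "v (-1) = 0" using v_mult[of "-1" "-1"] v_one by simp
  then show ?thesis using v_mult[of "-1" x] False by simp
qed simp

lemma v_power: "x \<noteq> 0 \<Longrightarrow> v (x ^ n) = int n * v x"
  by (induction n) (auto simp: v_one v_mult algebra_simps)

lemma frac_ideal_zero: "0 \<in> frac_ideal n"
  by (simp add: frac_ideal_def)

lemma frac_ideal_add: "x \<in> frac_ideal n \<Longrightarrow> y \<in> frac_ideal n \<Longrightarrow> x + y \<in> frac_ideal n"
  using v_add[of x y] by (cases "x = 0"; cases "y = 0"; cases "x + y = 0") (auto simp: frac_ideal_def)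

lemma frac_ideal_uminus: "x \<in> frac_ideal n \<Longrightarrow> - x \<in> frac_ideal n"
  by (auto simp: frac_ideal_def v_uminus)

lemma frac_ideal_diff: "x \<in> frac_ideal n \<Longrightarrow> y \<in> frac_ideal n \<Longrightarrow> x - y \<in> frac_ideal n"
  using frac_ideal_add[of x n "- y"] frac_ideal_uminus[of y n] by simp

lemma frac_ideal_mult: "x \<in> frac_ideal m \<Longrightarrow> y \<in> frac_ideal n \<Longrightarrow> x * y \<in> frac_ideal (m + n)"
  by (cases "x = 0"; cases "y = 0") (auto simp: frac_ideal_def v_mult)

lemma frac_ideal_mono: "m \<le> n \<Longrightarrow> x \<in> frac_ideal n \<Longrightarrow> x \<in> frac_ideal m"
  by (auto simp: frac_ideal_def)

lemma frac_ideal_sum: "(\<And>i. i \<in> A \<Longrightarrow> f i \<in> frac_ideal n) \<Longrightarrow> sum f A \<in> frac_ideal n"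
  by (induction A rule: infinite_finite_induct) (auto simp: frac_ideal_zero frac_ideal_add)

lemma frac_ideal_Inter: "(\<And>n::nat. x \<in> frac_ideal (int n)) \<Longrightarrow> x = 0"
  by (rule ccontr, drule meta_spec[of _ "nat (\<bar>v x\<bar> + 1)"]) (auto simp: frac_ideal_def)

definition unif :: 'a where
  "unif = (SOME x. x \<noteq> 0 \<and> v x = 1)"

lemma unif: "unif \<noteq> 0" "v unif = 1"
proof -
  have "1 \<in> v ` {x. x \<noteq> 0}" using valuation by (simp add: discrete_valuation_def)
  then have "\<exists>x. x \<noteq> 0 \<and> v x = 1" by force
  from someI_ex[OF this] show "unif \<noteq> 0" "v unif = 1" by (auto simp: unif_def)
qed

lemma unif_power_mult: "unif ^ n * x \<in> frac_ideal (int n + m) \<longleftrightarrow> x \<in> frac_ideal m"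
  using unif by (cases "x = 0") (auto simp: frac_ideal_def v_mult v_power)

lemma unif_mult: "unif * x \<in> frac_ideal (1 + m) \<longleftrightarrow> x \<in> frac_ideal m"
  using unif_power_mult[of 1 x m] by simp

lemma unif_in: "unif ^ n \<in> frac_ideal (int n)"
  using unif by (auto simp: frac_ideal_def v_power)

lemma ex_unif_power_mult: "\<exists>c::nat. \<forall>x\<in>A. unif ^ c * x \<in> \<O>" if "finite A" for A
proof -
  define c where "c = nat (Max (insert 0 ((\<lambda>x. - v x) ` A)))"
  have "unif ^ c * x \<in> \<O>" if "x \<in> A" for x
  proof (cases "x = 0")
    case False
    have "- v x \<le> Max (insert 0 ((\<lambda>x. - v x) ` A))"
      using that \<open>finite A\<close> by (intro Max_ge) auto
    then have "- v x \<le> int c" by (simp add: c_def)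
    then show ?thesis using False unif by (simp add: frac_ideal_def v_mult v_power)
  qed (simp add: frac_ideal_zero)
  then show ?thesis by blast
qed

lemma mult_mat_frac:
  assumes "dim_col A = dim_row B" "mat_over (frac_ideal m) A" "mat_over (frac_ideal n) B"
  shows "mat_over (frac_ideal (m + n)) (A * B)"
  using assms unfolding mat_over_def
  by (auto intro!: frac_ideal_sum frac_ideal_mult simp: scalar_prod_def)

lemma mult_vec_frac:
  assumes "dim_col A = dim_vec x" "mat_over (frac_ideal m) A" "vec_over (frac_ideal n) x"
  shows "vec_over (frac_ideal (m + n)) (A *\<^sub>v x)"
  using assms unfolding mat_over_def vec_over_def
  by (auto intro!: frac_ideal_sum frac_ideal_mult simp: scalar_prod_def)

end

locale dvr_reduction = valued_field v
  for v :: "'a::field_char_0 \<Rightarrow> int" +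
  fixes r :: "'a \<Rightarrow> 'k::field"
  assumes hom: "partial_hom \<O> r"
    and r_eq_0_iff: "\<And>x. x \<in> \<O> \<Longrightarrow> r x = 0 \<longleftrightarrow> x \<in> frac_ideal 1"
    and lift_residue: "\<And>y. \<exists>x\<in>\<O>. r x = y"

sublocale dvr_reduction \<subseteq> partial_hom \<O> r
  by (rule hom)

context dvr_reduction
begin

lemma of_nat_in_O: "of_nat n \<in> \<O>"
  using of_int_mem[of "int n"] by simp

text \<open>
  Among the invertible matrices whose columns lie in \<open>M\<close>, one whose determinant has least valuation
  is a basis: if some coordinate of a vector \<open>x\<close> of \<open>M\<close> were not integral, then replacing the
  corresponding column by \<open>x\<close> would multiply the determinant by that coordinate, by Cramer's rule,
  and lower its valuation. The common denominator of \<open>M\<close> bounds these valuations from below.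
\<close>

lemma lattice_has_basis:
  assumes M: "M \<subseteq> carrier_vec n" "0\<^sub>v n \<in> M"
    and add: "\<And>x y. x \<in> M \<Longrightarrow> y \<in> M \<Longrightarrow> x + y \<in> M"
    and smult: "\<And>c x. c \<in> \<O> \<Longrightarrow> x \<in> M \<Longrightarrow> c \<cdot>\<^sub>v x \<in> M"
    and bounded: "\<And>x. x \<in> M \<Longrightarrow> vec_over \<O> (unif ^ c \<cdot>\<^sub>v x)"
    and P0: "P0 \<in> carrier_mat n n" "det P0 \<noteq> 0" "\<And>j. j < n \<Longrightarrow> col P0 j \<in> M"
  obtains P where "P \<in> carrier_mat n n" "det P \<noteq> 0"
    "\<And>x. x \<in> M \<longleftrightarrow> (\<exists>y\<in>carrier_vec n. vec_over \<O> y \<and> x = P *\<^sub>v y)"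
proof -
  let ?S = "\<lambda>P. P \<in> carrier_mat n n \<and> det P \<noteq> 0 \<and> (\<forall>j<n. col P j \<in> M)"
  define \<mu> where "\<mu> P = nat (v (det (unif ^ c \<cdot>\<^sub>m P)))" for P :: "'a mat"
  have \<mu>: "int (\<mu> P) = int c * int n + v (det P)" if "?S P" for P
  proof -
    have "mat_over \<O> (unif ^ c \<cdot>\<^sub>m P)"
      unfolding mat_over_def
    proof (intro allI impI)
      fix i j assume "i < dim_row (unif ^ c \<cdot>\<^sub>m P)" "j < dim_col (unif ^ c \<cdot>\<^sub>m P)"
      then show "(unif ^ c \<cdot>\<^sub>m P) $$ (i, j) \<in> \<O>"
        using bounded[of "col P j"] that by (auto simp: vec_over_def)
    qed
    then have "det (unif ^ c \<cdot>\<^sub>m P) \<in> \<O>"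
      using that by (intro det_mem[of _ n]) auto
    moreover have "det (unif ^ c \<cdot>\<^sub>m P) \<noteq> 0" using that unif by simp
    ultimately have "int (\<mu> P) = v (det (unif ^ c \<cdot>\<^sub>m P))"
      by (simp only: \<mu>_def frac_ideal_def) auto
    also have "\<dots> = v ((unif ^ c) ^ n * det P)" using that by auto
    also have "\<dots> = int c * int n + v (det P)"
      using that unif by (subst v_mult) (auto simp: v_power)
    finally show ?thesis .
  qed
  obtain P where P: "?S P" and min: "\<And>P'. ?S P' \<Longrightarrow> \<mu> P \<le> \<mu> P'"
    using ex_has_least_nat[of ?S P0 \<mu>] P0 by blast
  obtain Q where Q: "Q \<in> carrier_mat n n" "P * Q = 1\<^sub>m n" "Q * P = 1\<^sub>m n"
    using P det_nonzero_inverse[of P n] by blast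
  have "\<exists>y\<in>carrier_vec n. vec_over \<O> y \<and> x = P *\<^sub>v y" if x: "x \<in> M" for x
  proof (intro bexI conjI)
    let ?y = "Q *\<^sub>v x"
    have xc: "x \<in> carrier_vec n" using x M by blast
    show y: "?y \<in> carrier_vec n" using Q xc by simp
    show x_eq: "x = P *\<^sub>v ?y"
      using Q P xc by (simp add: assoc_mult_mat_vec[of P n n Q n x, symmetric])
    show "vec_over \<O> ?y"
    proof (rule ccontr)
      assume "\<not> vec_over \<O> ?y"
      then obtain k where k: "k < n" "?y $ k \<notin> \<O>" using Q by (auto simp: vec_over_def)
      then have yk: "?y $ k \<noteq> 0" "v (?y $ k) < 0" by (auto simp: frac_ideal_def)
      define P' where "P' = replace_col P x k"
      have det: "det P' = ?y $ k * det P"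
        using cramer_lemma_mat[of P n ?y k] P y k x_eq by (simp add: P'_def)
      have "col P' j = (if j = k then x else col P j)" if "j < n" for j
        using that P xc k by (intro eq_vecI) (auto simp: P'_def replace_col_def)
      then have S': "?S P'"
        using P x det yk by (auto simp: P'_def replace_col_def)
      show False
        using min[OF S'] \<mu>[OF S'] \<mu>[OF P] det yk P by (simp add: v_mult)
    qed
  qed
  moreover have "P *\<^sub>v y \<in> M" if "y \<in> carrier_vec n" "vec_over \<O> y" for y
    using P that M by (intro mult_mat_vec_mem[of P n M \<O>]) (auto intro: add smult)
  ultimately show ?thesis using that[of P] P by blast
qed

lemma unit_det_inverse_over:
  assumes U: "U \<in> carrier_mat n n" "mat_over \<O> U" and W: "W \<in> carrier_mat n n" "U * W = 1\<^sub>m n"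
    and det: "v (det U) \<le> 0"
  shows "mat_over \<O> W"
proof -
  have "det U * det W = 1" using det_mult[OF U(1) W(1)] W by simp
  then have nz: "det U \<noteq> 0" "det W \<noteq> 0" by auto
  have "det W \<in> \<O>"
    using det v_mult[OF nz] \<open>det U * det W = 1\<close> v_one by (simp add: frac_ideal_def)
  note adj = adj_mat[OF U(1)]
  have "adj_mat U = adj_mat U * (U * W)" using W adj by simp
  also have "\<dots> = adj_mat U * U * W"
    by (rule assoc_mult_mat[OF adj(1) U(1) W(1), symmetric])
  also have "\<dots> = det U \<cdot>\<^sub>m W" using adj W by (simp add: mult_smult_assoc_mat[of _ n n _ n])
  finally have "det W \<cdot>\<^sub>m adj_mat U = (det U * det W) \<cdot>\<^sub>m W"
    by (simp add: smult_smult_mat mult.commute)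
  then have W_eq: "W = det W \<cdot>\<^sub>m adj_mat U" using \<open>det U * det W = 1\<close> by (simp add: one_smult_mat)
  have "mat_over \<O> (det W \<cdot>\<^sub>m adj_mat U)"
    using adj_mat_over[OF U] \<open>det W \<in> \<O>\<close> by (auto simp: mat_over_def mult_mem)
  then show ?thesis using W_eq by simp
qed

end

section \<open>Groups acting on a lattice with a form\<close>

lemmas square_simps =
  mult_carrier_mat[of _ n n _ n for n] left_mult_one_mat[of _ n n for n] right_mult_one_mat[of _ n n for n]

lemma mult_mat_unit_vec:
  "A \<in> carrier_mat m n \<Longrightarrow> j < n \<Longrightarrow> A *\<^sub>v unit_vec n j = col A (j :: nat)" for A :: "'a::semiring_1 mat"
  by (intro eq_vecI) auto

lemma mat_eq_on_vecI:
  assumes "A \<in> carrier_mat m n" "B \<in> carrier_mat m n"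
    and eq: "\<And>x. x \<in> carrier_vec n \<Longrightarrow> A *\<^sub>v x = B *\<^sub>v x"
  shows "A = (B :: 'a::semiring_1 mat)"
proof (rule mat_col_eqI)
  show "col A j = col B j" if "j < dim_col B" for j
    using assms(1,2) that eq[of "unit_vec n j"] by (simp add: mult_mat_unit_vec[of _ m n])
qed (use assms in auto)

text \<open>
  The sign \<open>\<epsilon>\<close> lets one argument serve symmetric forms (\<open>\<epsilon> = 1\<close>) and alternating forms
  (\<open>\<epsilon> = -1\<close>).
\<close>

locale form_rep = group G for G :: "('g, 'm) monoid_scheme" (structure) +
  fixes n :: nat and R :: "'g \<Rightarrow> 'a::field mat" and F :: "'a mat" and \<epsilon> :: int
  assumes R_carrier: "g \<in> carrier G \<Longrightarrow> R g \<in> carrier_mat n n"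
    and R_one: "R \<one> = 1\<^sub>m n"
    and R_mult: "g \<in> carrier G \<Longrightarrow> h \<in> carrier G \<Longrightarrow> R (g \<otimes> h) = R g * R h"
    and F_carrier: "F \<in> carrier_mat n n"
    and F_det: "det F \<noteq> 0"
    and F_transpose: "transpose_mat F = of_int \<epsilon> \<cdot>\<^sub>m F"
    and invariant: "g \<in> carrier G \<Longrightarrow> transpose_mat (R g) * F * R g = F"
begin

lemma R_inv: "g \<in> carrier G \<Longrightarrow> R (inv g) * R g = 1\<^sub>m n"
  "g \<in> carrier G \<Longrightarrow> R g * R (inv g) = 1\<^sub>m n"
  by (simp_all flip: R_mult R_one)

lemma F_R: 
  assumes g: "g \<in> carrier G"
  shows "F * R g = transpose_mat (R (inv g)) * F"
proof -
  note [simp] = square_simps R_carrier[OF g] R_carrier[OF inv_closed[OF g]] F_carrier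
  have "transpose_mat (R (inv g)) * F = transpose_mat (R (inv g)) * (transpose_mat (R g) * F * R g)"
    using invariant[OF g] by simp
  also have "\<dots> = transpose_mat (R (inv g)) * transpose_mat (R g) * (F * R g)"
    by (simp add: assoc_mult_mat[of _ n n _ n _ n])
  also have "transpose_mat (R (inv g)) * transpose_mat (R g) = transpose_mat (R g * R (inv g))"
    by (simp add: transpose_mult[of _ n n _ n])
  finally show ?thesis using R_inv[OF g] by simp
qed

lemma conjugate:
  assumes P: "P \<in> carrier_mat n n" "Q \<in> carrier_mat n n" "P * Q = 1\<^sub>m n" "Q * P = 1\<^sub>m n"
  shows "form_rep G n (\<lambda>g. Q * R g * P) (transpose_mat P * F * P) \<epsilon>"
proof unfold_locales
  note PQ [simp] = square_simps P(1,2) F_carrier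
  have PQA: "P * (Q * A) = A" "Q * (P * A) = A" if "A \<in> carrier_mat n n" for A
    using that P by (simp_all flip: assoc_mult_mat[of _ n n _ n _ n])
  note assoc = assoc_mult_mat[of _ n n _ n _ n]
  have QPt: "transpose_mat Q * (transpose_mat P * A) = A" if "A \<in> carrier_mat n n" for A
  proof -
    have "transpose_mat Q * transpose_mat P = 1\<^sub>m n"
      using P by (simp flip: transpose_mult[of _ n n _ n])
    then show ?thesis using that by (simp flip: assoc)
  qed
  fix g assume g: "g \<in> carrier G"
  note Rg [simp] = square_simps R_carrier[OF g]
  show "Q * R g * P \<in> carrier_mat n n" by simp
  show "transpose_mat (Q * R g * P) * (transpose_mat P * F * P) * (Q * R g * P) = transpose_mat P * F * P"
  proof -
    have "transpose_mat (Q * R g * P) * (transpose_mat P * F * P) * (Q * R g * P)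
      = transpose_mat P * (transpose_mat (R g) * F * R g) * P"
      by (simp add: transpose_mult[of _ n n _ n] assoc PQA QPt)
    then show ?thesis using invariant[OF g] by simp
  qed
  fix h assume h: "h \<in> carrier G"
  note [simp] = square_simps R_carrier[OF h]
  show "Q * R (g \<otimes> h) * P = Q * R g * P * (Q * R h * P)"
    by (simp add: R_mult[OF g h] assoc PQA)
next
  note PQ [simp] = square_simps P F_carrier
  show "Q * R \<one> * P = 1\<^sub>m n" using P by (simp add: R_one)
  show "transpose_mat P * F * P \<in> carrier_mat n n" by simp
  have "det P \<noteq> 0" using det_mult[of P n Q] P by auto
  then show "det (transpose_mat P * F * P) \<noteq> 0"
    using F_det P by (simp add: det_mult[of _ n] det_transpose[of _ n])
  have "transpose_mat (transpose_mat P * F * P) = transpose_mat P * transpose_mat F * P"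
    by (simp add: transpose_mult[of _ n n _ n] assoc_mult_mat[of _ n n _ n _ n])
  also have "\<dots> = of_int \<epsilon> \<cdot>\<^sub>m (transpose_mat P * F * P)"
    by (simp add: F_transpose mult_smult_distrib[of _ n n _ n] mult_smult_assoc_mat[of _ n n _ n])
  finally show "transpose_mat (transpose_mat P * F * P) = of_int \<epsilon> \<cdot>\<^sub>m (transpose_mat P * F * P)" .
qed

end

context dvr_reduction
begin

text \<open>
  The columns of an admissible \<open>P\<close> are a basis of a lattice stable under the group on which the form
  takes integral values.
\<close>

definition admissible :: "('g, 'm) monoid_scheme \<Rightarrow> nat \<Rightarrow> ('g \<Rightarrow> 'a mat) \<Rightarrow> 'a mat \<Rightarrow> 'a mat \<Rightarrow> bool" where
  "admissible G n R F P \<longleftrightarrow> P \<in> carrier_mat n n \<and> det P \<noteq> 0 \<and>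
     (\<forall>g\<in>carrier G. \<exists>X\<in>carrier_mat n n. mat_over \<O> X \<and> R g * P = P * X) \<and>
     mat_over \<O> (transpose_mat P * F * P)"

text \<open>
  The standard lattice is admissible and maximal among the admissible lattices. Admissible lattices
  are compared by the valuation of the determinant of a basis; a minimal one is maximal for
  inclusion.
\<close>

definition reduced_rep :: "('g, 'm) monoid_scheme \<Rightarrow> nat \<Rightarrow> ('g \<Rightarrow> 'a mat) \<Rightarrow> 'a mat \<Rightarrow> int \<Rightarrow> bool" where
  "reduced_rep G n R F \<epsilon> \<longleftrightarrow> form_rep G n R F \<epsilon> \<and> (\<forall>g\<in>carrier G. mat_over \<O> (R g)) \<and>
     mat_over \<O> F \<and> (\<forall>Q. admissible G n R F Q \<longrightarrow> 0 \<le> v (det Q))"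

lemma smult_unif_over:
  assumes "finite A" "\<And>a. a \<in> A \<Longrightarrow> a \<in> carrier_mat n n"
  shows "\<exists>c::nat. \<forall>a\<in>A. mat_over \<O> (unif ^ c \<cdot>\<^sub>m a)"
proof -
  have "finite ((\<lambda>(a, i, j). a $$ (i, j)) ` (A \<times> {..<n} \<times> {..<n}))" (is "finite ?E")
    using assms(1) by auto
  from ex_unif_power_mult[OF this] obtain c where c: "\<And>x. x \<in> ?E \<Longrightarrow> unif ^ c * x \<in> \<O>" by blast
  have "mat_over \<O> (unif ^ c \<cdot>\<^sub>m a)" if "a \<in> A" for a
    unfolding mat_over_def
  proof (intro allI impI)
    fix i j assume "i < dim_row (unif ^ c \<cdot>\<^sub>m a)" "j < dim_col (unif ^ c \<cdot>\<^sub>m a)"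
    then have ij: "i < n" "j < n" using assms(2)[OF that] by auto
    then have "a $$ (i, j) \<in> ?E" using that by (auto intro!: image_eqI[where x = "(a, i, j)"])
    from c[OF this] show "(unif ^ c \<cdot>\<^sub>m a) $$ (i, j) \<in> \<O>" using ij assms(2)[OF that] by simp
  qed
  then show ?thesis by blast
qed

lemma columns_in_lattice:
  assumes A: "A \<in> carrier_mat n n" and P: "P \<in> carrier_mat n n"
    and cols: "\<And>j. j < n \<Longrightarrow> \<exists>y\<in>carrier_vec n. vec_over \<O> y \<and> col A j = P *\<^sub>v y"
  shows "\<exists>X\<in>carrier_mat n n. mat_over \<O> X \<and> A = P * X"
proof -
  obtain y where y: "\<And>j. j < n \<Longrightarrow> y j \<in> carrier_vec n"
    "\<And>j. j < n \<Longrightarrow> vec_over \<O> (y j)" "\<And>j. j < n \<Longrightarrow> col A j = P *\<^sub>v y j"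
    using cols by metis
  define X where "X = mat n n (\<lambda>(i, j). y j $ i)"
  have X: "X \<in> carrier_mat n n" by (simp add: X_def)
  have colX: "col X j = y j" if "j < n" for j
    using y[OF that] that by (intro eq_vecI) (auto simp: X_def)
  have "mat_over \<O> X"
    using y(1,2) by (fastforce simp: mat_over_def X_def vec_over_def)
  moreover have "A = P * X"
  proof (rule mat_col_eqI)
    fix j assume "j < dim_col (P * X)"
    then have j: "j < n" by (simp add: X_def)
    have "col A j = P *\<^sub>v col X j" using y(3)[OF j] colX[OF j] by simp
    also have "\<dots> = col (P * X) j" by (rule col_mult2[OF P X j, symmetric])
    finally show "col A j = col (P * X) j" .
  qed (use A P X in auto)
  ultimately show ?thesis using X by blast
qed

text \<open>
  The vectors whose whole orbit is integral are stable under the group, and they form a lattice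
  because the group is finite. Multiplying it by a power of the uniformizer makes the form integral.
\<close>

lemma admissible_exists:
  assumes "form_rep G n R F \<epsilon>" and fin: "finite (carrier G)"
  shows "\<exists>P. admissible G n R F P"
proof -
  interpret form_rep G n R F \<epsilon> by fact
  \<comment> \<open>the intersection of all translates of the standard lattice\<close>
  define M where "M = {x \<in> carrier_vec n. \<forall>g\<in>carrier G. vec_over \<O> (R g *\<^sub>v x)}"
  from smult_unif_over[of "R ` carrier G" n] obtain c
    where c: "\<And>g. g \<in> carrier G \<Longrightarrow> mat_over \<O> (unif ^ c \<cdot>\<^sub>m R g)"
    using fin R_carrier by auto
  define P0 where "P0 = unif ^ c \<cdot>\<^sub>m 1\<^sub>m n"
  have dim_R [simp]: "dim_row (R g) = n" "dim_col (R g) = n" if "g \<in> carrier G" for g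
    using R_carrier[OF that] by auto
  have "\<exists>P. P \<in> carrier_mat n n \<and> det P \<noteq> 0 \<and>
      (\<forall>x. x \<in> M \<longleftrightarrow> (\<exists>y\<in>carrier_vec n. vec_over \<O> y \<and> x = P *\<^sub>v y))"
  proof (rule lattice_has_basis[of M n 0 P0])
    show "M \<subseteq> carrier_vec n" by (auto simp: M_def)
    show "0\<^sub>v n \<in> M"
      by (auto simp: M_def vec_over_def scalar_prod_def frac_ideal_zero)
    show "x + y \<in> M" if "x \<in> M" "y \<in> M" for x y
    proof -
      have "R g *\<^sub>v (x + y) = R g *\<^sub>v x + R g *\<^sub>v y" if "g \<in> carrier G" for g
        using \<open>x \<in> M\<close> \<open>y \<in> M\<close> R_carrier[OF that]
        by (intro mult_add_distrib_mat_vec[of _ n n]) (auto simp: M_def)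
      then have "\<forall>g\<in>carrier G. vec_over \<O> (R g *\<^sub>v (x + y))"
        using that by (auto simp: M_def vec_over_def simp del: index_mult_mat_vec intro!: add_mem)
      then show ?thesis using that by (auto simp: M_def)
    qed
    show "k \<cdot>\<^sub>v x \<in> M" if "k \<in> \<O>" "x \<in> M" for k x
    proof -
      have "R g *\<^sub>v (k \<cdot>\<^sub>v x) = k \<cdot>\<^sub>v (R g *\<^sub>v x)" if "g \<in> carrier G" for g
        using \<open>x \<in> M\<close> R_carrier[OF that]
        by (intro mult_mat_vec[of _ n n]) (auto simp: M_def)
      then have "\<forall>g\<in>carrier G. vec_over \<O> (R g *\<^sub>v (k \<cdot>\<^sub>v x))"
        using that by (auto simp: M_def vec_over_def simp del: index_mult_mat_vec intro!: mult_mem)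
      then show ?thesis using that by (auto simp: M_def)
    qed
    show "vec_over \<O> (unif ^ 0 \<cdot>\<^sub>v x)" if "x \<in> M" for x
      using that R_one one_mem by (force simp: M_def)
    show "P0 \<in> carrier_mat n n" "det P0 \<noteq> 0" using unif by (simp_all add: P0_def)
    show "col P0 j \<in> M" if "j < n" for j
    proof -
      have "R g *\<^sub>v col P0 j = col (unif ^ c \<cdot>\<^sub>m R g) j" if g: "g \<in> carrier G" for g
      proof -
        have "R g *\<^sub>v col P0 j = col (R g * P0) j"
          using R_carrier[OF g] \<open>j < n\<close> by (simp add: P0_def col_mult2[of _ n n _ n])
        also have "R g * P0 = unif ^ c \<cdot>\<^sub>m R g"
          using R_carrier[OF g] by (simp add: P0_def mult_smult_distrib[of _ n n _ n])
        finally show ?thesis .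
      qed
      then show ?thesis
        using c that by (auto simp: M_def mat_over_def vec_over_def P0_def)
    qed
  qed blast
  then obtain P where P: "P \<in> carrier_mat n n" "det P \<noteq> 0"
    and M: "\<And>x. x \<in> M \<longleftrightarrow> (\<exists>y\<in>carrier_vec n. vec_over \<O> y \<and> x = P *\<^sub>v y)" by blast
  have colM: "col P j \<in> M" if "j < n" for j
    unfolding M
    using that P by (intro bexI[of _ "unit_vec n j"] conjI)
      (auto simp: mult_mat_unit_vec[of P n n] vec_over_def index_unit_vec(1) one_mem zero_mem)
  have stable: "R g *\<^sub>v x \<in> M" if "x \<in> M" "g \<in> carrier G" for x g
    using that R_carrier[OF that(2)]
    by (auto simp: M_def R_mult[symmetric] simp flip: assoc_mult_mat_vec[OF R_carrier R_carrier])
  have "\<exists>X\<in>carrier_mat n n. mat_over \<O> X \<and> R g * P = P * X" if "g \<in> carrier G" for g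
  proof (rule columns_in_lattice)
    show "\<exists>y\<in>carrier_vec n. vec_over \<O> y \<and> col (R g * P) j = P *\<^sub>v y" if "j < n" for j
      using stable[OF colM[OF that] \<open>g \<in> carrier G\<close>] unfolding M
      by (simp only: col_mult2[OF R_carrier[OF \<open>g \<in> carrier G\<close>] P(1) that])
  qed (use P R_carrier[OF that] in \<open>auto simp: square_simps\<close>)
  then obtain X where X: "\<And>g. g \<in> carrier G \<Longrightarrow> X g \<in> carrier_mat n n \<and> mat_over \<O> (X g) \<and> R g * P = P * X g"
    by metis
  from smult_unif_over[of "{transpose_mat P * F * P}" n] obtain d
    where d: "mat_over \<O> (unif ^ d \<cdot>\<^sub>m (transpose_mat P * F * P))"
    using P F_carrier by auto
  \<comment> \<open>scaling the basis by \<open>unif ^ d\<close> multiplies the Gram matrix by \<open>unif ^ (2 * d)\<close>\<close>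
  define P' where "P' = unif ^ d \<cdot>\<^sub>m P"
  have P': "P' \<in> carrier_mat n n" "det P' \<noteq> 0" using P unif by (simp_all add: P'_def)
  have "transpose_mat P' * F * P' = unif ^ d \<cdot>\<^sub>m (unif ^ d \<cdot>\<^sub>m (transpose_mat P * F * P))"
  proof -
    have "transpose_mat P' = unif ^ d \<cdot>\<^sub>m transpose_mat P" by (intro eq_matI) (auto simp: P'_def)
    then show ?thesis
      using P F_carrier
      by (simp add: P'_def mult_smult_assoc_mat[of _ n n _ n] mult_smult_distrib[of _ n n _ n])
  qed
  moreover have "unif ^ d \<in> \<O>" using unif_in[of d] frac_ideal_mono[of 0 "int d"] by auto
  ultimately have "mat_over \<O> (transpose_mat P' * F * P')"
    using d by (auto simp: mat_over_def intro: mult_mem)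
  moreover have "R g * P' = P' * X g" if "g \<in> carrier G" for g
    using X[OF that] P R_carrier[OF that]
    by (simp add: P'_def mult_smult_assoc_mat[of _ n n _ n] mult_smult_distrib[of _ n n _ n])
  ultimately have "admissible G n R F P'"
    using P' X unfolding admissible_def by blast
  then show ?thesis by blast
qed

lemma admissible_conjugate:
  assumes "form_rep G n R F \<epsilon>"
    and P: "P \<in> carrier_mat n n" "P' \<in> carrier_mat n n" "P * P' = 1\<^sub>m n"
    and Q: "admissible G n (\<lambda>g. P' * R g * P) (transpose_mat P * F * P) Q"
  shows "admissible G n R F (P * Q)"
proof -
  interpret form_rep G n R F \<epsilon> by fact
  note assoc = assoc_mult_mat[of _ n n _ n _ n]
  have Qc: "Q \<in> carrier_mat n n" "det Q \<noteq> 0" using Q by (auto simp: admissible_def)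
  note [simp] = square_simps P(1,2) Qc(1) F_carrier
  have dP: "det P \<noteq> 0" using det_mult[of P n P'] P by auto
  have "\<exists>X\<in>carrier_mat n n. mat_over \<O> X \<and> R g * (P * Q) = P * Q * X" if g: "g \<in> carrier G" for g
  proof -
    note [simp] = square_simps R_carrier[OF g]
    obtain X where X: "X \<in> carrier_mat n n" "mat_over \<O> X" "P' * R g * P * Q = Q * X"
      using Q g by (auto simp: admissible_def)
    have "P * Q * X = P * (P' * R g * P * Q)" using X by (simp add: assoc)
    also have "\<dots> = (P * P') * (R g * P * Q)" by (simp add: assoc)
    also have "\<dots> = R g * (P * Q)" by (simp add: P(3) assoc)
    finally show ?thesis using X by (intro bexI[of _ X]) auto
  qed
  moreover have "transpose_mat (P * Q) * F * (P * Q) = transpose_mat Q * (transpose_mat P * F * P) * Q"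
    by (simp add: transpose_mult[of _ n n _ n] assoc)
  ultimately show ?thesis
    using Q Qc dP by (simp add: admissible_def det_mult[of _ n])
qed

text \<open>
  An integral Gram matrix has a determinant of nonnegative valuation, so the valuations of the
  determinants of admissible bases are bounded below.
\<close>

lemma reduced_rep_exists:
  assumes "form_rep G n R F \<epsilon>" and fin: "finite (carrier G)"
  obtains P P' where "P \<in> carrier_mat n n" "P' \<in> carrier_mat n n" "P * P' = 1\<^sub>m n" "P' * P = 1\<^sub>m n"
    "reduced_rep G n (\<lambda>g. P' * R g * P) (transpose_mat P * F * P) \<epsilon>"
proof -
  interpret form_rep G n R F \<epsilon> by fact
  define \<mu> where "\<mu> P = nat (v (det (transpose_mat P * F * P)))" for P
  have \<mu>: "int (\<mu> P) = 2 * v (det P) + v (det F)" if "admissible G n R F P" for P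
  proof -
    have P: "P \<in> carrier_mat n n" "det P \<noteq> 0" using that by (auto simp: admissible_def)
    have "det (transpose_mat P * F * P) = det P * det F * det P"
      using P F_carrier by (simp add: det_mult[of _ n] det_transpose[of _ n])
    moreover have "v (det P * det F * det P) = 2 * v (det P) + v (det F)"
      using P F_det by (simp add: v_mult)
    moreover have "det (transpose_mat P * F * P) \<in> \<O>"
      using that P F_carrier by (intro det_mem[of _ n]) (auto simp: admissible_def)
    ultimately show ?thesis
      using P F_det by (simp add: \<mu>_def frac_ideal_def)
  qed
  obtain P where P: "admissible G n R F P"
    and min: "\<And>Q. admissible G n R F Q \<Longrightarrow> \<mu> P \<le> \<mu> Q"
    using admissible_exists[OF assms] ex_has_least_nat[of "admissible G n R F" _ \<mu>] by blast
  have Pc [simp]: "P \<in> carrier_mat n n" and dP: "det P \<noteq> 0" using P by (auto simp: admissible_def)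
  obtain P' where P': "P' \<in> carrier_mat n n" "P * P' = 1\<^sub>m n" "P' * P = 1\<^sub>m n"
    using det_nonzero_inverse[OF Pc dP] by blast
  have "mat_over \<O> (P' * R g * P)" if g: "g \<in> carrier G" for g
  proof -
    obtain X where X: "X \<in> carrier_mat n n" "mat_over \<O> X" "R g * P = P * X"
      using P g by (auto simp: admissible_def)
    have "P' * R g * P = P' * (P * X)"
      using X(3) P' R_carrier[OF g] by (simp add: assoc_mult_mat[of _ n n _ n _ n])
    also have "\<dots> = P' * P * X" by (rule assoc_mult_mat[OF P'(1) Pc X(1), symmetric])
    finally have "P' * R g * P = P' * P * X" .
    then show ?thesis using X P' by simp
  qed
  moreover have "0 \<le> v (det Q)" if Q: "admissible G n (\<lambda>g. P' * R g * P) (transpose_mat P * F * P) Q" for Q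
  proof -
    have PQ: "admissible G n R F (P * Q)"
      using admissible_conjugate[OF assms(1) Pc P'(1,2) Q] .
    have "Q \<in> carrier_mat n n" "det Q \<noteq> 0" using Q by (auto simp: admissible_def)
    then have "v (det (P * Q)) = v (det P) + v (det Q)"
      using dP by (simp add: det_mult[of _ n] v_mult)
    then show ?thesis using min[OF PQ] \<mu>[OF PQ] \<mu>[OF P] by simp
  qed
  ultimately have "reduced_rep G n (\<lambda>g. P' * R g * P) (transpose_mat P * F * P) \<epsilon>"
    using P conjugate[OF Pc P'] by (auto simp: reduced_rep_def admissible_def)
  then show ?thesis using that Pc P' by blast
qed

lemma reduced_rep_conjugate:
  assumes red: "reduced_rep G n R F \<epsilon>"
    and U: "U \<in> carrier_mat n n" "mat_over \<O> U"
    and W: "W \<in> carrier_mat n n" "mat_over \<O> W" "U * W = 1\<^sub>m n" "W * U = 1\<^sub>m n"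
  shows "reduced_rep G n (\<lambda>g. W * R g * U) (transpose_mat U * F * U) \<epsilon>"
proof -
  interpret form_rep G n R F \<epsilon> using red by (simp add: reduced_rep_def)
  note [simp] = square_simps U(1) W(1) F_carrier
  have Ut: "mat_over \<O> (transpose_mat U)" using U by (auto simp: mat_over_def)
  have "det U * det W = 1" using det_mult[of U n W] W by simp
  then have nz: "det U \<noteq> 0" "det W \<noteq> 0" by auto
  have "det U \<in> \<O>" "det W \<in> \<O>" using U W by (auto intro: det_mem[of _ n])
  then have vU: "v (det U) = 0"
    using nz v_mult[OF nz] v_one \<open>det U * det W = 1\<close> by (auto simp: frac_ideal_def)
  have "0 \<le> v (det Q)" if Q: "admissible G n (\<lambda>g. W * R g * U) (transpose_mat U * F * U) Q" for Q
  proof -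
    have "admissible G n R F (U * Q)"
      using admissible_conjugate[OF form_rep_axioms U(1) W(1,3) Q] .
    then have "0 \<le> v (det (U * Q))" using red by (simp add: reduced_rep_def)
    moreover have "Q \<in> carrier_mat n n" "det Q \<noteq> 0" using Q by (auto simp: admissible_def)
    ultimately show ?thesis using nz vU by (simp add: det_mult[of _ n] v_mult)
  qed
  moreover have "mat_over \<O> (W * R g * U)" if "g \<in> carrier G" for g
  proof (intro mult_mat_over)
    show "dim_col (W * R g) = dim_row U" "dim_col W = dim_row (R g)"
      using carrier_matD[OF W(1)] carrier_matD[OF U(1)] carrier_matD[OF R_carrier[OF that]] by simp_all
  qed (use red that U W in \<open>auto simp: reduced_rep_def\<close>)
  moreover have "mat_over \<O> (transpose_mat U * F * U)"
  proof (intro mult_mat_over)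
    show "dim_col (transpose_mat U * F) = dim_row U" "dim_col (transpose_mat U) = dim_row F"
      using carrier_matD[OF F_carrier] carrier_matD[OF U(1)] by simp_all
  qed (use red U Ut in \<open>auto simp: reduced_rep_def\<close>)
  ultimately show ?thesis
    using conjugate[OF U(1) W(1,3,4)] by (auto simp: reduced_rep_def)
qed

end

section \<open>Maximal integral lattices are almost self-dual\<close>

context dvr_reduction
begin

lemma scalar_prod_frac:
  assumes "dim_vec x = dim_vec y" "vec_over (frac_ideal m) x" "vec_over (frac_ideal n) y"
  shows "x \<bullet> y \<in> frac_ideal (m + n)"
  using assms by (auto simp: scalar_prod_def vec_over_def intro!: frac_ideal_sum frac_ideal_mult)

text \<open>
  Let \<open>L\<close> be the standard lattice and \<open>\<pi>\<close> the uniformizer. The vectors \<open>t\<close> of \<open>\<pi>\<^sup>-\<^sup>1 L\<close> with \<open>F t\<close> in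
  \<open>\<pi> L\<close> can be added to \<open>L\<close> without leaving the stable lattices on which the form is integral:
  products of two such vectors are integral since the denominator of one is cancelled by \<open>F\<close> applied
  to the other. Maximality puts them into \<open>L\<close>, which is the assertion for \<open>x = \<pi> t\<close>. It is
  equivalent to the inclusion of \<open>\<pi>\<close> times the dual lattice in \<open>L\<close>.
\<close>

lemma reduced_rep_primitive:
  assumes red: "reduced_rep G n R F \<epsilon>"
    and x: "x \<in> carrier_vec n" "vec_over \<O> x" "vec_over (frac_ideal 2) (F *\<^sub>v x)"
  shows "vec_over (frac_ideal 1) x"
proof -
  interpret form_rep G n R F \<epsilon> using red by (simp add: reduced_rep_def)
  have F: "mat_over \<O> F" using red by (simp add: reduced_rep_def)
  have Rin: "mat_over \<O> (R g)" if "g \<in> carrier G" for g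
    using red that by (simp add: reduced_rep_def)
  define T where "T = {t \<in> carrier_vec n. vec_over (frac_ideal (-1)) t \<and> vec_over (frac_ideal 1) (F *\<^sub>v t)}"
  define Z where "Z = {z \<in> carrier_vec n. vec_over \<O> z}"
  \<comment> \<open>the enlarged lattice, which maximality will show to be the standard one\<close>
  define M where "M = {z + t | z t. z \<in> Z \<and> t \<in> T}"
  have Zc: "z \<in> carrier_vec n" if "z \<in> Z" for z using that by (simp add: Z_def)
  have Tc: "t \<in> carrier_vec n" if "t \<in> T" for t using that by (simp add: T_def)
  have F0: "F *\<^sub>v 0\<^sub>v n = 0\<^sub>v n" using F_carrier by (intro eq_vecI) auto
  have zero: "0\<^sub>v n \<in> Z" "0\<^sub>v n \<in> T"
    using carrier_matD[OF F_carrier]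
    by (auto simp: Z_def T_def F0 vec_over_def frac_ideal_zero simp del: index_mult_mat_vec)
  have ZM: "z \<in> M" if "z \<in> Z" for z
    unfolding M_def using that zero Zc[OF that] by (intro CollectI exI[of _ z] exI[of _ "0\<^sub>v n"]) auto
  have TM: "t \<in> M" if "t \<in> T" for t
    unfolding M_def using that zero Tc[OF that] by (intro CollectI exI[of _ t] exI[of _ "0\<^sub>v n"]) auto
  have addZ: "a + b \<in> Z" if "a \<in> Z" "b \<in> Z" for a b
    using that by (auto simp: Z_def vec_over_def add_mem)
  have addT: "a + b \<in> T" if "a \<in> T" "b \<in> T" for a b
  proof -
    have "F *\<^sub>v (a + b) = F *\<^sub>v a + F *\<^sub>v b"
      using that Tc F_carrier by (simp add: mult_add_distrib_mat_vec[of _ n n])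
    then show ?thesis
      using that F_carrier
      by (auto simp: T_def vec_over_def simp del: index_mult_mat_vec intro!: frac_ideal_add)
  qed
  have smultZ: "k \<cdot>\<^sub>v a \<in> Z" if "k \<in> \<O>" "a \<in> Z" for k a
    using that by (auto simp: Z_def vec_over_def mult_mem)
  have smultT: "k \<cdot>\<^sub>v a \<in> T" if "k \<in> \<O>" "a \<in> T" for k a
  proof -
    have "F *\<^sub>v (k \<cdot>\<^sub>v a) = k \<cdot>\<^sub>v (F *\<^sub>v a)"
      using that Tc F_carrier by (simp add: mult_mat_vec[of _ n n])
    moreover have "k * y \<in> frac_ideal s" if "y \<in> frac_ideal s" for y s
      using frac_ideal_mult[OF \<open>k \<in> \<O>\<close> that] by simp
    ultimately show ?thesis
      using that F_carrier by (auto simp: T_def vec_over_def simp del: index_mult_mat_vec)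
  qed
  have Mc: "M \<subseteq> carrier_vec n" using Zc Tc by (auto simp: M_def)
  have "\<exists>Q. Q \<in> carrier_mat n n \<and> det Q \<noteq> 0 \<and>
      (\<forall>x. x \<in> M \<longleftrightarrow> (\<exists>y\<in>carrier_vec n. vec_over \<O> y \<and> x = Q *\<^sub>v y))"
  proof (rule lattice_has_basis[of M n 1 "1\<^sub>m n"])
    show "M \<subseteq> carrier_vec n" by (rule Mc)
    show "0\<^sub>v n \<in> M" using ZM zero by blast
    show "a + b \<in> M" if ab: "a \<in> M" "b \<in> M" for a b
    proof -
      obtain z t z' t' where "a = z + t" "b = z' + t'" and m: "z \<in> Z" "t \<in> T" "z' \<in> Z" "t' \<in> T"
        using ab by (auto simp: M_def)
      then have "a + b = (z + z') + (t + t')"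
        using Zc[OF m(1)] Zc[OF m(3)] Tc[OF m(2)] Tc[OF m(4)] by (intro eq_vecI) auto
      then show ?thesis unfolding M_def using addZ addT m by blast
    qed
    show "k \<cdot>\<^sub>v a \<in> M" if k: "k \<in> \<O>" and a: "a \<in> M" for k a
    proof -
      obtain z t where "a = z + t" and m: "z \<in> Z" "t \<in> T" using a by (auto simp: M_def)
      then have "k \<cdot>\<^sub>v a = k \<cdot>\<^sub>v z + k \<cdot>\<^sub>v t"
        using Zc[OF m(1)] Tc[OF m(2)] by (simp add: smult_add_distrib_vec[of _ n])
      then show ?thesis unfolding M_def using smultZ smultT m k by blast
    qed
    show "vec_over \<O> (unif ^ 1 \<cdot>\<^sub>v a)" if a: "a \<in> M" for a
    proof -
      obtain z t where a_eq: "a = z + t" and m: "z \<in> Z" "t \<in> T" using a by (auto simp: M_def)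
      have "unif * (z $ i + t $ i) \<in> \<O>" if "i < n" for i
      proof -
        have "z $ i \<in> frac_ideal (-1)" "t $ i \<in> frac_ideal (-1)"
          using m that frac_ideal_mono[of "-1" 0] by (auto simp: Z_def T_def vec_over_def)
        then show ?thesis using unif_mult[of "z $ i + t $ i" "-1"] frac_ideal_add by simp
      qed
      then show ?thesis using a_eq Zc[OF m(1)] Tc[OF m(2)] by (auto simp: vec_over_def)
    qed
    show "col (1\<^sub>m n) j \<in> M" if "j < n" for j
      using that by (intro ZM) (auto simp: Z_def vec_over_def zero_mem one_mem)
  qed auto
  then obtain Q where Q: "Q \<in> carrier_mat n n" "det Q \<noteq> 0"
    and M: "\<And>x. x \<in> M \<longleftrightarrow> (\<exists>y\<in>carrier_vec n. vec_over \<O> y \<and> x = Q *\<^sub>v y)" by blast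
  have colM: "col Q j \<in> M" if "j < n" for j
    unfolding M using that Q by (intro bexI[of _ "unit_vec n j"] conjI)
      (auto simp: mult_mat_unit_vec[of Q n n] vec_over_def index_unit_vec(1) one_mem zero_mem)
  have stable: "R g *\<^sub>v w \<in> M" if g: "g \<in> carrier G" and w: "w \<in> M" for g w
  proof -
    have Rg: "mat_over \<O> (R g)" by (rule Rin[OF g])
    note Rc = R_carrier[OF g]
    obtain z t where w_eq: "w = z + t" and m: "z \<in> Z" "t \<in> T" using w by (auto simp: M_def)
    have "R g *\<^sub>v w = R g *\<^sub>v z + R g *\<^sub>v t"
      unfolding w_eq using Zc[OF m(1)] Tc[OF m(2)] Rc by (simp add: mult_add_distrib_mat_vec[of _ n n])
    moreover have "R g *\<^sub>v z \<in> Z"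
    proof -
      have "vec_over \<O> (R g *\<^sub>v z)" using m Rc by (intro mult_vec_over Rg) (auto simp: Z_def)
      then show ?thesis using Rc Zc[OF m(1)] by (simp add: Z_def)
    qed
    moreover have "R g *\<^sub>v t \<in> T"
    proof -
      have "vec_over (frac_ideal (-1)) (R g *\<^sub>v t)"
      proof -
        have "vec_over (frac_ideal (0 + - 1)) (R g *\<^sub>v t)"
          using m Rc by (intro mult_vec_frac Rg) (auto simp: T_def)
        then show ?thesis by simp
      qed
      moreover have "F *\<^sub>v (R g *\<^sub>v t) = transpose_mat (R (inv\<^bsub>G\<^esub> g)) *\<^sub>v (F *\<^sub>v t)"
      proof -
        have "F *\<^sub>v (R g *\<^sub>v t) = F * R g *\<^sub>v t"
          by (rule assoc_mult_mat_vec[OF F_carrier Rc Tc[OF m(2)], symmetric])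
        also have "\<dots> = transpose_mat (R (inv\<^bsub>G\<^esub> g)) * F *\<^sub>v t" by (simp only: F_R[OF g])
        also have "\<dots> = transpose_mat (R (inv\<^bsub>G\<^esub> g)) *\<^sub>v (F *\<^sub>v t)"
          using R_carrier[OF inv_closed[OF g]] by (intro assoc_mult_mat_vec[OF _ F_carrier Tc[OF m(2)]]) simp
        finally show ?thesis .
      qed
      moreover have "mat_over \<O> (transpose_mat (R (inv\<^bsub>G\<^esub> g)))"
        using Rin[OF inv_closed[OF g]] by (simp add: mat_over_def)
      then have "vec_over (frac_ideal (0 + 1)) (transpose_mat (R (inv\<^bsub>G\<^esub> g)) *\<^sub>v (F *\<^sub>v t))"
        using m F_carrier R_carrier[OF inv_closed[OF g]] by (intro mult_vec_frac) (auto simp: T_def)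
      moreover have "R g *\<^sub>v t \<in> carrier_vec n" using Rc Tc[OF m(2)] by simp
      ultimately show ?thesis unfolding T_def by simp
    qed
    ultimately show ?thesis unfolding M_def by blast
  qed
  have form: "w \<bullet> (F *\<^sub>v w') \<in> \<O>" if w: "w \<in> M" "w' \<in> M" for w w'
  proof -
    obtain z t z' t' where eq: "w = z + t" "w' = z' + t'" and m: "z \<in> Z" "t \<in> T" "z' \<in> Z" "t' \<in> T"
      using w by (auto simp: M_def)
    note c = Zc[OF m(1)] Zc[OF m(3)] Tc[OF m(2)] Tc[OF m(4)]
    have dims: "dim_vec z = dim_vec (F *\<^sub>v z')" "dim_vec z = dim_vec (F *\<^sub>v t')"
      "dim_vec (F *\<^sub>v t) = dim_vec z'" "dim_vec t = dim_vec (F *\<^sub>v t')"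
      using c F_carrier by auto
    note [simp] = c F_carrier
    have Fz: "vec_over \<O> (F *\<^sub>v z')" and Ft: "vec_over (frac_ideal 1) (F *\<^sub>v t')" "vec_over (frac_ideal 1) (F *\<^sub>v t)"
      and t: "vec_over (frac_ideal (-1)) t" and z: "vec_over \<O> z" "vec_over \<O> z'"
    proof -
      show "vec_over \<O> (F *\<^sub>v z')"
      proof (rule mult_vec_over[OF _ F])
        show "dim_col F = dim_vec z'" by (simp only: carrier_matD(2)[OF F_carrier] carrier_vecD[OF c(2)])
      qed (use m in \<open>simp add: Z_def\<close>)
    qed (use m in \<open>simp_all add: T_def Z_def\<close>)
    have "F *\<^sub>v w' = F *\<^sub>v z' + F *\<^sub>v t'" by (simp add: eq mult_add_distrib_mat_vec[of _ n n])
    then have "w \<bullet> (F *\<^sub>v w') = z \<bullet> (F *\<^sub>v z') + z \<bullet> (F *\<^sub>v t') + (t \<bullet> (F *\<^sub>v z') + t \<bullet> (F *\<^sub>v t'))"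
      using mult_mat_vec_carrier[OF F_carrier Zc[OF m(3)]] mult_mat_vec_carrier[OF F_carrier Tc[OF m(4)]]
      by (simp add: eq add_scalar_prod_distrib[of _ n] scalar_prod_add_distrib[of _ n])
    moreover have "t \<bullet> (F *\<^sub>v z') = of_int \<epsilon> * ((F *\<^sub>v t) \<bullet> z')"
    proof -
      have "t \<bullet> (F *\<^sub>v z') = (transpose_mat F *\<^sub>v t) \<bullet> z'"
        by (rule transpose_vec_mult_scalar[OF F_carrier c(2,3), symmetric])
      also have "transpose_mat F *\<^sub>v t = of_int \<epsilon> \<cdot>\<^sub>v (F *\<^sub>v t)"
      proof -
        have "dim_vec t = dim_col F" by (simp only: carrier_vecD[OF c(3)] carrier_matD(2)[OF F_carrier])
        then show ?thesis
          unfolding F_transpose by (intro eq_vecI) (auto simp: scalar_prod_def sum_distrib_left mult.assoc)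
      qed
      finally show ?thesis
        using mult_mat_vec_carrier[OF F_carrier Tc[OF m(2)]] by (simp add: smult_scalar_prod_distrib[of _ n])
    qed
    moreover have "z \<bullet> (F *\<^sub>v z') \<in> \<O>" by (rule scalar_prod_mem[OF dims(1) z(1) Fz])
    moreover have "z \<bullet> (F *\<^sub>v t') \<in> frac_ideal (0 + 1)"
      by (rule scalar_prod_frac[OF dims(2) z(1) Ft(1)])
    moreover have "(F *\<^sub>v t) \<bullet> z' \<in> frac_ideal (1 + 0)"
      by (rule scalar_prod_frac[OF dims(3) Ft(2) z(2)])
    moreover have "t \<bullet> (F *\<^sub>v t') \<in> frac_ideal (-1 + 1)"
      by (rule scalar_prod_frac[OF dims(4) t Ft(1)])
    moreover have "y \<in> \<O>" if "y \<in> frac_ideal 1" for y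
      using frac_ideal_mono[OF _ that, of 0] by simp
    ultimately show ?thesis by (simp add: add_mem mult_mem of_int_mem)
  qed
  have "admissible G n R F Q"
    unfolding admissible_def
  proof (intro conjI ballI)
    fix g assume g: "g \<in> carrier G"
    show "\<exists>X\<in>carrier_mat n n. mat_over \<O> X \<and> R g * Q = Q * X"
    proof (rule columns_in_lattice)
      show "\<exists>y\<in>carrier_vec n. vec_over \<O> y \<and> col (R g * Q) j = Q *\<^sub>v y" if "j < n" for j
        using stable[OF g colM[OF that]] unfolding M
        by (simp only: col_mult2[OF R_carrier[OF g] Q(1) that])
    qed (use Q R_carrier[OF g] in \<open>auto simp: square_simps\<close>)
  next
    have "(transpose_mat Q * F * Q) $$ (i, j) = col Q i \<bullet> (F *\<^sub>v col Q j)" if "i < n" "j < n" for i j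
    proof -
      have "transpose_mat Q * F * Q = transpose_mat Q * (F * Q)"
        using Q F_carrier by (simp add: assoc_mult_mat[of _ n n _ n _ n])
      also have "\<dots> $$ (i, j) = col Q i \<bullet> col (F * Q) j"
        using that Q F_carrier by (subst index_mult_mat) auto
      also have "col (F * Q) j = F *\<^sub>v col Q j" by (rule col_mult2[OF F_carrier Q(1) that(2)])
      finally show ?thesis .
    qed
    moreover have "dim_row (transpose_mat Q * F * Q) = n" "dim_col (transpose_mat Q * F * Q) = n"
      using Q by simp_all
    ultimately show "mat_over \<O> (transpose_mat Q * F * Q)"
      using form colM by (simp only: mat_over_def) simp
  qed (use Q in auto)
  then have detQ: "0 \<le> v (det Q)" using red by (simp add: reduced_rep_def)
  have "\<exists>Y\<in>carrier_mat n n. mat_over \<O> Y \<and> 1\<^sub>m n = Q * Y"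
  proof (rule columns_in_lattice)
    have "unit_vec n j \<in> M" if "j < n" for j
      using that by (intro ZM) (auto simp: Z_def vec_over_def index_unit_vec(1) zero_mem one_mem)
    then show "\<exists>y\<in>carrier_vec n. vec_over \<O> y \<and> col (1\<^sub>m n) j = Q *\<^sub>v y" if "j < n" for j
      using M that by auto
  qed (use Q in auto)
  then obtain Y where Y: "Y \<in> carrier_mat n n" "mat_over \<O> Y" "Q * Y = 1\<^sub>m n" by metis
  have "det Q * det Y = 1" using det_mult[OF Q(1) Y(1)] Y by simp
  moreover have "det Y \<noteq> 0" using calculation by auto
  ultimately have "v (det Y) \<le> 0" using detQ v_mult[OF Q(2), of "det Y"] v_one by simp
  then have Qint: "mat_over \<O> Q"
    using Y Q mat_mult_left_right_inverse[OF Q(1) Y(1,3)] by (intro unit_det_inverse_over[of Y n Q]) auto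
  let ?t = "inverse unif \<cdot>\<^sub>v x"
  have shift: "inverse unif * y \<in> frac_ideal s \<longleftrightarrow> y \<in> frac_ideal (1 + s)" for y s
    using unif_mult[of "inverse unif * y" s] unif by (simp flip: mult.assoc)
  have "?t \<in> T"
    using x F_carrier shift[of _ 1] shift[of _ "-1"] mult_mat_vec[OF F_carrier x(1), of "inverse unif"]
    by (auto simp: T_def vec_over_def simp del: index_mult_mat_vec)
  then obtain y where y: "y \<in> carrier_vec n" "vec_over \<O> y" "?t = Q *\<^sub>v y" using TM M by blast
  then have "vec_over \<O> ?t" using Q mult_vec_over[OF _ Qint, of y] by auto
  then show ?thesis using x shift[of _ 0] by (auto simp: vec_over_def)
qed

end

section \<open>Torsion elements that are unipotent modulo the maximal ideal\<close>

text \<open>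
  This is the binomial theorem for \<open>(1 + u)\<^sup>n u\<^sup>i\<close> read off one entry at a time, so that it can be
  used for matrices, whose type is not a ring.
\<close>

lemma binomial_shift_sum:
  fixes t :: "nat \<Rightarrow> nat \<Rightarrow> 'a::comm_ring_1"
  assumes step: "\<And>n i. t (Suc n) i = t n i + t n (Suc i)"
  shows "t n i = (\<Sum>k\<le>n. of_nat (n choose k) * t 0 (i + k))"
proof (induction n arbitrary: i)
  case (Suc n)
  have "(\<Sum>k\<le>Suc n. of_nat (Suc n choose k) * t 0 (i + k))
      = t 0 i + (\<Sum>k\<le>n. of_nat (Suc n choose Suc k) * t 0 (i + Suc k))"
    by (subst sum.atMost_Suc_shift) simp
  also have "(\<Sum>k\<le>n. of_nat (Suc n choose Suc k) * t 0 (i + Suc k))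
      = (\<Sum>k\<le>n. of_nat (n choose k) * t 0 (Suc i + k)) + (\<Sum>k\<le>n. of_nat (n choose Suc k) * t 0 (i + Suc k))"
    by (simp add: sum.distrib algebra_simps)
  also have "(\<Sum>k\<le>n. of_nat (n choose Suc k) * t 0 (i + Suc k)) = t n i - t 0 i"
    using sum.atMost_Suc_shift[of "\<lambda>k. of_nat (n choose k) * t 0 (i + k)" n] Suc[of i]
    by (simp add: binomial_eq_0 algebra_simps)
  finally show ?case using Suc[of "Suc i"] by (simp add: step)
qed simp

lemma mat_pow_add:
  assumes [simp]: "A \<in> carrier_mat n n"
  shows "A ^\<^sub>m (i + j) = A ^\<^sub>m i * A ^\<^sub>m (j :: nat)"
  using carrier_matD[OF assms]
  by (induction j) (simp_all add: square_simps pow_carrier_mat[of _ n] assoc_mult_mat[of _ n n _ n _ n, symmetric])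

context dvr_reduction
begin

text \<open>
  Write \<open>Y = 1 + U\<close>. The binomial expansion of \<open>Y\<^sup>p U\<^sup>i = U\<^sup>i\<close> expresses \<open>p U\<^sup>i\<^sup>+\<^sup>1\<close> by
  integer multiples of \<open>p U\<^sup>i\<^sup>+\<^sup>k\<close> with \<open>1 < k < p\<close> and by \<open>U\<^sup>i\<^sup>+\<^sup>p\<close>. Let \<open>U\<close> be divisible by the
  \<open>s\<close>-th power of the uniformizer. Every two further factors \<open>U\<close> gain one power, so \<open>U\<^sup>1\<^sup>+\<^sup>k\<close>
  gains at least one for \<open>k \<ge> 2\<close>, and \<open>U\<^sup>1\<^sup>+\<^sup>p\<close> gains at least \<open>v(p) + 1\<close> by the bound on \<open>p\<close>.
  The relation for \<open>i = 1\<close> thus makes \<open>U\<^sup>2\<close> divisible by the power \<open>s + 1\<close>, and the relation for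
  \<open>i = 0\<close> then does the same for \<open>U\<close>. So \<open>U\<close> is divisible by all powers and vanishes. Primes that
  are units, with \<open>v(p) = 0\<close>, and the residue characteristic are treated alike.
\<close>

lemma unipotent_torsion_trivial:
  assumes p: "prime p" "2 * v (of_nat p) + 2 \<le> int p"
    and Y: "Y \<in> carrier_mat n n" "mat_over \<O> Y" and Yp: "Y ^\<^sub>m p = 1\<^sub>m n"
    and sq: "mat_over (frac_ideal 1) ((Y - 1\<^sub>m n) * (Y - 1\<^sub>m n))"
  shows "Y = 1\<^sub>m n"
proof -
  define U where "U = Y - 1\<^sub>m n"
  have U [simp]: "U \<in> carrier_mat n n" unfolding U_def by (rule minus_carrier_mat) simp
  note [simp] = Y(1) square_simps pow_carrier_mat[of _ n]
  have Y_eq: "Y = U + 1\<^sub>m n" using carrier_matD[OF Y(1)] by (intro eq_matI) (auto simp: U_def)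
  have p0: "of_nat p \<noteq> (0::'a)" using p(1) by (auto simp: prime_gt_0_nat)
  define e where "e = nat (v (of_nat p))"
  have e: "int e = v (of_nat p)"
    using of_nat_in_O[of p] p0 by (simp add: e_def frac_ideal_def)
  \<comment> \<open>this is where the ramification bound enters: a power \<open>U ^ p\<close> gains more than \<open>p\<close> itself\<close>
  have p_e: "2 * e + 2 \<le> p" using p(2) e by linarith
  \<comment> \<open>\<open>D s i\<close> says that \<open>U ^ i\<close> is divisible by the \<open>s\<close>-th power of the uniformizer\<close>
  define D where "D s i \<longleftrightarrow> mat_over (frac_ideal (int s)) (U ^\<^sub>m i)" for s i :: nat
  have D_entry: "(U ^\<^sub>m i) $$ (a, b) \<in> frac_ideal (int s)" if "D s i" "a < n" "b < n" for s i a b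
    using that carrier_matD[OF pow_carrier_mat[OF U, of i]] by (simp add: D_def mat_over_def del: pow_mat_dim)
  have D_add: "D (s + s') (i + i')" if "D s i" "D s' i'" for s s' i i'
  proof -
    have "mat_over (frac_ideal (int s + int s')) (U ^\<^sub>m i * U ^\<^sub>m i')"
      using that carrier_matD[OF U] by (intro mult_mat_frac) (auto simp: D_def)
    moreover have "U ^\<^sub>m i * U ^\<^sub>m i' = U ^\<^sub>m (i + i')"
      by (rule mat_pow_add[symmetric, of _ n]) simp
    ultimately show ?thesis by (simp add: D_def)
  qed
  have D1: "D 0 1"
    using Y(2) carrier_matD[OF Y(1)]
    by (auto simp: D_def U_def mat_over_def intro!: frac_ideal_diff zero_mem one_mem)
  have D2: "D 1 2" using sq by (simp add: D_def U_def[symmetric] numeral_2_eq_2)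
  have D_even: "D k (2 * k)" for k
  proof (induction k)
    case (Suc k) then show ?case using D_add[OF Suc D2] by simp
  qed (auto simp: D_def one_mat_over)
  have D0: "D 0 i" for i
  proof (induction i)
    case (Suc i) then show ?case using D_add[OF Suc D1] by simp
  qed (auto simp: D_def one_mat_over)
  have D_up: "D (s + k) (i + j)" if "D s i" "2 * k \<le> j" for s i j k
    using D_add[OF that(1) D_add[OF D_even[of k] D0[of "j - 2 * k"]]] that(2) by simp

  \<comment> \<open>entrywise binomial expansion of \<open>Y ^ p * U ^ i = U ^ i\<close>\<close>
  have rel: "(\<Sum>k\<in>{1..p}. of_nat (p choose k) * (U ^\<^sub>m (i + k)) $$ (a, b)) = 0"
    if ab: "a < n" "b < n" for i a b
  proof -
    define t where "t m i = (Y ^\<^sub>m m * U ^\<^sub>m i) $$ (a, b)" for m i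
    have "t (Suc m) i = t m i + t m (Suc i)" for m i
    proof -
      have "Y ^\<^sub>m Suc m * U ^\<^sub>m i = Y ^\<^sub>m m * ((U + 1\<^sub>m n) * U ^\<^sub>m i)"
        by (simp add: assoc_mult_mat[of _ n n _ n _ n] flip: Y_eq)
      also have "(U + 1\<^sub>m n) * U ^\<^sub>m i = U ^\<^sub>m Suc i + U ^\<^sub>m i"
      proof -
        have "U ^\<^sub>m 1 = U" using carrier_matD(1)[OF U] left_mult_one_mat[OF U] by simp
        then have "U * U ^\<^sub>m i = U ^\<^sub>m Suc i" using mat_pow_add[OF U, of 1 i] by simp
        then show ?thesis by (simp add: add_mult_distrib_mat[of _ n n _ _ n] del: pow_mat.simps)
      qed
      also have "Y ^\<^sub>m m * \<dots> = Y ^\<^sub>m m * U ^\<^sub>m Suc i + Y ^\<^sub>m m * U ^\<^sub>m i"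
        by (rule mult_add_distrib_mat[of _ n n _ n]) auto
      finally show ?thesis
        using ab carrier_matD[OF U] carrier_matD[OF Y(1)] by (simp add: t_def)
    qed
    from binomial_shift_sum[of t, OF this, of p i]
    have "t p i = (\<Sum>k\<le>p. of_nat (p choose k) * t 0 (i + k))" .
    also have "\<dots> = t 0 i + (\<Sum>k\<in>{1..p}. of_nat (p choose k) * t 0 (i + k))"
      by (simp add: sum.atLeast_Suc_atMost atMost_atLeast0)
    finally have "t p i = t 0 i + (\<Sum>k\<in>{1..p}. of_nat (p choose k) * t 0 (i + k))" .
    moreover have "Y ^\<^sub>m 0 = 1\<^sub>m n" using carrier_matD(1)[OF Y(1)] by simp
    ultimately show ?thesis using Yp by (simp add: t_def del: pow_mat.simps)
  qed

  \<comment> \<open>solving the relation for its leading term \<open>p * U ^ (i + 1)\<close>\<close>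
  have solve: "D s (i + 1)"
    if mid: "\<And>k. 2 \<le> k \<Longrightarrow> k < p \<Longrightarrow> D s (i + k)" and last: "D (s + e) (i + p)" for s i
    unfolding D_def mat_over_def
  proof (intro allI impI)
    fix a b assume "a < dim_row (U ^\<^sub>m (i + 1))" "b < dim_col (U ^\<^sub>m (i + 1))"
    then have ab: "a < n" "b < n" by (simp_all only: carrier_matD[OF pow_carrier_mat[OF U]])
    define x where "x = (U ^\<^sub>m (i + 1)) $$ (a, b)"
    have p1: "{1..p} = insert 1 {2..p}" using prime_ge_2_nat[OF p(1)] by auto
    have "of_nat p * x = - (\<Sum>k\<in>{2..p}. of_nat (p choose k) * (U ^\<^sub>m (i + k)) $$ (a, b))"
      using rel[OF ab, of i] unfolding p1 by (simp add: x_def eq_neg_iff_add_eq_0)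
    also have "\<dots> \<in> frac_ideal (int s + int e)"
    proof (intro frac_ideal_uminus frac_ideal_sum)
      fix k assume k: "k \<in> {2..p}"
      show "of_nat (p choose k) * (U ^\<^sub>m (i + k)) $$ (a, b) \<in> frac_ideal (int s + int e)"
      proof (cases "k = p")
        case True
        then show ?thesis using D_entry[OF last ab] by simp
      next
        case False
        then have "p dvd (p choose k)" using k p by (intro dvd_choose_prime) auto
        then obtain c where c: "p choose k = p * c" by blast
        have "of_nat p * of_nat c \<in> frac_ideal (int e + 0)"
          using e by (intro frac_ideal_mult of_nat_in_O) (auto simp: frac_ideal_def)
        moreover have "(U ^\<^sub>m (i + k)) $$ (a, b) \<in> frac_ideal (int s)"
          using mid[of k] False k by (intro D_entry ab) auto
        ultimately have "of_nat p * of_nat c * (U ^\<^sub>m (i + k)) $$ (a, b) \<in> frac_ideal ((int e + 0) + int s)"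
          by (rule frac_ideal_mult)
        then show ?thesis by (simp add: c add.commute)
      qed
    qed
    finally have "of_nat p * x \<in> frac_ideal (int s + int e)" .
    then show "(U ^\<^sub>m (i + 1)) $$ (a, b) \<in> frac_ideal (int s)"
      using p0 e by (cases "x = 0") (auto simp: frac_ideal_def v_mult x_def)
  qed
  have D_all: "D s 1" for s
  proof (induction s)
    case (Suc s)
    have "D (Suc s) (1 + 1)"
    proof (rule solve)
      show "D (Suc s) (1 + k)" if "2 \<le> k" for k
        using D_up[OF Suc, of 1 k] that by simp
      show "D (Suc s + e) (1 + p)" using D_up[OF Suc, of "e + 1" p] p_e by simp
    qed
    then have D2': "D (Suc s) 2" by (simp add: numeral_2_eq_2)
    have "D (Suc s) (0 + 1)"
    proof (rule solve)
      show "D (Suc s) (0 + k)" if "2 \<le> k" for k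
        using D_up[OF D2', of 0 "k - 2"] le_add_diff_inverse[OF that] by simp
      show "D (Suc s + e) (0 + p)" using D_up[OF D2', of e "p - 2"] p_e le_add_diff_inverse[of 2 p] by simp
    qed
    then show ?case by simp
  qed (rule D1)
  have "U $$ (a, b) = 0" if "a < n" "b < n" for a b
    using D_entry[OF D_all that] U by (intro frac_ideal_Inter) simp
  then show ?thesis using carrier_matD[OF U] unfolding Y_eq by (intro eq_matI) auto
qed

end

section \<open>The two residual blocks\<close>

text \<open>
  Choose an invertible \<open>U\<close> with as many trailing columns in the kernel as possible. A kernel vector
  with a nonzero coordinate among the first \<open>m\<close> could replace that column, and be swapped to
  position \<open>m - 1\<close>.
\<close>

lemma kernel_adapted_basis:
  assumes A: "A \<in> carrier_mat n n"
  obtains U :: "'f::field mat" and m where "U \<in> carrier_mat n n" "det U \<noteq> 0" "m \<le> n"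
    "\<And>j. m \<le> j \<Longrightarrow> j < n \<Longrightarrow> A *\<^sub>v col U j = 0\<^sub>v n"
    "\<And>y i. y \<in> carrier_vec n \<Longrightarrow> A *\<^sub>v (U *\<^sub>v y) = 0\<^sub>v n \<Longrightarrow> i < m \<Longrightarrow> y $ i = 0"
proof -
  define P where "P m \<longleftrightarrow> m \<le> n \<and> (\<exists>U\<in>carrier_mat n n. det U \<noteq> 0 \<and>
     (\<forall>j. m \<le> j \<longrightarrow> j < n \<longrightarrow> A *\<^sub>v col U j = 0\<^sub>v n))" for m
  have "P n" unfolding P_def by (intro conjI bexI[of _ "1\<^sub>m n"]) auto
  define m where "m = (LEAST m. P m)"
  have "P m" unfolding m_def using \<open>P n\<close> by (rule LeastI)
  then obtain U where U: "U \<in> carrier_mat n n" "det U \<noteq> 0" "m \<le> n"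
    and ker: "\<And>j. m \<le> j \<Longrightarrow> j < n \<Longrightarrow> A *\<^sub>v col U j = 0\<^sub>v n" by (auto simp: P_def)
  have "y $ i = 0" if y: "y \<in> carrier_vec n" "A *\<^sub>v (U *\<^sub>v y) = 0\<^sub>v n" and i: "i < m" for y i
  proof (rule ccontr)
    assume yi: "y $ i \<noteq> 0"
    define U' where "U' = replace_col U (U *\<^sub>v y) i"
    have U': "U' \<in> carrier_mat n n" using U by (auto simp: U'_def replace_col_def)
    have dU': "det U' \<noteq> 0"
      using cramer_lemma_mat[of U n y i] U y i yi by (simp add: U'_def)
    have colU': "col U' j = (if j = i then U *\<^sub>v y else col U j)" if "j < n" for j
      using that U y i by (intro eq_vecI) (auto simp: U'_def replace_col_def)
    define U'' where "U'' = (if i = m - 1 then U' else mat_swapcols i (m - 1) U')"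
    have U'': "U'' \<in> carrier_mat n n" using U' by (simp add: U''_def)
    have dU'': "det U'' \<noteq> 0"
      using dU' det_swapcols[of i n "m - 1" U'] U' i U by (auto simp: U''_def)
    have "A *\<^sub>v col U'' j = 0\<^sub>v n" if j: "m - 1 \<le> j" "j < n" for j
    proof (cases "j = m - 1")
      case True
      then have "col U'' j = U *\<^sub>v y"
      proof -
        have "col U'' j = col U' i" using True U' i j U by (intro eq_vecI) (auto simp: U''_def)
        then show ?thesis using colU'[of i] i U by simp
      qed
      then show ?thesis using y by simp
    next
      case False
      then have "j \<noteq> i" using i j by linarith
      have "col U'' j = col U j"
      proof -
        have "col U'' j = col U' j" using False U' i j U by (intro eq_vecI) (auto simp: U''_def)
        then show ?thesis using colU'[OF j(2)] \<open>j \<noteq> i\<close> by simp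
      qed
      then show ?thesis using ker[of j] False j by simp
    qed
    then have "P (m - 1)" using U U'' dU'' by (auto simp: P_def)
    then show False using not_less_Least[of "m - 1" P] i by (simp add: m_def[symmetric])
  qed
  then show ?thesis using that[OF U ker] by blast
qed

text \<open>
  For a matrix that is block triangular, this is the action on the associated graded space.
\<close>

definition block_diag_part :: "nat \<Rightarrow> 'a::zero mat \<Rightarrow> 'a mat" where
  "block_diag_part m A = mat (dim_row A) (dim_col A) (\<lambda>(i, j). if i < m \<longleftrightarrow> j < m then A $$ (i, j) else 0)"

lemma block_diag_part_carrier [simp]:
  "A \<in> carrier_mat n n' \<Longrightarrow> block_diag_part m A \<in> carrier_mat n n'"
  by (auto simp: block_diag_part_def)

text \<open>
  A permutation that does not preserve the initial block contributes zero to both determinants, and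
  one that does uses only entries of the two diagonal blocks.
\<close>

lemma det_block_diag_part:
  fixes A :: "'a::comm_ring_1 mat"
  assumes A: "A \<in> carrier_mat n n" and zero: "\<And>i j. i < m \<Longrightarrow> m \<le> j \<Longrightarrow> j < n \<Longrightarrow> A $$ (i, j) = 0"
    and mn: "m \<le> n"
  shows "det (block_diag_part m A) = det A"
proof -
  have "(\<Prod>i = 0..<n. block_diag_part m A $$ (i, p i)) = (\<Prod>i = 0..<n. A $$ (i, p i))"
    if p: "p permutes {0..<n}" for p
  proof (cases "p ` {..<m} \<subseteq> {..<m}")
    case True
    have inj: "inj p" using p by (rule permutes_inj)
    have "p ` {..<m} = {..<m}"
      using True by (intro endo_inj_surj) (auto intro: inj_on_subset[OF inj])
    then have "p i < m \<longleftrightarrow> i < m" for i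
      using inj by (metis imageE imageI injD lessThan_iff)
    then show ?thesis
      using A permutes_in_image[OF p] by (intro prod.cong) (auto simp: block_diag_part_def)
  next
    case False
    then obtain i where i: "i < m" "m \<le> p i" by (meson image_subsetI lessThan_iff not_less)
    then have "i < n" "p i < n" using mn permutes_in_image[OF p, of i] by auto
    then have "block_diag_part m A $$ (i, p i) = 0" "A $$ (i, p i) = 0"
      using i zero A by (auto simp: block_diag_part_def)
    then have "(\<Prod>i = 0..<n. block_diag_part m A $$ (i, p i)) = 0" "(\<Prod>i = 0..<n. A $$ (i, p i)) = 0"
      using \<open>i < n\<close> by (auto intro!: prod_zero)
    then show ?thesis by simp
  qed
  then show ?thesis
    using A by (simp add: det_def'[of _ n])
qed

lemma char_poly_block_diag_part:
  fixes A :: "'a::comm_ring_1 mat"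
  assumes A: "A \<in> carrier_mat n n" and zero: "\<And>i j. i < m \<Longrightarrow> m \<le> j \<Longrightarrow> j < n \<Longrightarrow> A $$ (i, j) = 0"
    and mn: "m \<le> n"
  shows "char_poly (block_diag_part m A) = char_poly A"
proof -
  have "char_poly_matrix (block_diag_part m A) = block_diag_part m (char_poly_matrix A)"
    using A by (intro eq_matI) (auto simp: char_poly_matrix_def block_diag_part_def)
  moreover have "det (block_diag_part m (char_poly_matrix A)) = det (char_poly_matrix A)"
    using A zero mn by (intro det_block_diag_part[of _ n]) (auto simp: char_poly_matrix_def)
  ultimately show ?thesis by (simp add: char_poly_def)
qed

lemma block_diag_part_mult:
  fixes A B :: "'a::comm_semiring_1 mat"
  assumes A: "A \<in> carrier_mat n n" "\<And>i j. i < m \<Longrightarrow> m \<le> j \<Longrightarrow> j < n \<Longrightarrow> A $$ (i, j) = 0"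
    and B: "B \<in> carrier_mat n n" "\<And>i j. i < m \<Longrightarrow> m \<le> j \<Longrightarrow> j < n \<Longrightarrow> B $$ (i, j) = 0"
  shows "block_diag_part m (A * B) = block_diag_part m A * block_diag_part m B"
proof (rule eq_matI)
  fix i j assume "i < dim_row (block_diag_part m A * block_diag_part m B)"
    "j < dim_col (block_diag_part m A * block_diag_part m B)"
  then have ij: "i < n" "j < n" using A B by (auto simp: block_diag_part_def)
  have "(block_diag_part m A * block_diag_part m B) $$ (i, j)
      = (\<Sum>k = 0..<n. block_diag_part m A $$ (i, k) * block_diag_part m B $$ (k, j))"
    using A B ij by (simp add: block_diag_part_def scalar_prod_def)
  also have "\<dots> = (\<Sum>k = 0..<n. if i < m \<longleftrightarrow> j < m then A $$ (i, k) * B $$ (k, j) else 0)"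
    using A B ij by (intro sum.cong) (auto simp: block_diag_part_def)
  also have "\<dots> = block_diag_part m (A * B) $$ (i, j)"
    using A B ij by (simp add: block_diag_part_def scalar_prod_def)
  finally show "block_diag_part m (A * B) $$ (i, j) = (block_diag_part m A * block_diag_part m B) $$ (i, j)"
    by simp
qed (use A B in \<open>auto simp: block_diag_part_def\<close>)

lemma triple_product_entry:
  fixes A F B :: "'a::comm_semiring_1 mat"
  assumes "A \<in> carrier_mat n n" "F \<in> carrier_mat n n" "B \<in> carrier_mat n n" "i < n" "j < n"
  shows "(transpose_mat A * F * B) $$ (i, j) = (\<Sum>l<n. \<Sum>k<n. A $$ (k, i) * F $$ (k, l) * B $$ (l, j))"
proof -
  have "(transpose_mat A * F) $$ (i, l) = (\<Sum>k<n. A $$ (k, i) * F $$ (k, l))" if "l < n" for l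
    using assms that by (simp add: scalar_prod_def lessThan_atLeast0)
  moreover have "(transpose_mat A * F * B) $$ (i, j) = (\<Sum>l<n. (transpose_mat A * F) $$ (i, l) * B $$ (l, j))"
    using assms by (subst index_mult_mat(1)) (auto simp: scalar_prod_def lessThan_atLeast0)
  ultimately show ?thesis by (simp add: sum_distrib_right)
qed

context dvr_reduction
begin

text \<open>
  An entrywise lift of an invertible matrix has a determinant that is a unit.
\<close>

lemma lift_invertible:
  assumes A: "A \<in> carrier_mat n n" "det A \<noteq> 0"
  obtains U W where "U \<in> carrier_mat n n" "mat_over \<O> U" "map_mat r U = A"
    "W \<in> carrier_mat n n" "mat_over \<O> W" "U * W = 1\<^sub>m n" "W * U = 1\<^sub>m n"
proof -
  obtain s where s: "\<And>y. s y \<in> \<O> \<and> r (s y) = y" using lift_residue by metis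
  define U where "U = map_mat s A"
  have U: "U \<in> carrier_mat n n" "mat_over \<O> U" using A s by (auto simp: U_def mat_over_def)
  have rU: "map_mat r U = A" using s A by (intro eq_matI) (auto simp: U_def)
  have "det U \<notin> frac_ideal 1"
    using r_eq_0_iff[of "det U"] h_det[OF U] det_mem[OF U] rU A by simp
  then have dU: "det U \<noteq> 0" "v (det U) \<le> 0" by (auto simp: frac_ideal_def)
  obtain W where W: "W \<in> carrier_mat n n" "U * W = 1\<^sub>m n" "W * U = 1\<^sub>m n"
    using det_nonzero_inverse[OF U(1) dU(1)] by blast
  show ?thesis
    using that[OF U rU W(1) unit_det_inverse_over[OF U W(1,2) dU(2)] W(2,3)] .
qed

lemma frac_ideal_1_mult: "x \<in> frac_ideal 1 \<Longrightarrow> y \<in> frac_ideal 1 \<Longrightarrow> x * y \<in> frac_ideal 2"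
  using frac_ideal_mult[of x 1 y 1] by simp

text \<open>
  If \<open>L\<close> is the lattice, \<open>L*\<close> its dual, and the basis is adapted to the radical \<open>\<pi> L* / \<pi> L\<close> of
  the form modulo the maximal ideal, then the first block is the form induced on \<open>L / \<pi> L*\<close> and the
  second one is the form \<open>\<pi>\<^sup>-\<^sup>1 f\<close> on \<open>\<pi> L* / \<pi> L\<close>.
\<close>

definition residual_form :: "nat \<Rightarrow> 'a mat \<Rightarrow> 'k mat" where
  "residual_form m F = mat (dim_row F) (dim_col F) (\<lambda>(i, j).
     if i < m \<and> j < m then r (F $$ (i, j))
     else if m \<le> i \<and> m \<le> j then r (F $$ (i, j) / unif) else 0)"

lemma div_unif: "x / unif \<in> frac_ideal s \<longleftrightarrow> x \<in> frac_ideal (1 + s)"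
  using unif_mult[of "x / unif" s] unif by simp

lemma r_frac_ideal_1: "x \<in> frac_ideal 1 \<Longrightarrow> r x = 0"
  using r_eq_0_iff frac_ideal_mono[of 0 1] by auto

text \<open>
  Reducing the expansion of \<open>A\<^sup>T F A = F\<close> term by term: in the first block every term that meets the
  second block of \<open>F\<close> vanishes, and in the second block, after division by the uniformizer, every
  term that meets the first block still has a factor from the maximal ideal.
\<close>

lemma residual_form_invariant:
  assumes F: "F \<in> carrier_mat n n" "mat_over \<O> F"
    and F1: "\<And>i j. i < n \<Longrightarrow> j < n \<Longrightarrow> m \<le> i \<or> m \<le> j \<Longrightarrow> F $$ (i, j) \<in> frac_ideal 1"
    and A: "A \<in> carrier_mat n n" "mat_over \<O> A"
    and A1: "\<And>i j. i < m \<Longrightarrow> m \<le> j \<Longrightarrow> j < n \<Longrightarrow> A $$ (i, j) \<in> frac_ideal 1"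
    and inv: "transpose_mat A * F * A = F"
  defines "A0 \<equiv> block_diag_part m (map_mat r A)"
  shows "transpose_mat A0 * residual_form m F * A0 = residual_form m F"
proof (rule eq_matI)
  let ?F0 = "residual_form m F"
  have c: "A0 \<in> carrier_mat n n" "?F0 \<in> carrier_mat n n"
    using A F by (auto simp: A0_def residual_form_def)
  fix i j assume "i < dim_row ?F0" "j < dim_col ?F0"
  then have ij: "i < n" "j < n" using F by (auto simp: residual_form_def)
  have Ain: "A $$ (k, l) \<in> \<O>" if "k < n" "l < n" for k l
    using A that by (auto simp: mat_over_def)
  have Fin: "F $$ (k, l) \<in> \<O>" if "k < n" "l < n" for k l
    using F that by (auto simp: mat_over_def)
  have A0: "A0 $$ (k, l) = (if k < m \<longleftrightarrow> l < m then r (A $$ (k, l)) else 0)" if "k < n" "l < n" for k l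
    using A that by (simp add: A0_def block_diag_part_def)
  have F0: "?F0 $$ (k, l) = (if k < m \<and> l < m then r (F $$ (k, l))
     else if m \<le> k \<and> m \<le> l then r (F $$ (k, l) / unif) else 0)" if "k < n" "l < n" for k l
    using F that by (simp add: residual_form_def)
  have F_ij: "F $$ (i, j) = (\<Sum>l<n. \<Sum>k<n. A $$ (k, i) * F $$ (k, l) * A $$ (l, j))"
    using triple_product_entry[OF A(1) F(1) A(1) ij] inv by simp
  have lhs: "(transpose_mat A0 * ?F0 * A0) $$ (i, j) = (\<Sum>l<n. \<Sum>k<n. A0 $$ (k, i) * ?F0 $$ (k, l) * A0 $$ (l, j))"
    by (rule triple_product_entry[OF c(1,2,1) ij])
  consider "i < m" "j < m" | "m \<le> i" "m \<le> j" | "i < m \<longleftrightarrow> \<not> j < m" by linarith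
  then show "(transpose_mat A0 * ?F0 * A0) $$ (i, j) = ?F0 $$ (i, j)"
  proof cases
    case 1
    have "?F0 $$ (i, j) = r (F $$ (i, j))" using 1 ij by (simp add: F0)
    also have "\<dots> = (\<Sum>l<n. \<Sum>k<n. r (A $$ (k, i) * F $$ (k, l) * A $$ (l, j)))"
    proof -
      have "r (\<Sum>k<n. A $$ (k, i) * F $$ (k, l) * A $$ (l, j)) = (\<Sum>k<n. r (A $$ (k, i) * F $$ (k, l) * A $$ (l, j)))"
        if "l < n" for l
        using that ij by (intro h_sum mult_mem Ain Fin) auto
      moreover have "r (\<Sum>l<n. \<Sum>k<n. A $$ (k, i) * F $$ (k, l) * A $$ (l, j))
          = (\<Sum>l<n. r (\<Sum>k<n. A $$ (k, i) * F $$ (k, l) * A $$ (l, j)))"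
        using ij by (intro h_sum sum_mem mult_mem Ain Fin) auto
      ultimately show ?thesis unfolding F_ij by simp
    qed
    also have "\<dots> = (\<Sum>l<n. \<Sum>k<n. A0 $$ (k, i) * ?F0 $$ (k, l) * A0 $$ (l, j))"
    proof (intro sum.cong refl)
      fix l k assume "l \<in> {..<n}" "k \<in> {..<n}"
      then have lk: "l < n" "k < n" by auto
      show "r (A $$ (k, i) * F $$ (k, l) * A $$ (l, j)) = A0 $$ (k, i) * ?F0 $$ (k, l) * A0 $$ (l, j)"
      proof (cases "k < m \<and> l < m")
        case True
        then show ?thesis using lk 1 ij by (simp add: A0 F0 h_mult mult_mem Ain Fin)
      next
        case False
        then have "r (F $$ (k, l)) = 0" using F1[OF lk(2,1)] by (intro r_frac_ideal_1) auto
        then show ?thesis using False lk 1 ij by (auto simp: A0 h_mult mult_mem Ain Fin)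
      qed
    qed
    finally show ?thesis using lhs by simp
  next
    case 2
    have entry: "A $$ (k, i) * F $$ (k, l) * A $$ (l, j) / unif \<in> \<O> \<and>
       r (A $$ (k, i) * F $$ (k, l) * A $$ (l, j) / unif) = A0 $$ (k, i) * ?F0 $$ (k, l) * A0 $$ (l, j)"
      if lk: "l < n" "k < n" for l k
    proof (cases "m \<le> k \<and> m \<le> l")
      case True
      then have "F $$ (k, l) / unif \<in> \<O>" using F1[OF lk(2,1)] by (simp add: div_unif)
      moreover have "A $$ (k, i) * F $$ (k, l) * A $$ (l, j) / unif = A $$ (k, i) * (F $$ (k, l) / unif) * A $$ (l, j)"
        by simp
      ultimately show ?thesis
        using lk 2 ij True by (simp only:) (simp add: A0 F0 h_mult mult_mem Ain del: times_divide_eq_right)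
    next
      case False
      have "A $$ (k, i) * F $$ (k, l) * A $$ (l, j) \<in> frac_ideal 2"
      proof -
        consider "k < m" "l < m" | "k < m" "m \<le> l" | "m \<le> k" "l < m" using False by linarith
        then show ?thesis
        proof cases
          case 1
          then have "A $$ (k, i) * A $$ (l, j) \<in> frac_ideal 2"
            using A1[of k i] A1[of l j] 2 ij by (intro frac_ideal_1_mult) auto
          from frac_ideal_mult[OF Fin[OF lk(2,1)] this] show ?thesis by (simp add: ac_simps)
        next
          case a: 2
          then have "A $$ (k, i) * F $$ (k, l) \<in> frac_ideal 2"
            using A1[of k i] F1[of k l] 2 ij lk by (intro frac_ideal_1_mult) auto
          from frac_ideal_mult[OF this Ain[OF lk(1) ij(2)]] show ?thesis by simp
        next
          case 3
          then have "F $$ (k, l) * A $$ (l, j) \<in> frac_ideal 2"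
            using A1[of l j] F1[of k l] 2 ij lk by (intro frac_ideal_1_mult) auto
          from frac_ideal_mult[OF Ain[OF lk(2) ij(1)] this] show ?thesis by (simp add: ac_simps)
        qed
      qed
      then have "A $$ (k, i) * F $$ (k, l) * A $$ (l, j) / unif \<in> frac_ideal 1"
        by (simp add: div_unif)
      moreover from this have "A $$ (k, i) * F $$ (k, l) * A $$ (l, j) / unif \<in> \<O>"
        using frac_ideal_mono[of 0 1] by simp
      ultimately show ?thesis
        using False lk 2 ij by (auto simp: r_frac_ideal_1 A0)
    qed
    have "?F0 $$ (i, j) = r (F $$ (i, j) / unif)" using 2 ij by (simp add: F0)
    also have "F $$ (i, j) / unif = (\<Sum>l<n. \<Sum>k<n. A $$ (k, i) * F $$ (k, l) * A $$ (l, j) / unif)"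
      unfolding F_ij by (simp add: sum_divide_distrib)
    also have "r \<dots> = (\<Sum>l<n. \<Sum>k<n. A0 $$ (k, i) * ?F0 $$ (k, l) * A0 $$ (l, j))"
    proof -
      have "r (\<Sum>k<n. A $$ (k, i) * F $$ (k, l) * A $$ (l, j) / unif)
          = (\<Sum>k<n. A0 $$ (k, i) * ?F0 $$ (k, l) * A0 $$ (l, j))" if "l < n" for l
        using entry[OF that] by (subst h_sum) auto
      moreover have "r (\<Sum>l<n. \<Sum>k<n. A $$ (k, i) * F $$ (k, l) * A $$ (l, j) / unif)
          = (\<Sum>l<n. r (\<Sum>k<n. A $$ (k, i) * F $$ (k, l) * A $$ (l, j) / unif))"
        using entry by (intro h_sum sum_mem) auto
      ultimately show ?thesis by simp
    qed
    finally show ?thesis using lhs by simp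
  next
    case 3
    have "A0 $$ (k, i) * ?F0 $$ (k, l) * A0 $$ (l, j) = 0" if "l < n" "k < n" for l k
      using 3 that ij by (auto simp: A0 F0)
    then have "(transpose_mat A0 * ?F0 * A0) $$ (i, j) = 0" unfolding lhs by (intro sum.neutral ballI) auto
    then show ?thesis using 3 ij by (auto simp only: F0 split: if_splits)
  qed
qed (use A F in \<open>auto simp: A0_def residual_form_def block_diag_part_def\<close>)

text \<open>
  In the first block this is the hypothesis on the radical. A vector \<open>y\<close> killed by the second block
  can be completed to an integral vector \<open>x = (\<pi> s, y)\<close> with \<open>F x\<close> divisible by \<open>\<pi>\<^sup>2\<close>: the first
  coordinates of \<open>F x\<close> lead to a linear system for \<open>s\<close> modulo the maximal ideal whose matrix is the
  invertible first block. The primitivity hypothesis then forces \<open>y\<close> to vanish modulo the maximal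
  ideal.
\<close>

lemma residual_form_nondegenerate:
  assumes F: "F \<in> carrier_mat n n" "mat_over \<O> F" and mn: "m \<le> n"
    and F1: "\<And>i j. i < n \<Longrightarrow> j < n \<Longrightarrow> m \<le> i \<or> m \<le> j \<Longrightarrow> F $$ (i, j) \<in> frac_ideal 1"
    and radical: "\<And>y i. y \<in> carrier_vec n \<Longrightarrow> map_mat r F *\<^sub>v y = 0\<^sub>v n \<Longrightarrow> i < m \<Longrightarrow> y $ i = 0"
    and primitive: "\<And>x. x \<in> carrier_vec n \<Longrightarrow> vec_over \<O> x \<Longrightarrow> vec_over (frac_ideal 2) (F *\<^sub>v x) \<Longrightarrow>
       vec_over (frac_ideal 1) x"
  shows "det (residual_form m F) \<noteq> 0"
proof
  let ?F0 = "residual_form m F"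
  have c: "?F0 \<in> carrier_mat n n" using F by (auto simp: residual_form_def)
  have Fin: "F $$ (k, l) \<in> \<O>" if "k < n" "l < n" for k l
    using F that by (auto simp: mat_over_def)
  have rF: "r (F $$ (k, l)) = 0" if "k < n" "l < n" "m \<le> k \<or> m \<le> l" for k l
    using F1[OF that] by (rule r_frac_ideal_1)
  have F0: "?F0 $$ (k, l) = (if k < m \<and> l < m then r (F $$ (k, l))
     else if m \<le> k \<and> m \<le> l then r (F $$ (k, l) / unif) else 0)" if "k < n" "l < n" for k l
    using F that by (simp add: residual_form_def)
  assume "det ?F0 = 0"
  then obtain y where y: "y \<in> carrier_vec n" "y \<noteq> 0\<^sub>v n" "?F0 *\<^sub>v y = 0\<^sub>v n"
    using det_0_iff_vec_prod_zero_field[OF c] by auto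
  have y0: "(\<Sum>j<n. ?F0 $$ (i, j) * y $ j) = 0" if "i < n" for i
    using arg_cong[OF y(3), of "\<lambda>x. x $ i"] that c y(1) by (simp add: scalar_prod_def lessThan_atLeast0)
  have upper: "w = 0"
    if w: "\<And>i. i < m \<Longrightarrow> (\<Sum>j<m. r (F $$ (i, j)) * f j) = 0" and w_eq: "w = f i" "i < m" for f w i
  proof -
    let ?x = "vec n (\<lambda>j. if j < m then f j else 0)"
    have "map_mat r F *\<^sub>v ?x = 0\<^sub>v n"
    proof (rule eq_vecI)
      fix i assume "i < dim_vec (0\<^sub>v n)"
      then have i: "i < n" by simp
      have "(map_mat r F *\<^sub>v ?x) $ i = (\<Sum>j<n. r (F $$ (i, j)) * (if j < m then f j else 0))"
        using F i by (simp add: scalar_prod_def lessThan_atLeast0)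
      also have "\<dots> = (\<Sum>j<m. r (F $$ (i, j)) * f j)"
        using mn by (intro sum.mono_neutral_cong_right) auto
      also have "\<dots> = 0" using w[of i] rF[OF i] mn by (cases "i < m") auto
      finally show "(map_mat r F *\<^sub>v ?x) $ i = 0\<^sub>v n $ i" using i by simp
    qed (use F in auto)
    from radical[OF _ this w_eq(2)] show ?thesis using w_eq mn by simp
  qed
  have y_upper: "y $ i = 0" if "i < m" for i
  proof (rule upper[OF _ refl that])
    fix i assume i: "i < m"
    have "(\<Sum>j<m. r (F $$ (i, j)) * y $ j) = (\<Sum>j<n. ?F0 $$ (i, j) * y $ j)"
      using i mn by (intro sum.mono_neutral_cong_left) (auto simp: F0)
    then show "(\<Sum>j<m. r (F $$ (i, j)) * y $ j) = 0" using y0[of i] i mn by simp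
  qed
  obtain s where s: "\<And>y. s y \<in> \<O>" "\<And>y. r (s y) = y" using lift_residue by metis
  define b where "b i = r ((\<Sum>j\<in>{m..<n}. F $$ (i, j) * s (y $ j)) / unif)" for i
  \<comment> \<open>the first block of the reduced Gram matrix, padded by the identity to a square matrix of size \<open>n\<close>\<close>
  define E where "E = mat n n (\<lambda>(i, j). if i < m \<and> j < m then r (F $$ (i, j)) else if i = j then 1 else 0)"
  have E: "E \<in> carrier_mat n n" by (simp add: E_def)
  have E_upper: "(E *\<^sub>v x) $ i = (\<Sum>j<m. r (F $$ (i, j)) * x $ j)" if "i < m" "x \<in> carrier_vec n" for x i
  proof -
    have "(E *\<^sub>v x) $ i = (\<Sum>j<n. E $$ (i, j) * x $ j)"
      using that mn E by (simp add: scalar_prod_def lessThan_atLeast0)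
    also have "\<dots> = (\<Sum>j<m. r (F $$ (i, j)) * x $ j)"
      using that mn by (intro sum.mono_neutral_cong_right) (auto simp: E_def)
    finally show ?thesis .
  qed
  have E_lower: "(E *\<^sub>v x) $ i = x $ i" if "m \<le> i" "i < n" "x \<in> carrier_vec n" for x i
  proof -
    have "row E i = unit_vec n i" using that by (intro eq_vecI) (auto simp: E_def unit_vec_def)
    then show ?thesis using that E by simp
  qed
  have "det E \<noteq> 0"
  proof
    assume "det E = 0"
    then obtain x where x: "x \<in> carrier_vec n" "x \<noteq> 0\<^sub>v n" "E *\<^sub>v x = 0\<^sub>v n"
      using det_0_iff_vec_prod_zero_field[OF E] by auto
    have "x $ i = 0" if "i < n" for i
    proof (cases "i < m")
      case True
      show ?thesis
      proof (rule upper[OF _ refl True])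
        show "(\<Sum>j<m. r (F $$ (i, j)) * x $ j) = 0" if "i < m" for i
          using E_upper[OF that x(1)] x(3) that mn by simp
      qed
    next
      case False
      then show ?thesis using E_lower[of i x] x that by simp
    qed
    then show False using x by (auto intro: eq_vecI)
  qed
  then obtain E' where E': "E' \<in> carrier_mat n n" "E * E' = 1\<^sub>m n"
    using det_nonzero_inverse[OF E] by blast
  define u where "u = E' *\<^sub>v vec n (\<lambda>i. - b i)"
  have u: "u \<in> carrier_vec n" "E *\<^sub>v u = vec n (\<lambda>i. - b i)"
    using E E' by (simp_all add: u_def flip: assoc_mult_mat_vec[of _ n n _ n])
  define x where "x = vec n (\<lambda>j. if j < m then unif * s (u $ j) else s (y $ j))"
  have x: "x \<in> carrier_vec n" "vec_over \<O> x"
    using s unif_in[of 1] frac_ideal_mono[of 0 1] by (auto simp: x_def vec_over_def intro!: mult_mem)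
  have Fx: "(F *\<^sub>v x) $ i = unif * ((\<Sum>j<m. F $$ (i, j) * s (u $ j)) + (\<Sum>j\<in>{m..<n}. F $$ (i, j) * s (y $ j)) / unif)"
    if "i < n" for i
  proof -
    have "(F *\<^sub>v x) $ i = (\<Sum>j\<in>{..<m} \<union> {m..<n}. F $$ (i, j) * x $ j)"
      using that F mn x by (simp add: scalar_prod_def ivl_disj_un lessThan_atLeast0)
    also have "\<dots> = (\<Sum>j<m. F $$ (i, j) * x $ j) + (\<Sum>j\<in>{m..<n}. F $$ (i, j) * x $ j)"
      by (rule sum.union_disjoint) auto
    also have "(\<Sum>j<m. F $$ (i, j) * x $ j) = unif * (\<Sum>j<m. F $$ (i, j) * s (u $ j))"
      using mn by (auto simp: sum_distrib_left x_def intro!: sum.cong)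
    also have "(\<Sum>j\<in>{m..<n}. F $$ (i, j) * x $ j) = (\<Sum>j\<in>{m..<n}. F $$ (i, j) * s (y $ j))"
      by (intro sum.cong) (auto simp: x_def)
    finally show ?thesis using unif by (simp add: algebra_simps)
  qed
  have quot: "(\<Sum>j\<in>{m..<n}. F $$ (i, j) * s (y $ j)) / unif = (\<Sum>j\<in>{m..<n}. F $$ (i, j) / unif * s (y $ j))" for i
    by (simp add: sum_divide_distrib)
  have Fq: "F $$ (i, j) / unif \<in> \<O>" if "i < n" "m \<le> j" "j < n" for i j
    using F1[of i j] that by (simp add: div_unif)
  have quot_in: "(\<Sum>j\<in>{m..<n}. F $$ (i, j) * s (y $ j)) / unif \<in> \<O>" if "i < n" for i
    unfolding quot using that Fq s by (intro sum_mem mult_mem) auto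
  have "vec_over (frac_ideal 2) (F *\<^sub>v x)"
    unfolding vec_over_def
  proof (intro allI impI)
    fix i assume "i < dim_vec (F *\<^sub>v x)"
    then have i: "i < n" using F by simp
    have in1: "(\<Sum>j<m. F $$ (i, j) * s (u $ j)) \<in> \<O>"
      using i mn Fin s by (intro sum_mem mult_mem) auto
    have r1: "r (\<Sum>j<m. F $$ (i, j) * s (u $ j)) = (\<Sum>j<m. r (F $$ (i, j)) * u $ j)"
      using i mn Fin s by (subst h_sum) (auto simp: h_mult mult_mem)
    have "(\<Sum>j<m. r (F $$ (i, j)) * u $ j) + b i = 0"
    proof (cases "i < m")
      case True
      then have "(\<Sum>j<m. r (F $$ (i, j)) * u $ j) = - b i"
        using E_upper[OF True u(1)] u(2) i by simp
      then show ?thesis by simp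
    next
      case False
      then have "(\<Sum>j<m. r (F $$ (i, j)) * u $ j) = 0" using rF[OF i] mn by simp
      moreover have "b i = (\<Sum>j\<in>{m..<n}. r (F $$ (i, j) / unif) * y $ j)"
        unfolding b_def quot using i Fq s by (subst h_sum) (auto simp: h_mult mult_mem simp del: times_divide_eq_left)
      moreover have "\<dots> = (\<Sum>j<n. ?F0 $$ (i, j) * y $ j)"
        using False i by (intro sum.mono_neutral_cong_left) (auto simp: F0)
      ultimately show ?thesis using y0[OF i] by simp
    qed
    then have "r ((\<Sum>j<m. F $$ (i, j) * s (u $ j)) + (\<Sum>j\<in>{m..<n}. F $$ (i, j) * s (y $ j)) / unif) = 0"
      using h_add[OF in1 quot_in[OF i]] r1 by (simp add: b_def)
    then have "(\<Sum>j<m. F $$ (i, j) * s (u $ j)) + (\<Sum>j\<in>{m..<n}. F $$ (i, j) * s (y $ j)) / unif \<in> frac_ideal 1"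
      using r_eq_0_iff add_mem[OF in1 quot_in[OF i]] by blast
    then show "(F *\<^sub>v x) $ i \<in> frac_ideal 2"
      unfolding Fx[OF i] using unif_mult[of _ 1] by simp
  qed
  from primitive[OF x this] have x1: "vec_over (frac_ideal 1) x" .
  have "y $ i = 0" if "i < n" for i
  proof (cases "i < m")
    case False
    then have "s (y $ i) \<in> frac_ideal 1" using x1 that by (auto simp: vec_over_def x_def split: if_splits)
    then show ?thesis using s(2)[of "y $ i"] r_frac_ideal_1 by metis
  qed (rule y_upper)
  then show False using y by (auto intro: eq_vecI)
qed

end

section \<open>Reduction of a matrix representation\<close>

context form_rep
begin

lemma R_pow: "g \<in> carrier G \<Longrightarrow> R (g [^] (k::nat)) = R g ^\<^sub>m k"
  using R_carrier by (induction k) (auto simp: R_one R_mult)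

end

lemma one_mat_pow: "1\<^sub>m n ^\<^sub>m k = (1\<^sub>m n :: 'a::semiring_1 mat)"
  by (induction k) auto

lemma conjugate_similar:
  assumes "A \<in> carrier_mat n n" "P \<in> carrier_mat n n" "Q \<in> carrier_mat n n" "P * Q = 1\<^sub>m n" "Q * P = 1\<^sub>m n"
  shows "similar_mat (Q * A * P) (A :: 'a::comm_ring_1 mat)"
  using assms by (intro similar_matI[of _ _ Q P n]) (auto simp: square_simps)

lemma conjugate_eq_one:
  assumes A: "A \<in> carrier_mat n n" and P: "P \<in> carrier_mat n n" "Q \<in> carrier_mat n n" "P * Q = 1\<^sub>m n"
    and one: "Q * A * P = 1\<^sub>m n"
  shows "A = (1\<^sub>m n :: 'a::comm_ring_1 mat)"
proof -
  note assoc = assoc_mult_mat[of _ n n _ n _ n]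
  have "A = (P * Q) * A * (P * Q)" using A P by (simp add: square_simps)
  also have "\<dots> = P * (Q * A * P) * Q" using A P(1,2) by (simp add: assoc square_simps)
  finally show ?thesis using P by (simp add: one square_simps)
qed

context dvr_reduction
begin

text \<open>
  Changing a maximal lattice's basis by a lift of a basis adapted to the kernel of the reduced Gram
  matrix makes the columns of the Gram matrix from the \<open>m\<close>-th on divisible by the uniformizer.
\<close>

lemma reduced_rep_adapted:
  assumes "form_rep G n R F \<epsilon>" "finite (carrier G)"
  obtains P Q m where "P \<in> carrier_mat n n" "Q \<in> carrier_mat n n" "P * Q = 1\<^sub>m n" "Q * P = 1\<^sub>m n" "m \<le> n"
    "reduced_rep G n (\<lambda>g. Q * R g * P) (transpose_mat P * F * P) \<epsilon>"
    "\<And>i j. i < n \<Longrightarrow> m \<le> j \<Longrightarrow> j < n \<Longrightarrow> (transpose_mat P * F * P) $$ (i, j) \<in> frac_ideal 1"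
    "\<And>y i. y \<in> carrier_vec n \<Longrightarrow> map_mat r (transpose_mat P * F * P) *\<^sub>v y = 0\<^sub>v n \<Longrightarrow> i < m \<Longrightarrow> y $ i = 0"
proof -
  interpret form_rep G n R F \<epsilon> by fact
  note assoc = assoc_mult_mat[of _ n n _ n _ n]
  obtain P P' where P: "P \<in> carrier_mat n n" "P' \<in> carrier_mat n n" "P * P' = 1\<^sub>m n" "P' * P = 1\<^sub>m n"
    and red: "reduced_rep G n (\<lambda>g. P' * R g * P) (transpose_mat P * F * P) \<epsilon>"
    using reduced_rep_exists[OF assms] by blast
  define F1 where "F1 = transpose_mat P * F * P"
  have F1: "F1 \<in> carrier_mat n n" "mat_over \<O> F1"
    using P F_carrier red by (auto simp: F1_def square_simps reduced_rep_def)
  have rF1: "map_mat r F1 \<in> carrier_mat n n" using F1 by simp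
  obtain U0 m where U0: "U0 \<in> carrier_mat n n" "det U0 \<noteq> 0" and m: "m \<le> n"
    and ker: "\<And>j. m \<le> j \<Longrightarrow> j < n \<Longrightarrow> map_mat r F1 *\<^sub>v col U0 j = 0\<^sub>v n"
    and inj: "\<And>y i. y \<in> carrier_vec n \<Longrightarrow> map_mat r F1 *\<^sub>v (U0 *\<^sub>v y) = 0\<^sub>v n \<Longrightarrow> i < m \<Longrightarrow> y $ i = 0"
    using kernel_adapted_basis[OF rF1] by blast
  obtain U W where U: "U \<in> carrier_mat n n" "mat_over \<O> U" "map_mat r U = U0"
    and W: "W \<in> carrier_mat n n" "mat_over \<O> W" "U * W = 1\<^sub>m n" "W * U = 1\<^sub>m n"
    using lift_invertible[OF U0] by blast
  define F2 where "F2 = transpose_mat U * F1 * U"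
  have red2: "reduced_rep G n (\<lambda>g. W * (P' * R g * P) * U) F2 \<epsilon>"
    using reduced_rep_conjugate[OF red[folded F1_def] U(1,2) W] by (simp add: F2_def)
  have F2: "F2 \<in> carrier_mat n n" "mat_over \<O> F2"
    using U F1 red2 by (auto simp: F2_def square_simps reduced_rep_def)
  have Ut: "mat_over \<O> (transpose_mat U)" "map_mat r (transpose_mat U) = transpose_mat U0"
    using U by (auto simp: mat_over_def)
  have rF2: "map_mat r F2 = transpose_mat U0 * map_mat r F1 * U0"
  proof -
    have "map_mat r F2 = map_mat r (transpose_mat U * F1) * map_mat r U"
      unfolding F2_def using U F1 Ut by (intro map_mat_mult mult_mat_over) auto
    also have "map_mat r (transpose_mat U * F1) = map_mat r (transpose_mat U) * map_mat r F1"
      using U F1 Ut by (intro map_mat_mult) auto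
    finally show ?thesis using U Ut by simp
  qed
  have F2_col: "F2 $$ (i, j) \<in> frac_ideal 1" if "i < n" "m \<le> j" "j < n" for i j
  proof -
    have "map_mat r F2 = transpose_mat U0 * (map_mat r F1 * U0)"
      using U0 rF1 by (simp add: rF2 assoc)
    then have "r (F2 $$ (i, j)) = (transpose_mat U0 * (map_mat r F1 * U0)) $$ (i, j)"
      using F2 that by (metis carrier_matD index_map_mat(1))
    also have "\<dots> = col U0 i \<bullet> col (map_mat r F1 * U0) j"
      using that U0 F1 by (subst index_mult_mat(1)) auto
    also have "col (map_mat r F1 * U0) j = 0\<^sub>v n"
      using ker[OF that(2,3)] col_mult2[OF rF1 U0(1) that(3)] by simp
    finally have "r (F2 $$ (i, j)) = 0" using that U0 by simp
    then show ?thesis using r_eq_0_iff F2 that by (auto simp: mat_over_def)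
  qed
  have radical: "y $ i = 0" if y: "y \<in> carrier_vec n" "map_mat r F2 *\<^sub>v y = 0\<^sub>v n" and "i < m" for y i
  proof (rule inj[OF y(1) _ that(3)])
    obtain V where V: "V \<in> carrier_mat n n" "U0 * V = 1\<^sub>m n" using det_nonzero_inverse[OF U0] by blast
    let ?w = "map_mat r F1 *\<^sub>v (U0 *\<^sub>v y)"
    have w: "?w \<in> carrier_vec n" using F1 U0 y by (intro mult_mat_vec_carrier[of _ n n]) auto
    have "transpose_mat V * transpose_mat U0 = 1\<^sub>m n"
      using V U0 transpose_mult[of U0 n n V n] by simp
    then have "?w = transpose_mat V * transpose_mat U0 *\<^sub>v ?w" using w by simp
    also have "\<dots> = transpose_mat V *\<^sub>v (transpose_mat U0 *\<^sub>v ?w)"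
      using V U0 w by (intro assoc_mult_mat_vec[of _ n n _ n]) auto
    also have "transpose_mat U0 *\<^sub>v ?w = map_mat r F2 *\<^sub>v y"
      unfolding rF2 using U0 rF1 y by (simp add: square_simps assoc_mult_mat_vec[of _ n n _ n])
    also have "transpose_mat V *\<^sub>v \<dots> = 0\<^sub>v n" unfolding y(2) using V by (intro eq_vecI) auto
    finally show "?w = 0\<^sub>v n" .
  qed
  have PU: "P * U \<in> carrier_mat n n" "W * P' \<in> carrier_mat n n" using P U W by (auto simp: square_simps)
  have form: "transpose_mat (P * U) * F * (P * U) = F2"
    using P U F_carrier by (simp add: F2_def F1_def transpose_mult[of _ n n _ n] assoc square_simps)
  have rep: "W * P' * R g * (P * U) = W * (P' * R g * P) * U" if "g \<in> carrier G" for g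
    using P U W R_carrier[OF that] by (simp add: assoc square_simps)
  have "P * U * (W * P') = P * (U * W) * P'" using P(1,2) U(1) W(1) by (simp add: assoc square_simps)
  then have inv1: "P * U * (W * P') = 1\<^sub>m n" using P W by (simp add: square_simps)
  have inv2: "W * P' * (P * U) = 1\<^sub>m n"
    by (rule mat_mult_left_right_inverse[OF PU inv1])
  have "form_rep G n (\<lambda>g. W * P' * R g * (P * U)) F2 \<epsilon>"
    using conjugate[OF PU inv1 inv2] by (simp add: form)
  then have "reduced_rep G n (\<lambda>g. W * P' * R g * (P * U)) F2 \<epsilon>"
    using red2 rep by (simp add: reduced_rep_def admissible_def)
  then show ?thesis
    using that[OF PU inv1 inv2 m] F2_col radical by (simp add: form)
qed

text \<open>
  Modulo the maximal ideal the group preserves the radical of the form, so its matrices are block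
  lower triangular. Their diagonal blocks preserve the two residual forms, and passing from
  a block triangular matrix to its diagonal blocks is multiplicative and keeps the characteristic
  polynomial.
  If \<open>g\<close> becomes trivial, then \<open>(g - 1)\<^sup>2\<close> vanishes modulo the maximal ideal; elements of prime order
  with this property are trivial, and a general \<open>g\<close> of finite order follows by removing one prime
  factor of the order at a time.
\<close>

lemma reduction_of_form_rep:
  assumes rep: "form_rep G n R F \<epsilon>" and fin: "finite (carrier G)" and \<epsilon>: "\<epsilon> = 1 \<or> \<epsilon> = -1"
    and faithful: "\<And>g. g \<in> carrier G \<Longrightarrow> R g = 1\<^sub>m n \<Longrightarrow> g = \<one>\<^bsub>G\<^esub>"
    and ramification: "\<And>p. prime p \<Longrightarrow> 2 * v (of_nat p) + 2 \<le> int p"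
  obtains R0 F0 where "form_rep G n R0 (F0 :: 'k mat) \<epsilon>"
    "\<And>g. g \<in> carrier G \<Longrightarrow> R0 g = 1\<^sub>m n \<Longrightarrow> g = \<one>\<^bsub>G\<^esub>"
    "\<And>g. g \<in> carrier G \<Longrightarrow> char_poly (R0 g) = map_poly r (char_poly (R g))"
    "\<And>i. \<epsilon> = -1 \<Longrightarrow> i < n \<Longrightarrow> F0 $$ (i, i) = 0"
proof -
  interpret form_rep G n R F \<epsilon> by fact
  obtain P Q m where PQ: "P \<in> carrier_mat n n" "Q \<in> carrier_mat n n" "P * Q = 1\<^sub>m n" "Q * P = 1\<^sub>m n"
    and m: "m \<le> n"
    and red: "reduced_rep G n (\<lambda>g. Q * R g * P) (transpose_mat P * F * P) \<epsilon>"
    and col1: "\<And>i j. i < n \<Longrightarrow> m \<le> j \<Longrightarrow> j < n \<Longrightarrow> (transpose_mat P * F * P) $$ (i, j) \<in> frac_ideal 1"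
    and radical: "\<And>y i. y \<in> carrier_vec n \<Longrightarrow> map_mat r (transpose_mat P * F * P) *\<^sub>v y = 0\<^sub>v n \<Longrightarrow> i < m \<Longrightarrow> y $ i = 0"
    by (rule reduced_rep_adapted[OF rep fin]; rule that; assumption)
  define X where "X g = Q * R g * P" for g
  define E where "E = transpose_mat P * F * P"
  note red = red[folded E_def X_def] and col1 = col1[folded E_def] and radical = radical[folded E_def]
  interpret X: form_rep G n X E \<epsilon> using red by (simp add: reduced_rep_def)
  have Xin: "mat_over \<O> (X g)" if "g \<in> carrier G" for g using red that by (simp add: reduced_rep_def)
  have Ein: "mat_over \<O> E" using red by (simp add: reduced_rep_def)
  have E_sym: "E $$ (j, i) = of_int \<epsilon> * E $$ (i, j)" if "i < n" "j < n" for i j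
    using arg_cong[OF X.F_transpose, of "\<lambda>M. M $$ (i, j)"] X.F_carrier that by simp
  have E1: "E $$ (i, j) \<in> frac_ideal 1" if "i < n" "j < n" "m \<le> i \<or> m \<le> j" for i j
  proof (cases "m \<le> j")
    case False
    then have "E $$ (j, i) \<in> frac_ideal 1" using col1 that by auto
    then show ?thesis
      using E_sym[OF that(2,1)] frac_ideal_mult[OF of_int_mem, of "E $$ (j, i)" 1 \<epsilon>] by simp
  qed (use col1 that in auto)
  let ?X0 = "\<lambda>g. block_diag_part m (map_mat r (X g))"
  let ?F0 = "residual_form m E"
  have Xinv: "X (inv\<^bsub>G\<^esub> g) \<in> carrier_mat n n" if "g \<in> carrier G" for g
    using that by (intro X.R_carrier) simp
  have X1: "X g $$ (i, j) \<in> frac_ideal 1" if g: "g \<in> carrier G" and ij: "i < m" "m \<le> j" "j < n" for g i j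
  proof -
    let ?Y = "X (inv\<^bsub>G\<^esub> g)"
    have Xg: "map_mat r (X g) \<in> carrier_mat n n" using X.R_carrier[OF g] by simp
    have Yg: "transpose_mat (map_mat r ?Y) \<in> carrier_mat n n" using Xinv[OF g] by simp
    have rE: "map_mat r E \<in> carrier_mat n n" using X.F_carrier by simp
    have "map_mat r E * map_mat r (X g) = map_mat r (E * X g)"
      using X.F_carrier X.R_carrier[OF g] Ein Xin[OF g] by (intro map_mat_mult[symmetric]) auto
    also have "E * X g = transpose_mat ?Y * E" by (rule X.F_R[OF g])
    also have "map_mat r \<dots> = map_mat r (transpose_mat ?Y) * map_mat r E"
      using X.F_carrier Xinv[OF g] Ein Xin[of "inv\<^bsub>G\<^esub> g"] g
      by (intro map_mat_mult) (auto simp: mat_over_def)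
    also have "map_mat r (transpose_mat ?Y) = transpose_mat (map_mat r ?Y)" by (intro eq_matI) auto
    finally have eq: "map_mat r E * map_mat r (X g) = transpose_mat (map_mat r ?Y) * map_mat r E" .
    have "map_mat r E *\<^sub>v col (map_mat r (X g)) j = col (map_mat r E * map_mat r (X g)) j"
      by (rule col_mult2[OF rE Xg ij(3), symmetric])
    also have "\<dots> = transpose_mat (map_mat r ?Y) *\<^sub>v col (map_mat r E) j"
      unfolding eq by (rule col_mult2[OF Yg rE ij(3)])
    also have "col (map_mat r E) j = 0\<^sub>v n"
      using X.F_carrier ij by (intro eq_vecI) (auto intro!: r_frac_ideal_1 col1)
    also have "transpose_mat (map_mat r ?Y) *\<^sub>v 0\<^sub>v n = 0\<^sub>v n" using Xinv[OF g] by (intro eq_vecI) auto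
    finally have "col (map_mat r (X g)) j $ i = 0"
      using Xg ij by (intro radical) auto
    then have "r (X g $$ (i, j)) = 0" using X.R_carrier[OF g] ij m by simp
    then show ?thesis using r_eq_0_iff Xin[OF g] X.R_carrier[OF g] ij m by (auto simp: mat_over_def)
  qed
  have rX0: "map_mat r (X g) $$ (i, j) = 0" if "g \<in> carrier G" "i < m" "m \<le> j" "j < n" for g i j
    using r_frac_ideal_1[OF X1[OF that]] X.R_carrier[OF that(1)] m that by simp
  have bd_one: "block_diag_part m (1\<^sub>m n) = (1\<^sub>m n :: 'k mat)"
    by (intro eq_matI) (auto simp: block_diag_part_def)
  have F0c: "?F0 \<in> carrier_mat n n" using X.F_carrier by (auto simp: residual_form_def)
  have X0: "form_rep G n ?X0 ?F0 \<epsilon>"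
  proof unfold_locales
    fix g assume g: "g \<in> carrier G"
    show "?X0 g \<in> carrier_mat n n" using X.R_carrier[OF g] by simp
    show "transpose_mat (?X0 g) * ?F0 * ?X0 g = ?F0"
      using X.F_carrier Ein E1 X.R_carrier[OF g] Xin[OF g] X1[OF g] X.invariant[OF g]
      by (intro residual_form_invariant) auto
    fix h assume h: "h \<in> carrier G"
    have "map_mat r (X (g \<otimes>\<^bsub>G\<^esub> h)) = map_mat r (X g) * map_mat r (X h)"
      unfolding X.R_mult[OF g h] using X.R_carrier[OF g] X.R_carrier[OF h] Xin g h
      by (intro map_mat_mult) auto
    then show "?X0 (g \<otimes>\<^bsub>G\<^esub> h) = ?X0 g * ?X0 h"
      using block_diag_part_mult[OF _ rX0[OF g] _ rX0[OF h]] X.R_carrier[OF g] X.R_carrier[OF h]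
      by simp
  next
    show "?X0 \<one>\<^bsub>G\<^esub> = 1\<^sub>m n" by (simp add: X.R_one map_mat_one bd_one)
    show "?F0 \<in> carrier_mat n n" by (rule F0c)
    show "det ?F0 \<noteq> 0"
      using X.F_carrier Ein m E1 radical reduced_rep_primitive[OF red]
      by (intro residual_form_nondegenerate) auto
    show "transpose_mat ?F0 = of_int \<epsilon> \<cdot>\<^sub>m ?F0"
    proof (rule eq_matI)
      fix i j assume "i < dim_row (of_int \<epsilon> \<cdot>\<^sub>m ?F0)" "j < dim_col (of_int \<epsilon> \<cdot>\<^sub>m ?F0)"
      then have ij: "i < n" "j < n" using F0c by auto
      have "E $$ (i, j) \<in> \<O>" using Ein X.F_carrier ij by (auto simp: mat_over_def)
      moreover have "E $$ (i, j) / unif \<in> \<O>" if "m \<le> i"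
        using E1[OF ij] that by (simp add: div_unif)
      ultimately show "transpose_mat ?F0 $$ (i, j) = (of_int \<epsilon> \<cdot>\<^sub>m ?F0) $$ (i, j)"
        using ij X.F_carrier h_mult[OF of_int_mem, of "E $$ (i, j)" \<epsilon>]
          h_mult[OF of_int_mem, of "E $$ (i, j) / unif" \<epsilon>]
        by (auto simp: residual_form_def E_sym[OF ij] h_of_int)
    qed (use F0c in auto)
  qed
  then interpret X0: form_rep G n ?X0 ?F0 \<epsilon> .
  have kernel_torsion: "h = \<one>\<^bsub>G\<^esub>"
    if h: "h \<in> carrier G" "?X0 h = 1\<^sub>m n" and p: "prime p" and hp: "h [^]\<^bsub>G\<^esub> p = \<one>\<^bsub>G\<^esub>" for h and p :: nat
  proof -
    define D where "D = X h - 1\<^sub>m n"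
    note Xh = X.R_carrier[OF h(1)]
    have D: "D \<in> carrier_mat n n" unfolding D_def by (rule minus_carrier_mat) simp
    have D_in: "D $$ (i, j) \<in> \<O>" if "i < n" "j < n" for i j
      using Xin[OF h(1)] Xh that by (auto simp: D_def mat_over_def intro!: frac_ideal_diff one_mem zero_mem)
    have D1: "D $$ (i, j) \<in> frac_ideal 1" if "i < n" "j < n" "i < m \<or> m \<le> j" for i j
    proof (cases "i < m \<longleftrightarrow> j < m")
      case True
      have "r (D $$ (i, j)) = r (X h $$ (i, j) + of_int (- (if i = j then 1 else 0)))"
        using that Xh by (simp add: D_def)
      also have "\<dots> = r (X h $$ (i, j)) + of_int (- (if i = j then 1 else 0))"
        using Xin[OF h(1)] Xh that by (subst h_add) (auto simp: mat_over_def h_of_int of_int_mem simp del: of_int_minus)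
      also have "r (X h $$ (i, j)) = ?X0 h $$ (i, j)"
        using True that Xh by (simp add: block_diag_part_def)
      also have "\<dots> + of_int (- (if i = j then 1 else 0)) = 0" using that by (simp add: h(2))
      finally show ?thesis using r_eq_0_iff D_in that by blast
    next
      case False
      then have "i < m" "m \<le> j" using that by auto
      then have "D $$ (i, j) = X h $$ (i, j)" using that Xh by (simp add: D_def)
      then show ?thesis using X1[OF h(1) \<open>i < m\<close> \<open>m \<le> j\<close>] that by simp
    qed
    have "mat_over (frac_ideal 1) (D * D)"
      unfolding mat_over_def
    proof (intro allI impI)
      fix i j assume "i < dim_row (D * D)" "j < dim_col (D * D)"
      then have ij: "i < n" "j < n" using D by auto
      have "(D * D) $$ (i, j) = (\<Sum>k<n. D $$ (i, k) * D $$ (k, j))"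
        using D ij by (simp add: scalar_prod_def lessThan_atLeast0)
      moreover have "D $$ (i, k) * D $$ (k, j) \<in> frac_ideal 1" if "k < n" for k
      proof (cases "m \<le> k")
        case True
        then show ?thesis using frac_ideal_mult[OF D1[of i k] D_in[of k j]] that ij by simp
      next
        case False
        then show ?thesis using frac_ideal_mult[OF D_in[of i k] D1[of k j]] that ij by simp
      qed
      ultimately show "(D * D) $$ (i, j) \<in> frac_ideal 1" by (auto intro!: frac_ideal_sum)
    qed
    moreover have "X h ^\<^sub>m p = 1\<^sub>m n" using X.R_pow[OF h(1), of p] hp X.R_one by simp
    ultimately have "X h = 1\<^sub>m n"
      using unipotent_torsion_trivial[OF p ramification[OF p] Xh Xin[OF h(1)]] by (simp add: D_def)
    then show ?thesis
      using conjugate_eq_one[OF R_carrier[OF h(1)] PQ(1,2,3)] faithful[OF h(1)] by (simp add: X_def)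
  qed
  have kernel_trivial: "g = \<one>\<^bsub>G\<^esub>"
    if "g \<in> carrier G" "?X0 g = 1\<^sub>m n" "g [^]\<^bsub>G\<^esub> N = \<one>\<^bsub>G\<^esub>" "N > 0" for g and N :: nat
    using that
  proof (induction N arbitrary: g rule: less_induct)
    case (less N)
    show ?case
    proof (cases "N = 1")
      case True
      then show ?thesis using less.prems by simp
    next
      case False
      then obtain p where p: "prime p" "p dvd N" using prime_factor_nat by blast
      then obtain q where q: "N = q * p" by (metis dvdE mult.commute)
      let ?h = "g [^]\<^bsub>G\<^esub> q"
      have "?h = \<one>\<^bsub>G\<^esub>"
      proof (rule kernel_torsion[OF _ _ p(1)])
        show "?h \<in> carrier G" using less.prems by simp
        show "?X0 ?h = 1\<^sub>m n" using X0.R_pow[OF less.prems(1), of q] less.prems(2) by (simp add: one_mat_pow)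
        show "?h [^]\<^bsub>G\<^esub> p = \<one>\<^bsub>G\<^esub>" using less.prems q by (simp add: nat_pow_pow)
      qed
      moreover have "q > 0" "q < N" using q less.prems(4) prime_gt_1_nat[OF p(1)] by auto
      ultimately show ?thesis using less.IH less.prems by blast
    qed
  qed
  have "g = \<one>\<^bsub>G\<^esub>" if "g \<in> carrier G" "?X0 g = 1\<^sub>m n" for g
    using kernel_trivial[OF that pow_order_eq_1[OF that(1)]] fin order_gt_0_iff_finite by simp
  moreover have "char_poly (?X0 g) = map_poly r (char_poly (R g))" if g: "g \<in> carrier G" for g
  proof -
    have "char_poly (?X0 g) = char_poly (map_mat r (X g))"
      using X.R_carrier[OF g] rX0[OF g] m by (intro char_poly_block_diag_part[of _ n]) auto
    also have "\<dots> = map_poly r (char_poly (X g))"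
      by (rule map_poly_char_poly[OF X.R_carrier[OF g] Xin[OF g], symmetric])
    also have "char_poly (X g) = char_poly (R g)"
      unfolding X_def using R_carrier[OF g] PQ by (intro char_poly_similar conjugate_similar)
    finally show ?thesis .
  qed
  moreover have "?F0 $$ (i, i) = 0" if "\<epsilon> = -1" "i < n" for i
  proof -
    have "E $$ (i, i) + E $$ (i, i) = 0"
      by (subst (2) E_sym[OF that(2,2)]) (simp add: that(1))
    then have "E $$ (i, i) = 0" by (simp flip: mult_2)
    then show ?thesis using that X.F_carrier by (simp add: residual_form_def h_zero)
  qed
  ultimately show ?thesis using that[OF X0] by blast
qed

end

section \<open>Coordinates in an abstract vector space\<close>

lemma vec_linear_induct [consumes 1, case_names zero add smult unit]:
  fixes x :: "'a::comm_ring_1 vec"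
  assumes x: "x \<in> carrier_vec n" and zero: "P (0\<^sub>v n)"
    and add: "\<And>x y. x \<in> carrier_vec n \<Longrightarrow> y \<in> carrier_vec n \<Longrightarrow> P x \<Longrightarrow> P y \<Longrightarrow> P (x + y)"
    and smult: "\<And>c x. x \<in> carrier_vec n \<Longrightarrow> P x \<Longrightarrow> P (c \<cdot>\<^sub>v x)"
    and unit: "\<And>j. j < n \<Longrightarrow> P (unit_vec n j)"
  shows "P x"
proof -
  have "1\<^sub>m n *\<^sub>v x \<in> {x \<in> carrier_vec n. P x}"
    using assms by (intro mult_mat_vec_mem[where S = UNIV]) (auto simp: vec_over_def)
  then show ?thesis using x by simp
qed

lemma module_vec_ops:
  "carrier (module_vec TYPE('a::semiring_1) n) = carrier_vec n"
  "x \<oplus>\<^bsub>module_vec TYPE('a) n\<^esub> y = x + y"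
  "\<zero>\<^bsub>module_vec TYPE('a) n\<^esub> = 0\<^sub>v n"
  "c \<odot>\<^bsub>module_vec TYPE('a) n\<^esub> x = c \<cdot>\<^sub>v x"
  by (simp_all add: module_vec_simps)

locale based_space = vectorspace class_ring W
  for W :: "('a::field, 'v, 'm) module_scheme" (structure) +
  fixes bs :: "'v list"
  assumes distinct_bs: "distinct bs" and basis_bs: "basis (set bs)"
begin

text \<open>
  The inverse of the coordinate map of the basis.
\<close>

definition comb :: "'a vec \<Rightarrow> 'v" where
  "comb x = (\<Oplus>i\<in>{..<length bs}. x $ i \<odot> bs ! i)"

lemma bs_carrier: "i < length bs \<Longrightarrow> bs ! i \<in> carrier W"
  using basis_bs unfolding basis_def by auto

lemma smult_bs: "i < length bs \<Longrightarrow> c \<odot> bs ! i \<in> carrier W"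
  using bs_carrier by (auto intro!: smult_closed)

lemma smult_add_scalar: "w \<in> carrier W \<Longrightarrow> (a + b) \<odot> w = a \<odot> w \<oplus> b \<odot> w"
  using smult_l_distr[of a b w] by simp

lemma smult_mult_scalar: "w \<in> carrier W \<Longrightarrow> (a * b) \<odot> w = a \<odot> (b \<odot> w)"
  using smult_assoc1[of a b w] by simp

lemma smult_zero_scalar: "w \<in> carrier W \<Longrightarrow> 0 \<odot> w = \<zero>"
  using smult_l_null[of w] by simp

lemma comb_carrier: "comb x \<in> carrier W"
  unfolding comb_def by (intro M.finsum_closed) (auto intro: smult_bs)

lemma comb_lincomb: "lincomb a (set bs) = comb (vec (length bs) (\<lambda>i. a (bs ! i)))"
proof -
  have inj: "inj_on ((!) bs) {..<length bs}" using distinct_bs by (auto simp: inj_on_def nth_eq_iff_index_eq)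
  have img: "(!) bs ` {..<length bs} = set bs" by (auto simp: set_conv_nth)
  have "lincomb a (set bs) = (\<Oplus>b\<in>(!) bs ` {..<length bs}. a b \<odot> b)" by (simp add: lincomb_def img)
  also have "\<dots> = (\<Oplus>i\<in>{..<length bs}. a (bs ! i) \<odot> bs ! i)"
    using inj by (intro M.add.finprod_reindex) (auto intro: smult_bs)
  also have "\<dots> = comb (vec (length bs) (\<lambda>i. a (bs ! i)))"
    unfolding comb_def by (intro M.finsum_cong') (auto intro: smult_bs)
  finally show ?thesis .
qed

lemma comb_ex1: 
  assumes w: "w \<in> carrier W"
  shows "\<exists>!x. x \<in> carrier_vec (length bs) \<and> comb x = w"
proof -
  have "set bs \<subseteq> carrier W" using basis_bs by (simp add: basis_def)
  then obtain a where a: "lincomb a (set bs) = w"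
    and uniq: "\<And>b. b \<in> set bs \<rightarrow>\<^sub>E UNIV \<Longrightarrow> lincomb b (set bs) = w \<Longrightarrow> b = a"
    using basis_criterion[of "set bs"] basis_bs w by (simp add: Ex1_def) metis
  show ?thesis
  proof (rule ex1I)
    show "vec (length bs) (\<lambda>i. a (bs ! i)) \<in> carrier_vec (length bs) \<and> comb (vec (length bs) (\<lambda>i. a (bs ! i))) = w"
      using a comb_lincomb by simp
    fix x assume x: "x \<in> carrier_vec (length bs) \<and> comb x = w"
    define b where "b = (\<lambda>u\<in>set bs. x $ the_inv_into {..<length bs} ((!) bs) u)"
    have b_nth: "b (bs ! i) = x $ i" if "i < length bs" for i
    proof -
      have "inj_on ((!) bs) {..<length bs}" using distinct_bs by (auto simp: inj_on_def nth_eq_iff_index_eq)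
      then show ?thesis using that by (simp add: b_def the_inv_into_f_f)
    qed
    have "vec (length bs) (\<lambda>i. b (bs ! i)) = x" using x b_nth by (intro eq_vecI) auto
    then have "b = a" using x comb_lincomb[of b] by (intro uniq) (auto simp: b_def)
    then show "x = vec (length bs) (\<lambda>i. a (bs ! i))"
      using \<open>vec (length bs) (\<lambda>i. b (bs ! i)) = x\<close> by simp
  qed
qed

lemma comb_inj: "x \<in> carrier_vec (length bs) \<Longrightarrow> y \<in> carrier_vec (length bs) \<Longrightarrow> comb x = comb y \<Longrightarrow> x = y"
  using comb_ex1[OF comb_carrier[of y]] by blast

lemma comb_surj: "w \<in> carrier W \<Longrightarrow> \<exists>x\<in>carrier_vec (length bs). w = comb x"
  using comb_ex1[of w] by blast

lemma comb_add:
  assumes "x \<in> carrier_vec (length bs)" "y \<in> carrier_vec (length bs)"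
  shows "comb (x + y) = comb x \<oplus> comb y"
proof -
  have "comb (x + y) = (\<Oplus>i\<in>{..<length bs}. x $ i \<odot> bs ! i \<oplus> y $ i \<odot> bs ! i)"
    unfolding comb_def using assms bs_carrier
    by (intro M.finsum_cong') (auto simp: smult_add_scalar intro!: smult_bs)
  also have "\<dots> = comb x \<oplus> comb y"
    unfolding comb_def by (rule M.finsum_addf) (auto intro: smult_bs)
  finally show ?thesis .
qed

lemma comb_smult:
  assumes "x \<in> carrier_vec (length bs)"
  shows "comb (c \<cdot>\<^sub>v x) = c \<odot> comb x"
proof -
  have "comb (c \<cdot>\<^sub>v x) = (\<Oplus>i\<in>{..<length bs}. c \<odot> (x $ i \<odot> bs ! i))"
    unfolding comb_def using assms bs_carrier
    by (intro M.finsum_cong') (auto simp: smult_mult_scalar intro!: smult_bs smult_closed)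
  also have "\<dots> = c \<odot> comb x"
    unfolding comb_def by (subst finsum_smult) (auto intro: smult_bs)
  finally show ?thesis .
qed

lemma comb_zero: "comb (0\<^sub>v (length bs)) = \<zero>"
proof -
  have "(0::'a) \<cdot>\<^sub>v 0\<^sub>v (length bs) = 0\<^sub>v (length bs)" by (intro eq_vecI) auto
  then show ?thesis
    using comb_smult[of "0\<^sub>v (length bs)" 0] smult_zero_scalar[OF comb_carrier] by simp
qed

lemma comb_unit:
  assumes "j < length bs"
  shows "comb (unit_vec (length bs) j) = bs ! j"
proof -
  have "comb (unit_vec (length bs) j) = (\<Oplus>i\<in>{..<length bs}. if j = i then bs ! i else \<zero>)"
    unfolding comb_def
  proof (intro M.finsum_cong' refl)
    show "unit_vec (length bs) j $ i \<odot> bs ! i = (if j = i then bs ! i else \<zero>)" if "i \<in> {..<length bs}" for i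
      using that assms bs_carrier[of i] smult_one[of "bs ! i"] smult_l_null[of "bs ! i"] by simp
  qed (use bs_carrier in auto)
  also have "\<dots> = bs ! j"
    using assms bs_carrier by (intro M.finsum_singleton) auto
  finally show ?thesis .
qed

lemma linear_map_comb:
  assumes x: "x \<in> carrier_vec (length bs)"
    and T: "T \<in> LinearCombinations.module_hom class_ring W W" and A: "A \<in> carrier_mat (length bs) (length bs)"
    and basis: "\<And>j. j < length bs \<Longrightarrow> T (bs ! j) = comb (col A j)"
  shows "T (comb x) = comb (A *\<^sub>v x)"
  using x
proof (induction x rule: vec_linear_induct)
  have Tz: "T \<zero> = \<zero>"
    using LinearCombinations.module_hom_smult[OF T, of 0 "\<zero>"] LinearCombinations.module_hom_closed[OF T]
      smult_zero_scalar[of "\<zero>"] smult_zero_scalar[of "T \<zero>"] by auto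
  have "A *\<^sub>v 0\<^sub>v (length bs) = 0\<^sub>v (length bs)" using A by (intro eq_vecI) auto
  then show "T (comb (0\<^sub>v (length bs))) = comb (A *\<^sub>v 0\<^sub>v (length bs))" by (simp add: comb_zero Tz)
next
  fix x y assume "x \<in> carrier_vec (length bs)" "y \<in> carrier_vec (length bs)"
    "T (comb x) = comb (A *\<^sub>v x)" "T (comb y) = comb (A *\<^sub>v y)"
  then show "T (comb (x + y)) = comb (A *\<^sub>v (x + y))"
    using A by (simp add: comb_add LinearCombinations.module_hom_add[OF T] comb_carrier mult_add_distrib_mat_vec[OF A]
        mult_mat_vec_carrier[OF A])
next
  fix c x assume "x \<in> carrier_vec (length bs)" "T (comb x) = comb (A *\<^sub>v x)"
  then show "T (comb (c \<cdot>\<^sub>v x)) = comb (A *\<^sub>v (c \<cdot>\<^sub>v x))"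
    using A by (simp add: comb_smult LinearCombinations.module_hom_smult[OF T] comb_carrier mult_mat_vec[OF A]
        mult_mat_vec_carrier[OF A])
next
  fix j assume "j < length bs"
  then show "T (comb (unit_vec (length bs) j)) = comb (A *\<^sub>v unit_vec (length bs) j)"
    using A basis by (simp add: comb_unit mult_mat_unit_vec[OF A])
qed

lemma comb_col: "A \<in> carrier_mat (length bs) (length bs) \<Longrightarrow> j < length bs \<Longrightarrow>
    (\<Oplus>i\<in>{..<length bs}. A $$ (i, j) \<odot> bs ! i) = comb (col A j)"
  unfolding comb_def by (intro M.finsum_cong') (auto intro: smult_bs)

lemma representsI:
  assumes "A \<in> carrier_mat (length bs) (length bs)"
    and "\<And>x. x \<in> carrier_vec (length bs) \<Longrightarrow> T (comb x) = comb (A *\<^sub>v x)"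
  shows "represents W T A"
  unfolding represents_def
proof (intro exI[of _ bs] conjI allI impI)
  fix j assume "j < length bs"
  then show "T (bs ! j) = (\<Oplus>i\<in>{..<length bs}. A $$ (i, j) \<odot> bs ! i)"
    using assms(2)[of "unit_vec (length bs) j"] by (simp add: comb_unit comb_col mult_mat_unit_vec[OF assms(1)] assms(1))
qed (use assms distinct_bs basis_bs in auto)

lemma matrix_exists:
  assumes T: "T \<in> LinearCombinations.module_hom class_ring W W"
  shows "\<exists>A\<in>carrier_mat (length bs) (length bs). \<forall>x\<in>carrier_vec (length bs). T (comb x) = comb (A *\<^sub>v x)"
proof -
  have "\<exists>x\<in>carrier_vec (length bs). T (bs ! j) = comb x" if "j < length bs" for j
    using that comb_surj LinearCombinations.module_hom_closed[OF T] bs_carrier by blast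
  then obtain c where c: "\<And>j. j < length bs \<Longrightarrow> c j \<in> carrier_vec (length bs) \<and> T (bs ! j) = comb (c j)"
    by metis
  define A where "A = mat (length bs) (length bs) (\<lambda>(i, j). c j $ i)"
  have A: "A \<in> carrier_mat (length bs) (length bs)" by (simp add: A_def)
  have "col A j = c j" if "j < length bs" for j
    using c[OF that] that by (intro eq_vecI) (auto simp: A_def)
  then show ?thesis using linear_map_comb[OF _ T A] A c by force
qed

end

lemma change_of_basis:
  assumes "based_space W bs" "based_space W bs'" and len: "length bs' = length bs"
  obtains P where "P \<in> carrier_mat (length bs) (length bs)"
    "\<And>x. x \<in> carrier_vec (length bs) \<Longrightarrow> based_space.comb W bs' x = based_space.comb W bs (P *\<^sub>v x)"
proof -
  interpret b: based_space W bs by fact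
  interpret b': based_space W bs' by fact
  have "\<exists>x\<in>carrier_vec (length bs). bs' ! j = b.comb x" if "j < length bs" for j
    using that b.comb_surj b'.bs_carrier len by simp
  then obtain c where c: "\<And>j. j < length bs \<Longrightarrow> c j \<in> carrier_vec (length bs) \<and> bs' ! j = b.comb (c j)"
    by metis
  define P where "P = mat (length bs) (length bs) (\<lambda>(i, j). c j $ i)"
  have P: "P \<in> carrier_mat (length bs) (length bs)" by (simp add: P_def)
  have colP: "col P j = c j" if "j < length bs" for j
    using c[OF that] that by (intro eq_vecI) (auto simp: P_def)
  have "b'.comb x = b.comb (P *\<^sub>v x)" if "x \<in> carrier_vec (length bs)" for x
  proof (rule vec_linear_induct[where P = "\<lambda>x. b'.comb x = b.comb (P *\<^sub>v x)", OF that])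
    have "P *\<^sub>v 0\<^sub>v (length bs) = 0\<^sub>v (length bs)" using P by (intro eq_vecI) auto
    then show "b'.comb (0\<^sub>v (length bs)) = b.comb (P *\<^sub>v 0\<^sub>v (length bs))"
      using b'.comb_zero by (simp add: b.comb_zero len)
  next
    fix x y assume "x \<in> carrier_vec (length bs)" "y \<in> carrier_vec (length bs)"
      "b'.comb x = b.comb (P *\<^sub>v x)" "b'.comb y = b.comb (P *\<^sub>v y)"
    then show "b'.comb (x + y) = b.comb (P *\<^sub>v (x + y))"
      by (simp add: b.comb_add b'.comb_add len mult_add_distrib_mat_vec[OF P] mult_mat_vec_carrier[OF P])
  next
    fix k x assume "x \<in> carrier_vec (length bs)" "b'.comb x = b.comb (P *\<^sub>v x)"
    then show "b'.comb (k \<cdot>\<^sub>v x) = b.comb (P *\<^sub>v (k \<cdot>\<^sub>v x))"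
      by (simp add: b.comb_smult b'.comb_smult len mult_mat_vec[OF P] mult_mat_vec_carrier[OF P])
  next
    fix j assume j: "j < length bs"
    then show "b'.comb (unit_vec (length bs) j) = b.comb (P *\<^sub>v unit_vec (length bs) j)"
      using b'.comb_unit[of j] c[OF j] by (simp add: len mult_mat_unit_vec[OF P] colP)
  qed
  then show ?thesis using that P by blast
qed

lemma represents_similar:
  assumes vs: "vectorspace class_ring W" and T: "T \<in> LinearCombinations.module_hom class_ring W W"
    and A: "represents W T A" and B: "represents W T B"
  shows "similar_mat A B"
proof -
  obtain bs where bs: "distinct bs" "vectorspace.basis class_ring W (set bs)"
    and Ac: "A \<in> carrier_mat (length bs) (length bs)"
    and A_eq: "\<And>j. j < length bs \<Longrightarrow> T (bs ! j) = (\<Oplus>\<^bsub>W\<^esub> i\<in>{..<length bs}. A $$ (i, j) \<odot>\<^bsub>W\<^esub> (bs ! i))"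
    using A by (auto simp: represents_def)
  obtain bs' where bs': "distinct bs'" "vectorspace.basis class_ring W (set bs')"
    and Bc: "B \<in> carrier_mat (length bs') (length bs')"
    and B_eq: "\<And>j. j < length bs' \<Longrightarrow> T (bs' ! j) = (\<Oplus>\<^bsub>W\<^esub> i\<in>{..<length bs'}. B $$ (i, j) \<odot>\<^bsub>W\<^esub> (bs' ! i))"
    using B by (auto simp: represents_def)
  have b: "based_space W bs" and b': "based_space W bs'"
    using vs bs bs' by (auto simp: based_space_def based_space_axioms_def)
  interpret b: based_space W bs by (rule b)
  interpret b': based_space W bs' by (rule b')
  have len: "length bs' = length bs"
    using b.dim_basis[of "set bs"] b.dim_basis[of "set bs'"] bs bs' by (simp add: distinct_card)
  let ?n = "length bs"
  have TA: "T (b.comb x) = b.comb (A *\<^sub>v x)" if "x \<in> carrier_vec ?n" for x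
    using b.linear_map_comb[OF that T Ac] A_eq Ac b.comb_col by simp
  have TB: "T (b'.comb x) = b'.comb (B *\<^sub>v x)" if "x \<in> carrier_vec ?n" for x
    using b'.linear_map_comb[OF _ T Bc] that B_eq Bc b'.comb_col len by simp
  have Bc: "B \<in> carrier_mat ?n ?n" using Bc len by simp
  obtain P where P: "P \<in> carrier_mat ?n ?n" "\<And>x. x \<in> carrier_vec ?n \<Longrightarrow> b'.comb x = b.comb (P *\<^sub>v x)"
    using change_of_basis[OF b b' len] by blast
  obtain Q where Q: "Q \<in> carrier_mat ?n ?n" "\<And>x. x \<in> carrier_vec ?n \<Longrightarrow> b.comb x = b'.comb (Q *\<^sub>v x)"
    using change_of_basis[OF b' b len[symmetric]] len by auto
  note mvc = mult_mat_vec_carrier[OF P(1)] mult_mat_vec_carrier[OF Q(1)] mult_mat_vec_carrier[OF Ac]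
    mult_mat_vec_carrier[OF Bc]
  have PQ: "P * Q = 1\<^sub>m ?n"
  proof (rule mat_eq_on_vecI)
    fix x :: "'a vec" assume x: "x \<in> carrier_vec ?n"
    have "b.comb (P *\<^sub>v (Q *\<^sub>v x)) = b.comb x" using x P(2)[of "Q *\<^sub>v x"] Q(2)[of x] mvc by simp
    then have "P *\<^sub>v (Q *\<^sub>v x) = x" using x mvc by (intro b.comb_inj) auto
    then show "P * Q *\<^sub>v x = 1\<^sub>m ?n *\<^sub>v x" using x P(1) Q(1) by (simp add: assoc_mult_mat_vec[of _ ?n ?n _ ?n])
  qed (use P Q in \<open>auto simp: square_simps\<close>)
  have QP: "Q * P = 1\<^sub>m ?n" by (rule mat_mult_left_right_inverse[OF P(1) Q(1) PQ])
  have "P * B = A * P"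
  proof (rule mat_eq_on_vecI)
    fix x :: "'a vec" assume x: "x \<in> carrier_vec ?n"
    have "b.comb (P *\<^sub>v (B *\<^sub>v x)) = T (b'.comb x)" using x TB P(2)[of "B *\<^sub>v x"] mvc by simp
    also have "\<dots> = b.comb (A *\<^sub>v (P *\<^sub>v x))" using x P(2)[of x] TA[of "P *\<^sub>v x"] mvc by simp
    finally have "P *\<^sub>v (B *\<^sub>v x) = A *\<^sub>v (P *\<^sub>v x)" using x mvc by (intro b.comb_inj) auto
    then show "P * B *\<^sub>v x = A * P *\<^sub>v x"
      using x P(1) Ac Bc by (simp add: assoc_mult_mat_vec[of _ ?n ?n _ ?n])
  qed (use P Ac Bc in \<open>auto simp: square_simps\<close>)
  have "A = A * (P * Q)" using Ac by (simp add: PQ)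
  also have "\<dots> = P * B * Q"
    unfolding \<open>P * B = A * P\<close> using Ac P(1) Q(1) by (simp add: assoc_mult_mat[of _ ?n ?n _ ?n _ ?n])
  finally show ?thesis using P Q Ac Bc PQ QP by (intro similar_matI[of _ _ P Q ?n]) auto
qed

lemma endo_char_poly_eq:
  assumes "vectorspace class_ring W" "T \<in> LinearCombinations.module_hom class_ring W W" "represents W T A"
  shows "endo_char_poly W T = char_poly A"
proof -
  have "represents W T (SOME A. represents W T A)" using assms(3) by (rule someI)
  then have "similar_mat (SOME A. represents W T A) A" using represents_similar assms by blast
  then show ?thesis unfolding endo_char_poly_def by (rule char_poly_similar)
qed

section \<open>Passing between forms on spaces and Gram matrices\<close>

context based_space
begin

definition gram :: "('v \<Rightarrow> 'v \<Rightarrow> 'a) \<Rightarrow> 'a mat" where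
  "gram f = mat (length bs) (length bs) (\<lambda>(i, j). f (bs ! i) (bs ! j))"

lemma gram_carrier: "gram f \<in> carrier_mat (length bs) (length bs)"
  by (simp add: gram_def)

lemma form_comb:
  assumes f: "bilinear_form W f" and x: "x \<in> carrier_vec (length bs)" and y: "y \<in> carrier_vec (length bs)"
  shows "f (comb x) (comb y) = x \<bullet> (gram f *\<^sub>v y)"
proof -
  let ?n = "length bs"
  note F = gram_carrier[of f]
  note Fv = mult_mat_vec_carrier[OF F]
  have addl: "f (a \<oplus> b) c = f a c + f b c" and addr: "f a (b \<oplus> c) = f a b + f a c"
    if "a \<in> carrier W" "b \<in> carrier W" "c \<in> carrier W" for a b c
    using f that by (auto simp: bilinear_form_def)
  have smultl: "f (k \<odot> a) c = k * f a c" and smultr: "f a (k \<odot> c) = k * f a c"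
    if "a \<in> carrier W" "c \<in> carrier W" for a c k
    using f that by (auto simp: bilinear_form_def)
  have zl: "f \<zero> c = 0" and zr: "f c \<zero> = 0" if "c \<in> carrier W" for c
    using smultl[of "\<zero>" c 0] smultr[of c "\<zero>" 0] smult_zero_scalar[of "\<zero>"] that by auto
  have unit: "f (bs ! i) (comb y) = (gram f *\<^sub>v y) $ i" if i: "i < ?n" for i
    using y
  proof (induction y rule: vec_linear_induct)
    show "f (bs ! i) (comb (0\<^sub>v ?n)) = (gram f *\<^sub>v 0\<^sub>v ?n) $ i"
      using i F by (simp add: comb_zero zr bs_carrier)
  next
    fix a b assume "a \<in> carrier_vec ?n" "b \<in> carrier_vec ?n"
      "f (bs ! i) (comb a) = (gram f *\<^sub>v a) $ i" "f (bs ! i) (comb b) = (gram f *\<^sub>v b) $ i"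
    then show "f (bs ! i) (comb (a + b)) = (gram f *\<^sub>v (a + b)) $ i"
      using i F by (simp add: comb_add addr bs_carrier comb_carrier mult_add_distrib_mat_vec[OF F])
  next
    fix k a assume "a \<in> carrier_vec ?n" "f (bs ! i) (comb a) = (gram f *\<^sub>v a) $ i"
    then show "f (bs ! i) (comb (k \<cdot>\<^sub>v a)) = (gram f *\<^sub>v (k \<cdot>\<^sub>v a)) $ i"
      using i F by (simp add: comb_smult smultr bs_carrier comb_carrier mult_mat_vec[OF F])
  next
    fix j assume "j < ?n"
    then show "f (bs ! i) (comb (unit_vec ?n j)) = (gram f *\<^sub>v unit_vec ?n j) $ i"
      using i by (simp add: comb_unit mult_mat_unit_vec[OF F]) (simp add: gram_def)
  qed
  show ?thesis
    using x
  proof (induction x rule: vec_linear_induct)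
    show "f (comb (0\<^sub>v ?n)) (comb y) = 0\<^sub>v ?n \<bullet> (gram f *\<^sub>v y)"
      using Fv[OF y] by (simp add: comb_zero zl comb_carrier)
  next
    fix a b assume "a \<in> carrier_vec ?n" "b \<in> carrier_vec ?n"
      "f (comb a) (comb y) = a \<bullet> (gram f *\<^sub>v y)" "f (comb b) (comb y) = b \<bullet> (gram f *\<^sub>v y)"
    then show "f (comb (a + b)) (comb y) = (a + b) \<bullet> (gram f *\<^sub>v y)"
      using Fv[OF y] by (simp add: comb_add addl comb_carrier add_scalar_prod_distrib[of _ ?n])
  next
    fix k a assume "a \<in> carrier_vec ?n" "f (comb a) (comb y) = a \<bullet> (gram f *\<^sub>v y)"
    then show "f (comb (k \<cdot>\<^sub>v a)) (comb y) = (k \<cdot>\<^sub>v a) \<bullet> (gram f *\<^sub>v y)"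
      using Fv[OF y] by (simp add: comb_smult smultl comb_carrier smult_scalar_prod_distrib[of _ ?n])
  next
    fix j assume "j < ?n"
    then show "f (comb (unit_vec ?n j)) (comb y) = unit_vec ?n j \<bullet> (gram f *\<^sub>v y)"
      using unit[of j] Fv[OF y] by (simp add: comb_unit scalar_prod_left_unit[OF Fv[OF y]] del: index_mult_mat_vec)
  qed
qed

end

lemma scalar_prod_mult_mat_eqI:
  assumes A: "A \<in> carrier_mat n n" and B: "B \<in> carrier_mat n n"
    and eq: "\<And>x y. x \<in> carrier_vec n \<Longrightarrow> y \<in> carrier_vec n \<Longrightarrow> x \<bullet> (A *\<^sub>v y) = x \<bullet> (B *\<^sub>v y)"
  shows "A = (B :: 'a::comm_semiring_1 mat)"
proof (rule eq_matI)
  fix i j assume "i < dim_row B" "j < dim_col B"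
  then have ij: "i < n" "j < n" using B by auto
  have "unit_vec n i \<bullet> (C *\<^sub>v unit_vec n j) = C $$ (i, j)" if "C \<in> carrier_mat n n" for C :: "'a mat"
    using that ij by (simp add: mult_mat_unit_vec[OF that])
  then show "A $$ (i, j) = B $$ (i, j)" using eq[of "unit_vec n i" "unit_vec n j"] A B by simp
qed (use A B in auto)

lemma form_aut_groupD:
  assumes "\<sigma> \<in> carrier (form_aut_group W b)"
  shows "\<sigma> \<in> extensional (carrier W)" "bij_betw \<sigma> (carrier W) (carrier W)"
    "\<sigma> \<in> LinearCombinations.module_hom class_ring W W"
    "\<And>x y. x \<in> carrier W \<Longrightarrow> y \<in> carrier W \<Longrightarrow> b (\<sigma> x) (\<sigma> y) = b x y"
  using assms by (auto simp: form_aut_group_def Bij_def)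

lemma form_aut_group_mult:
  assumes "\<sigma> \<in> carrier (form_aut_group W b)" "\<tau> \<in> carrier (form_aut_group W b)" "x \<in> carrier W"
  shows "(\<sigma> \<otimes>\<^bsub>form_aut_group W b\<^esub> \<tau>) x = \<sigma> (\<tau> x)"
  using assms by (simp add: form_aut_group_def BijGroup_def compose_def)

text \<open>
  The matrices are taken in the given basis. That the identity is represented by the identity matrix
  follows from multiplicativity, because \<open>R g\<^sup>T F R g = F\<close> already makes each \<open>R g\<close> invertible.
\<close>

lemma form_rep_of_action:
  fixes V :: "('a::field, 'v, 'm) module_scheme" and G :: "('g, 'n) monoid_scheme"
  assumes "based_space V bs" and f: "bilinear_form V f" and nondeg: "nondegenerate_form V f"
    and G: "group G" and \<rho>: "\<rho> \<in> hom G (form_aut_group V f)" and inj: "inj_on \<rho> (carrier G)"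
    and sym: "\<And>x y. x \<in> carrier V \<Longrightarrow> y \<in> carrier V \<Longrightarrow> f y x = of_int \<epsilon> * f x y"
  obtains R F where "form_rep G (length bs) R F \<epsilon>"
    "\<And>g. g \<in> carrier G \<Longrightarrow> R g = 1\<^sub>m (length bs) \<Longrightarrow> g = \<one>\<^bsub>G\<^esub>"
    "\<And>g. g \<in> carrier G \<Longrightarrow> endo_char_poly V (\<rho> g) = char_poly (R g)"
proof -
  interpret V: based_space V bs by fact
  interpret G: group G by fact
  let ?n = "length bs"
  have \<rho>c: "\<rho> g \<in> carrier (form_aut_group V f)" if "g \<in> carrier G" for g
    using \<rho> that by (auto simp: hom_def)
  have lin: "\<rho> g \<in> LinearCombinations.module_hom class_ring V V" if "g \<in> carrier G" for g
    using form_aut_groupD(3)[OF \<rho>c[OF that]] .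
  have "\<forall>g\<in>carrier G. \<exists>A. A \<in> carrier_mat ?n ?n \<and> (\<forall>x\<in>carrier_vec ?n. \<rho> g (V.comb x) = V.comb (A *\<^sub>v x))"
    using V.matrix_exists[OF lin] by blast
  from bchoice[OF this] obtain R where R: "\<And>g. g \<in> carrier G \<Longrightarrow> R g \<in> carrier_mat ?n ?n"
    and R_eq: "\<And>g x. g \<in> carrier G \<Longrightarrow> x \<in> carrier_vec ?n \<Longrightarrow> \<rho> g (V.comb x) = V.comb (R g *\<^sub>v x)"
    by blast
  define F where "F = V.gram f"
  have F: "F \<in> carrier_mat ?n ?n" by (simp add: F_def V.gram_carrier)
  have form: "f (V.comb x) (V.comb y) = x \<bullet> (F *\<^sub>v y)" if "x \<in> carrier_vec ?n" "y \<in> carrier_vec ?n" for x y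
    using V.form_comb[OF f that] by (simp add: F_def)
  have mult: "R (g \<otimes>\<^bsub>G\<^esub> h) = R g * R h" if g: "g \<in> carrier G" and h: "h \<in> carrier G" for g h
  proof (rule mat_eq_on_vecI)
    fix x :: "'a vec" assume x: "x \<in> carrier_vec ?n"
    have "V.comb (R (g \<otimes>\<^bsub>G\<^esub> h) *\<^sub>v x) = \<rho> (g \<otimes>\<^bsub>G\<^esub> h) (V.comb x)"
      using R_eq[OF _ x, of "g \<otimes>\<^bsub>G\<^esub> h"] g h by simp
    also have "\<rho> (g \<otimes>\<^bsub>G\<^esub> h) = \<rho> g \<otimes>\<^bsub>form_aut_group V f\<^esub> \<rho> h" using \<rho> g h by (simp add: hom_def)
    also have "\<dots> (V.comb x) = \<rho> g (\<rho> h (V.comb x))"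
      by (rule form_aut_group_mult[OF \<rho>c[OF g] \<rho>c[OF h] V.comb_carrier])
    also have "\<dots> = V.comb (R g *\<^sub>v (R h *\<^sub>v x))"
      using R_eq[OF h x] R_eq[OF g mult_mat_vec_carrier[OF R[OF h] x]] by simp
    finally have "R (g \<otimes>\<^bsub>G\<^esub> h) *\<^sub>v x = R g *\<^sub>v (R h *\<^sub>v x)"
      using mult_mat_vec_carrier[OF R x] mult_mat_vec_carrier[OF R mult_mat_vec_carrier[OF R x]] g h
      by (intro V.comb_inj) auto
    then show "R (g \<otimes>\<^bsub>G\<^esub> h) *\<^sub>v x = R g * R h *\<^sub>v x"
      by (simp only: assoc_mult_mat_vec[OF R[OF g] R[OF h] x])
  qed (use R g h in \<open>auto simp: square_simps\<close>)
  have detF: "det F \<noteq> 0"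
  proof
    assume "det F = 0"
    then obtain y where y: "y \<in> carrier_vec ?n" "y \<noteq> 0\<^sub>v ?n" "F *\<^sub>v y = 0\<^sub>v ?n"
      using det_0_iff_vec_prod_zero_field[OF F] by auto
    have "f w (V.comb y) = 0" if w: "w \<in> carrier V" for w
    proof -
      obtain x where "x \<in> carrier_vec ?n" "w = V.comb x" using V.comb_surj[OF w] by blast
      then show ?thesis using form[of x y] y by simp
    qed
    then have "V.comb y = \<zero>\<^bsub>V\<^esub>"
      using nondeg V.comb_carrier[of y] unfolding nondegenerate_form_def by blast
    then have "y = 0\<^sub>v ?n" using V.comb_zero y by (intro V.comb_inj) auto
    then show False using y by simp
  qed
  have inv: "transpose_mat (R g) * F * R g = F" if g: "g \<in> carrier G" for g
  proof (rule scalar_prod_mult_mat_eqI)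
    note Rg = R[OF g]
    fix x y :: "'a vec" assume x: "x \<in> carrier_vec ?n" and y: "y \<in> carrier_vec ?n"
    note Rv = mult_mat_vec_carrier[OF Rg]
    have "transpose_mat (R g) * F * R g *\<^sub>v y = transpose_mat (R g) *\<^sub>v (F *\<^sub>v (R g *\<^sub>v y))"
      using F Rg y by (simp add: square_simps assoc_mult_mat_vec[of _ ?n ?n _ ?n])
    then have "x \<bullet> (transpose_mat (R g) * F * R g *\<^sub>v y) = (transpose_mat (R g) *\<^sub>v (F *\<^sub>v (R g *\<^sub>v y))) \<bullet> x"
      using x mult_mat_vec_carrier[OF F Rv[OF y]] Rg by (simp add: comm_scalar_prod[of _ ?n])
    also have "\<dots> = (F *\<^sub>v (R g *\<^sub>v y)) \<bullet> (R g *\<^sub>v x)"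
      by (rule transpose_vec_mult_scalar[OF Rg x mult_mat_vec_carrier[OF F Rv[OF y]]])
    also have "\<dots> = (R g *\<^sub>v x) \<bullet> (F *\<^sub>v (R g *\<^sub>v y))"
      by (rule comm_scalar_prod[OF mult_mat_vec_carrier[OF F Rv[OF y]] Rv[OF x]])
    also have "\<dots> = f (\<rho> g (V.comb x)) (\<rho> g (V.comb y))"
      using form[OF Rv[OF x] Rv[OF y]] R_eq[OF g] x y by simp
    also have "\<dots> = x \<bullet> (F *\<^sub>v y)"
      using form_aut_groupD(4)[OF \<rho>c[OF g] V.comb_carrier V.comb_carrier] form[OF x y] by simp
    finally show "x \<bullet> (transpose_mat (R g) * F * R g *\<^sub>v y) = x \<bullet> (F *\<^sub>v y)" .
  qed (use F R[OF g] in \<open>auto simp: square_simps\<close>)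
  have one: "R \<one>\<^bsub>G\<^esub> = 1\<^sub>m ?n"
  proof -
    note R1 = R[OF G.one_closed]
    have "det F = det (transpose_mat (R \<one>\<^bsub>G\<^esub>)) * det F * det (R \<one>\<^bsub>G\<^esub>)"
      using arg_cong[OF inv[OF G.one_closed], of det] R1 F by (simp add: det_mult[of _ ?n] square_simps)
    then have "det (R \<one>\<^bsub>G\<^esub>) \<noteq> 0" using detF by auto
    then obtain Q where Q: "Q \<in> carrier_mat ?n ?n" "R \<one>\<^bsub>G\<^esub> * Q = 1\<^sub>m ?n"
      using det_nonzero_inverse[OF R1] by blast
    have "R \<one>\<^bsub>G\<^esub> = R \<one>\<^bsub>G\<^esub> * (R \<one>\<^bsub>G\<^esub> * Q)" using Q R1 by simp
    also have "\<dots> = R \<one>\<^bsub>G\<^esub> * R \<one>\<^bsub>G\<^esub> * Q" by (rule assoc_mult_mat[OF R1 R1 Q(1), symmetric])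
    also have "R \<one>\<^bsub>G\<^esub> * R \<one>\<^bsub>G\<^esub> = R \<one>\<^bsub>G\<^esub>" using mult[of "\<one>\<^bsub>G\<^esub>" "\<one>\<^bsub>G\<^esub>"] by simp
    finally show ?thesis using Q by simp
  qed
  have rep: "form_rep G ?n R F \<epsilon>"
  proof unfold_locales
    show "transpose_mat F = of_int \<epsilon> \<cdot>\<^sub>m F"
    proof (rule eq_matI)
      fix i j assume "i < dim_row (of_int \<epsilon> \<cdot>\<^sub>m F)" "j < dim_col (of_int \<epsilon> \<cdot>\<^sub>m F)"
      then have ij: "i < ?n" "j < ?n" using F by auto
      then show "transpose_mat F $$ (i, j) = (of_int \<epsilon> \<cdot>\<^sub>m F) $$ (i, j)"
        using sym[OF V.bs_carrier[OF ij(1)] V.bs_carrier[OF ij(2)]] by (simp add: F_def V.gram_def)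
    qed (use F in auto)
  qed (use R one mult F detF inv in auto)
  moreover have "g = \<one>\<^bsub>G\<^esub>" if g: "g \<in> carrier G" "R g = 1\<^sub>m ?n" for g
  proof -
    have "\<rho> g w = \<rho> \<one>\<^bsub>G\<^esub> w" if w: "w \<in> carrier V" for w
    proof -
      obtain x where "x \<in> carrier_vec ?n" "w = V.comb x" using V.comb_surj[OF w] by blast
      then show ?thesis using R_eq[OF g(1)] R_eq[OF G.one_closed] g one by simp
    qed
    then have "\<rho> g = \<rho> \<one>\<^bsub>G\<^esub>"
      by (intro extensionalityI[OF form_aut_groupD(1)[OF \<rho>c[OF g(1)]] form_aut_groupD(1)[OF \<rho>c[OF G.one_closed]]])
    then show ?thesis using inj g by (auto dest: inj_onD)
  qed
  moreover have "endo_char_poly V (\<rho> g) = char_poly (R g)" if g: "g \<in> carrier G" for g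
    using V.representsI[OF R[OF g] R_eq[OF g]] lin[OF g] V.vectorspace_axioms
    by (intro endo_char_poly_eq) auto
  ultimately show ?thesis using that by blast
qed

lemma based_space_vec: "based_space (module_vec TYPE('a::field) n) (unit_vecs n)"
proof -
  interpret vec_space "TYPE('a)" n .
  show ?thesis
    using vec_vs unit_vecs_basis unit_vecs_distinct
    by (auto simp: based_space_def based_space_axioms_def)
qed

lemma comb_unit_vecs:
  fixes x :: "'a::field vec"
  assumes "x \<in> carrier_vec n"
  shows "based_space.comb (module_vec TYPE('a) n) (unit_vecs n) x = x"
proof -
  interpret b: based_space "module_vec TYPE('a) n" "unit_vecs n" by (rule based_space_vec)
  have len: "length (unit_vecs n :: 'a vec list) = n" by (simp add: unit_vecs_def)
  note comb = b.comb_zero b.comb_add b.comb_smult b.comb_unit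
  have unit_vecs_nth: "unit_vecs n ! j = (unit_vec n j :: 'a vec)" if "j < n" for j
    using that by (simp add: unit_vecs_def)
  note comb' = comb[unfolded len module_vec_ops]
  show ?thesis
    using assms
    by (induction x rule: vec_linear_induct) (auto simp: comb' unit_vecs_nth)
qed

context form_rep
begin

definition vec_form :: "'a vec \<Rightarrow> 'a vec \<Rightarrow> 'a" where
  "vec_form x y = x \<bullet> (F *\<^sub>v y)"

definition vec_action :: "'g \<Rightarrow> 'a vec \<Rightarrow> 'a vec" where
  "vec_action g = (\<lambda>x\<in>carrier_vec n. R g *\<^sub>v x)"

lemma F_mult_vec: "x \<in> carrier_vec n \<Longrightarrow> F *\<^sub>v x \<in> carrier_vec n"
  by (rule mult_mat_vec_carrier[OF F_carrier])

lemma R_mult_vec: "g \<in> carrier G \<Longrightarrow> x \<in> carrier_vec n \<Longrightarrow> R g *\<^sub>v x \<in> carrier_vec n"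
  by (rule mult_mat_vec_carrier[OF R_carrier])

lemma vec_form_bilinear: "bilinear_form (module_vec TYPE('a) n) vec_form"
  using F_mult_vec
  by (auto simp: bilinear_form_def module_vec_ops vec_form_def add_scalar_prod_distrib[of _ n]
      scalar_prod_add_distrib[of _ n] mult_add_distrib_mat_vec[OF F_carrier] mult_mat_vec[OF F_carrier]
      smult_scalar_prod_distrib[of _ n] scalar_prod_smult_distrib[of _ n] simp del: index_mult_mat_vec)

lemma vec_form_swap:
  assumes x: "x \<in> carrier_vec n" and y: "y \<in> carrier_vec n"
  shows "vec_form y x = of_int \<epsilon> * vec_form x y"
proof -
  have "vec_form y x = (transpose_mat F *\<^sub>v y) \<bullet> x"
    unfolding vec_form_def by (rule transpose_vec_mult_scalar[OF F_carrier x y, symmetric])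
  also have "transpose_mat F *\<^sub>v y = of_int \<epsilon> \<cdot>\<^sub>v (F *\<^sub>v y)"
    unfolding F_transpose using F_carrier y
    by (intro eq_vecI) (auto simp: scalar_prod_def sum_distrib_left mult.assoc)
  also have "\<dots> \<bullet> x = of_int \<epsilon> * (x \<bullet> (F *\<^sub>v y))"
    using F_mult_vec[OF y] x by (simp add: smult_scalar_prod_distrib[of _ n] comm_scalar_prod[of _ n])
  finally show ?thesis by (simp add: vec_form_def)
qed

lemma vec_form_nondegenerate: "nondegenerate_form (module_vec TYPE('a) n) vec_form"
proof -
  have right: "y = 0\<^sub>v n" if y: "y \<in> carrier_vec n" and z: "\<And>x. x \<in> carrier_vec n \<Longrightarrow> vec_form x y = 0" for y
  proof (rule ccontr)
    assume "y \<noteq> 0\<^sub>v n"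
    have "(F *\<^sub>v y) $ i = 0" if "i < n" for i
      using z[of "unit_vec n i"] scalar_prod_left_unit[OF F_mult_vec[OF y] that]
      by (simp add: vec_form_def del: index_mult_mat_vec)
    then have "F *\<^sub>v y = 0\<^sub>v n" using F_carrier by (intro eq_vecI) (auto simp del: index_mult_mat_vec)
    then show False using det_0_iff_vec_prod_zero_field[OF F_carrier] F_det y \<open>y \<noteq> 0\<^sub>v n\<close> by blast
  qed
  moreover have "x = 0\<^sub>v n" if "x \<in> carrier_vec n" "\<And>y. y \<in> carrier_vec n \<Longrightarrow> vec_form x y = 0" for x
    using that vec_form_swap[OF that(1)] by (intro right) auto
  ultimately show ?thesis by (auto simp: nondegenerate_form_def module_vec_ops)
qed

lemma vec_form_symmetric: "\<epsilon> = 1 \<Longrightarrow> symmetric_form (module_vec TYPE('a) n) vec_form"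
  using vec_form_swap by (auto simp: symmetric_form_def module_vec_ops)

lemma vec_form_alternating:
  assumes \<epsilon>: "\<epsilon> = -1" and diag: "\<And>i. i < n \<Longrightarrow> F $$ (i, i) = 0"
  shows "alternating_form (module_vec TYPE('a) n) vec_form"
proof -
  have "vec_form x x = 0" if "x \<in> carrier_vec n" for x
    using that
  proof (induction x rule: vec_linear_induct)
    fix x y assume x: "x \<in> carrier_vec n" and y: "y \<in> carrier_vec n" and 0: "vec_form x x = 0" "vec_form y y = 0"
    have "vec_form (x + y) (x + y) = vec_form x x + vec_form y x + (vec_form x y + vec_form y y)"
      using vec_form_bilinear x y by (simp add: bilinear_form_def module_vec_ops)
    then show "vec_form (x + y) (x + y) = 0" using 0 vec_form_swap[OF x y] \<epsilon> by simp
  next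
    fix c x assume "x \<in> carrier_vec n" "vec_form x x = 0"
    then show "vec_form (c \<cdot>\<^sub>v x) (c \<cdot>\<^sub>v x) = 0"
      using vec_form_bilinear by (simp add: bilinear_form_def module_vec_ops)
  next
    fix j assume "j < n"
    then show "vec_form (unit_vec n j) (unit_vec n j) = 0"
      using diag F_carrier by (simp add: vec_form_def mult_mat_unit_vec[OF F_carrier])
  qed (use F_mult_vec[of "0\<^sub>v n"] in \<open>simp add: vec_form_def\<close>)
  then show ?thesis by (simp add: alternating_form_def module_vec_ops)
qed

lemma vec_action_linear:
  assumes g: "g \<in> carrier G"
  shows "vec_action g \<in> LinearCombinations.module_hom class_ring (module_vec TYPE('a) n) (module_vec TYPE('a) n)"
  using R_mult_vec[OF g]
  by (auto simp: LinearCombinations.module_hom_def module_vec_ops vec_action_def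
      mult_add_distrib_mat_vec[OF R_carrier[OF g]] mult_mat_vec[OF R_carrier[OF g]])

lemma vec_action_preserves:
  assumes g: "g \<in> carrier G" and x: "x \<in> carrier_vec n" and y: "y \<in> carrier_vec n"
  shows "vec_form (R g *\<^sub>v x) (R g *\<^sub>v y) = vec_form x y"
proof -
  note Rg = R_carrier[OF g]
  note Rv = R_mult_vec[OF g]
  have "vec_form (R g *\<^sub>v x) (R g *\<^sub>v y) = (F *\<^sub>v (R g *\<^sub>v y)) \<bullet> (R g *\<^sub>v x)"
    unfolding vec_form_def by (rule comm_scalar_prod[OF Rv[OF x] F_mult_vec[OF Rv[OF y]]])
  also have "\<dots> = (transpose_mat (R g) *\<^sub>v (F *\<^sub>v (R g *\<^sub>v y))) \<bullet> x"
    by (rule transpose_vec_mult_scalar[OF Rg x F_mult_vec[OF Rv[OF y]], symmetric])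
  also have "transpose_mat (R g) *\<^sub>v (F *\<^sub>v (R g *\<^sub>v y)) = transpose_mat (R g) * F * R g *\<^sub>v y"
    using F_carrier Rg y by (simp add: square_simps assoc_mult_mat_vec[of _ n n _ n])
  also have "\<dots> \<bullet> x = x \<bullet> (F *\<^sub>v y)"
    unfolding invariant[OF g] by (rule comm_scalar_prod[OF F_mult_vec[OF y] x])
  finally show ?thesis by (simp add: vec_form_def)
qed

lemma vec_action_carrier:
  assumes g: "g \<in> carrier G"
  shows "vec_action g \<in> carrier (form_aut_group (module_vec TYPE('a) n) vec_form)"
proof -
  have inverse: "R g *\<^sub>v (R (inv g) *\<^sub>v x) = x" "R (inv g) *\<^sub>v (R g *\<^sub>v x) = x" if "x \<in> carrier_vec n" for x
    using R_inv[OF g] R_carrier[OF g] R_carrier[OF inv_closed[OF g]] that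
    by (simp_all add: assoc_mult_mat_vec[of _ n n _ n, symmetric])
  have "bij_betw (vec_action g) (carrier_vec n) (carrier_vec n)"
    by (rule bij_betwI[where g = "\<lambda>x. R (inv g) *\<^sub>v x"])
      (auto simp: vec_action_def inverse simp del: index_mult_mat_vec intro: R_mult_vec g)
  then show ?thesis
    using vec_action_linear[OF g] vec_action_preserves[OF g]
    by (auto simp: form_aut_group_def Bij_def module_vec_ops) (auto simp: vec_action_def)
qed

lemma vec_action_hom: "vec_action \<in> hom G (form_aut_group (module_vec TYPE('a) n) vec_form)"
proof (rule homI)
  show "vec_action g \<in> carrier (form_aut_group (module_vec TYPE('a) n) vec_form)" if "g \<in> carrier G" for g
    using that by (rule vec_action_carrier)
  fix g h assume g: "g \<in> carrier G" and h: "h \<in> carrier G"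
  have Bij: "vec_action g \<in> Bij (carrier_vec n)" "vec_action h \<in> Bij (carrier_vec n)"
    using vec_action_carrier[OF g] vec_action_carrier[OF h]
    by (auto simp: form_aut_group_def module_vec_ops)
  have "vec_action (g \<otimes> h) = compose (carrier_vec n) (vec_action g) (vec_action h)"
    using R_mult_vec[OF h] assoc_mult_mat_vec[OF R_carrier[OF g] R_carrier[OF h]]
    by (auto simp: vec_action_def compose_def R_mult[OF g h] simp del: index_mult_mat_vec intro!: restrict_ext)
  then show "vec_action (g \<otimes> h) = vec_action g \<otimes>\<^bsub>form_aut_group (module_vec TYPE('a) n) vec_form\<^esub> vec_action h"
    using Bij by (simp add: form_aut_group_def BijGroup_def module_vec_ops)
qed

lemma vec_action_inj:
  assumes faithful: "\<And>g. g \<in> carrier G \<Longrightarrow> R g = 1\<^sub>m n \<Longrightarrow> g = \<one>"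
  shows "inj_on vec_action (carrier G)"
proof (rule inj_onI)
  fix g h assume g: "g \<in> carrier G" and h: "h \<in> carrier G" and eq: "vec_action g = vec_action h"
  have "R g = R h"
  proof (rule mat_eq_on_vecI[OF R_carrier[OF g] R_carrier[OF h]])
    fix x :: "'a vec" assume "x \<in> carrier_vec n"
    then show "R g *\<^sub>v x = R h *\<^sub>v x" using fun_cong[OF eq, of x] by (simp add: vec_action_def)
  qed
  then have "R (inv h \<otimes> g) = 1\<^sub>m n" using g h by (simp add: R_mult R_inv)
  then have "inv h \<otimes> g = \<one>" using faithful g h by simp
  then show "g = h" using g h by (metis inv_closed inv_equality inv_inv)
qed

lemma vec_action_char_poly:
  assumes g: "g \<in> carrier G"
  shows "endo_char_poly (module_vec TYPE('a) n) (vec_action g) = char_poly (R g)"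
proof (rule endo_char_poly_eq[OF vec_vs vec_action_linear[OF g]])
  interpret b: based_space "module_vec TYPE('a) n" "unit_vecs n" by (rule based_space_vec)
  have len: "length (unit_vecs n :: 'a vec list) = n" by (simp add: unit_vecs_def)
  show "represents (module_vec TYPE('a) n) (vec_action g) (R g)"
    using R_carrier[OF g] R_mult_vec[OF g]
    by (intro b.representsI) (simp_all add: len comb_unit_vecs vec_action_def del: index_mult_mat_vec)
qed

end

section \<open>The residue field and the reduction theorem\<close>

context valued_field
begin

lemma val_ring_simps:
  "carrier (val_ring v) = \<O>" "x \<oplus>\<^bsub>val_ring v\<^esub> y = x + y" "x \<otimes>\<^bsub>val_ring v\<^esub> y = x * y"
  "\<one>\<^bsub>val_ring v\<^esub> = 1" "\<zero>\<^bsub>val_ring v\<^esub> = 0"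
  by (auto simp: val_ring_def frac_ideal_def)

lemma val_ring_one: "1 \<in> \<O>"
  by (simp add: frac_ideal_def v_one)

lemma val_ring_mult: "x \<in> \<O> \<Longrightarrow> y \<in> \<O> \<Longrightarrow> x * y \<in> \<O>"
  using frac_ideal_mult[of x 0 y 0] by simp

lemma val_ring_cring: "cring (val_ring v)"
proof (rule cringI)
  show "abelian_group (val_ring v)"
  proof (rule abelian_groupI)
    show "\<exists>y\<in>carrier (val_ring v). y \<oplus>\<^bsub>val_ring v\<^esub> x = \<zero>\<^bsub>val_ring v\<^esub>"
      if "x \<in> carrier (val_ring v)" for x
      using that frac_ideal_uminus[of x 0] by (intro bexI[of _ "- x"]) (auto simp: val_ring_simps)
  qed (auto simp: val_ring_simps frac_ideal_add frac_ideal_zero)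
  show "comm_monoid (val_ring v)"
    by (rule comm_monoidI) (auto simp: val_ring_simps val_ring_mult val_ring_one)
qed (auto simp: val_ring_simps algebra_simps)

lemma max_ideal_eq: "max_ideal v = frac_ideal 1"
  by (auto simp: max_ideal_def frac_ideal_def)

lemma max_ideal_ideal: "ideal (max_ideal v) (val_ring v)"
proof -
  interpret cring "val_ring v" by (rule val_ring_cring)
  have neg: "\<ominus>\<^bsub>val_ring v\<^esub> x = - x" if "x \<in> \<O>" for x
    using that frac_ideal_uminus[of x 0] by (intro minus_equality) (auto simp: val_ring_simps)
  have sub: "x \<in> \<O>" if "x \<in> frac_ideal 1" for x
    using that frac_ideal_mono[of 0 1] by simp
  show ?thesis
  proof (rule idealI)
    show "subgroup (max_ideal v) (add_monoid (val_ring v))"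
    proof (rule add.subgroupI)
      show "max_ideal v \<noteq> {}" using frac_ideal_zero by (auto simp: max_ideal_eq)
    qed (auto simp: max_ideal_eq val_ring_simps sub frac_ideal_add neg frac_ideal_uminus simp flip: a_inv_def)
    show "x \<otimes>\<^bsub>val_ring v\<^esub> a \<in> max_ideal v" "a \<otimes>\<^bsub>val_ring v\<^esub> x \<in> max_ideal v"
      if "a \<in> max_ideal v" "x \<in> carrier (val_ring v)" for a x
      using that frac_ideal_mult[of x 0 a 1] frac_ideal_mult[of a 1 x 0]
      by (auto simp: max_ideal_eq val_ring_simps)
  qed (rule ring_axioms)
qed

text \<open>
  The kernel of the reduction is the maximal ideal because \<open>\<phi>\<close> is injective on cosets, and it is
  onto because \<open>\<phi>\<close> is.
\<close>

lemma dvr_reduction_reduction: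
  fixes \<phi> :: "'a set \<Rightarrow> 'k::field"
  assumes \<phi>: "\<phi> \<in> ring_iso (residue_ring_of v) class_ring"
  shows "dvr_reduction v (reduction v \<phi>)"
proof -
  interpret R: cring "val_ring v" by (rule val_ring_cring)
  interpret I: ideal "max_ideal v" "val_ring v" by (rule max_ideal_ideal)
  have \<phi>h: "\<phi> \<in> Ring.ring_hom (val_ring v Quot max_ideal v) class_ring"
    and bij: "bij_betw \<phi> (carrier (val_ring v Quot max_ideal v)) UNIV"
    using \<phi> by (auto simp: ring_iso_def residue_ring_of_def)
  have "(\<phi> \<circ> (+>\<^bsub>val_ring v\<^esub>) (max_ideal v)) \<in> Ring.ring_hom (val_ring v) class_ring"
    using ring_hom_trans[OF I.rcos_ring_hom \<phi>h] .
  moreover have "\<phi> \<circ> (+>\<^bsub>val_ring v\<^esub>) (max_ideal v) = reduction v \<phi>"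
    by (auto simp: reduction_def)
  ultimately have h: "reduction v \<phi> \<in> Ring.ring_hom (val_ring v) class_ring" by simp
  have hom: "partial_hom \<O> (reduction v \<phi>)"
    using ring_hom_memE[OF h] val_ring_one val_ring_mult frac_ideal_add frac_ideal_uminus
    by unfold_locales (auto simp: val_ring_simps)
  have coset: "max_ideal v +>\<^bsub>val_ring v\<^esub> x \<in> carrier (val_ring v Quot max_ideal v)" if "x \<in> \<O>" for x
    using that by (auto simp: FactRing_def A_RCOSETS_def' val_ring_simps)
  have sg: "subgroup (max_ideal v) (add_monoid (val_ring v))" by (rule I.a_subgroup)
  show ?thesis
  proof (intro dvr_reduction.intro dvr_reduction_axioms.intro valued_field_axioms)
    show "partial_hom \<O> (reduction v \<phi>)" by (rule hom)
    fix x assume x: "x \<in> \<O>"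
    have zero: "max_ideal v +>\<^bsub>val_ring v\<^esub> 0 = max_ideal v"
      using sg R.a_coset_join2[OF _ sg, of 0] frac_ideal_zero by (simp add: val_ring_simps max_ideal_eq)
    have "reduction v \<phi> 0 = 0" using hom by (rule partial_hom.h_zero)
    then have "reduction v \<phi> x = 0 \<longleftrightarrow> reduction v \<phi> x = reduction v \<phi> 0" by simp
    also have "\<dots> \<longleftrightarrow> max_ideal v +>\<^bsub>val_ring v\<^esub> x = max_ideal v +>\<^bsub>val_ring v\<^esub> 0"
      using bij_betw_imp_inj_on[OF bij] coset[OF x] coset[OF frac_ideal_zero]
      by (auto simp: reduction_def inj_on_eq_iff)
    also have "\<dots> \<longleftrightarrow> x \<in> frac_ideal 1"
      unfolding zero using R.a_coset_join1[OF _ _ sg, of x] R.a_coset_join2[OF _ sg, of x] x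
      by (auto simp: val_ring_simps max_ideal_eq)
    finally show "reduction v \<phi> x = 0 \<longleftrightarrow> x \<in> frac_ideal 1" .
  next
    fix y :: 'k
    have "y \<in> \<phi> ` carrier (val_ring v Quot max_ideal v)" using bij by (auto simp: bij_betw_def)
    then show "\<exists>x\<in>\<O>. reduction v \<phi> x = y"
      by (auto simp: FactRing_def A_RCOSETS_def' val_ring_simps reduction_def)
  qed
qed

text \<open>
  If the ideal generated by the residue characteristic is the \<open>e\<close>-th power of the maximal ideal,
  this makes it divide the \<open>e\<close>-th power of the uniformizer.
\<close>

lemma unif_power_in_ideal_power:
  "unif ^ e \<in> max_ideal v [^]\<^bsub>ideals_set (val_ring v)\<^esub> e"
proof (induction e)
  case 0
  then show ?case by (simp add: nat_pow_def ideals_set_def val_ring_simps val_ring_one)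
next
  case (Suc e)
  have "unif \<in> max_ideal v" using unif by (simp add: max_ideal_def)
  from ideal_prod.prod[OF Suc this, of "val_ring v"] show ?case
    by (simp add: nat_pow_def ideals_set_def val_ring_simps mult.commute)
qed

lemma v_le_ramification:
  assumes "PIdl\<^bsub>val_ring v\<^esub> x = max_ideal v [^]\<^bsub>ideals_set (val_ring v)\<^esub> (e :: nat)"
  shows "v x \<le> int e"
proof -
  have "unif ^ e \<in> PIdl\<^bsub>val_ring v\<^esub> x" using unif_power_in_ideal_power assms by simp
  then obtain y where y: "y \<in> \<O>" "unif ^ e = y * x" by (auto simp: cgenideal_def val_ring_simps)
  then have "y \<noteq> 0" "x \<noteq> 0" using unif by auto
  then have "int e = v y + v x" using v_mult[of y x] v_power[of unif e] unif y by simp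
  then show ?thesis using y \<open>y \<noteq> 0\<close> by (simp add: frac_ideal_def)
qed

end

text \<open>
  Primes other than the residue characteristic are units of the valuation ring.
\<close>

lemma (in dvr_reduction) prime_ramification_bound:
  assumes p: "prime p" and l: "prime l" "CHAR('k) = l" and bound: "2 * v (of_nat l) + 2 \<le> int l"
  shows "2 * v (of_nat p) + 2 \<le> int p"
proof (cases "p = l")
  case False
  then have "\<not> l dvd p" using p l(1) primes_dvd_imp_eq[of l p] by blast
  then have "(of_nat p :: 'k) \<noteq> 0" using l by (simp add: of_nat_eq_0_iff_char_dvd)
  then have "r (of_nat p) \<noteq> 0" using h_of_int[of "int p"] by simp
  then have "of_nat p \<notin> frac_ideal 1" using r_frac_ideal_1 by blast
  then have "v (of_nat p) \<le> 0" by (auto simp: frac_ideal_def)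
  then show ?thesis using prime_ge_2_nat[OF p] by linarith
qed (use bound in simp)

theorem theorem2:
  fixes l e N :: nat
    and v :: "'a::field_char_0 \<Rightarrow> int"
    and \<phi> :: "'a set \<Rightarrow> 'k::field"
    and V :: "('a, 'v, 'm) module_scheme"
    and f :: "'v \<Rightarrow> 'v \<Rightarrow> 'a"
    and G :: "('g, 'n) monoid_scheme"
    and \<rho> :: "'g \<Rightarrow> 'v \<Rightarrow> 'v"
  assumes "prime l"
    and "discrete_valuation v"
    and "\<phi> \<in> ring_iso (residue_ring_of v) class_ring"
    and "CHAR('k) = l"
    and "PIdl\<^bsub>val_ring v\<^esub> (of_nat l) = max_ideal v [^]\<^bsub>ideals_set (val_ring v)\<^esub> e"
    and "2 * e < l - 1"
    and "vectorspace class_ring V"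
    and "vectorspace.fin_dim class_ring V"
    and "vectorspace.dim class_ring V = N"
    and "bilinear_form V f"
    and "nondegenerate_form V f"
    and "group G"
    and "finite (carrier G)"
    and "\<rho> \<in> hom G (form_aut_group V f)"
    and "inj_on \<rho> (carrier G)"
  shows
    "(alternating_form V f \<longrightarrow>
       (\<exists>f\<^sub>0 \<rho>'. bilinear_form (module_vec TYPE('k) N) f\<^sub>0 \<and>
          nondegenerate_form (module_vec TYPE('k) N) f\<^sub>0 \<and>
          alternating_form (module_vec TYPE('k) N) f\<^sub>0 \<and>
          \<rho>' \<in> hom G (form_aut_group (module_vec TYPE('k) N) f\<^sub>0) \<and>
          inj_on \<rho>' (carrier G) \<and>
          (\<forall>g\<in>carrier G. endo_char_poly (module_vec TYPE('k) N) (\<rho>' g) =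
             map_poly (reduction v \<phi>) (endo_char_poly V (\<rho> g))))) \<and>
     (symmetric_form V f \<longrightarrow>
       (\<exists>f\<^sub>0 \<rho>'. bilinear_form (module_vec TYPE('k) N) f\<^sub>0 \<and>
          nondegenerate_form (module_vec TYPE('k) N) f\<^sub>0 \<and>
          symmetric_form (module_vec TYPE('k) N) f\<^sub>0 \<and>
          \<rho>' \<in> hom G (form_aut_group (module_vec TYPE('k) N) f\<^sub>0) \<and>
          inj_on \<rho>' (carrier G) \<and>
          (\<forall>g\<in>carrier G. endo_char_poly (module_vec TYPE('k) N) (\<rho>' g) =
             map_poly (reduction v \<phi>) (endo_char_poly V (\<rho> g)))))"
proof -
  interpret val: valued_field v by unfold_locales fact
  interpret red: dvr_reduction v "reduction v \<phi>"
    by (rule val.dvr_reduction_reduction) fact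
  interpret V: vectorspace class_ring V by fact
  obtain B where B: "finite B" "V.basis B" using V.finite_basis_exists assms(8) by blast
  obtain bs where bs: "set bs = B" "distinct bs" using finite_distinct_list[OF B(1)] by blast
  have based: "based_space V bs"
    using V.vectorspace_axioms B bs by (auto simp: based_space_def based_space_axioms_def)
  have len: "length bs = N"
    using V.dim_basis[OF B] assms(9) bs by (simp add: distinct_card[symmetric])
  have ramification: "2 * v (of_nat p) + 2 \<le> int p" if "prime p" for p
    using val.v_le_ramification[OF assms(5)] assms(6)
    by (intro red.prime_ramification_bound[OF that assms(1,4)]) linarith
  have reduced_pair: "\<exists>F0 R0. form_rep G N R0 F0 \<epsilon> \<and>
      (\<forall>g\<in>carrier G. R0 g = 1\<^sub>m N \<longrightarrow> g = \<one>\<^bsub>G\<^esub>) \<and>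
      (\<forall>g\<in>carrier G. char_poly (R0 g) = map_poly (reduction v \<phi>) (endo_char_poly V (\<rho> g))) \<and>
      (\<epsilon> = -1 \<longrightarrow> (\<forall>i<N. F0 $$ (i, i) = 0))"
    if \<epsilon>: "\<epsilon> = 1 \<or> \<epsilon> = -1"
      and sym: "\<And>x y. x \<in> carrier V \<Longrightarrow> y \<in> carrier V \<Longrightarrow> f y x = of_int \<epsilon> * f x y" for \<epsilon>
  proof -
    obtain R F where rep: "form_rep G N R F \<epsilon>"
      and faithful: "\<And>g. g \<in> carrier G \<Longrightarrow> R g = 1\<^sub>m N \<Longrightarrow> g = \<one>\<^bsub>G\<^esub>"
      and cp: "\<And>g. g \<in> carrier G \<Longrightarrow> endo_char_poly V (\<rho> g) = char_poly (R g)"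
      by (rule form_rep_of_action[OF based assms(10,11,12,14,15) sym, unfolded len]; (rule that; assumption)?)
    show ?thesis
      by (rule red.reduction_of_form_rep[OF rep assms(13) \<epsilon> faithful ramification]) (auto simp: cp)
  qed
  have transfer: "\<exists>f\<^sub>0 \<rho>'. bilinear_form (module_vec TYPE('k) N) f\<^sub>0 \<and>
          nondegenerate_form (module_vec TYPE('k) N) f\<^sub>0 \<and>
          P f\<^sub>0 \<and>
          \<rho>' \<in> hom G (form_aut_group (module_vec TYPE('k) N) f\<^sub>0) \<and>
          inj_on \<rho>' (carrier G) \<and>
          (\<forall>g\<in>carrier G. endo_char_poly (module_vec TYPE('k) N) (\<rho>' g) =
             map_poly (reduction v \<phi>) (endo_char_poly V (\<rho> g)))"
    if rep: "form_rep G N R0 F0 \<epsilon>"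
      and faithful: "\<forall>g\<in>carrier G. R0 g = 1\<^sub>m N \<longrightarrow> g = \<one>\<^bsub>G\<^esub>"
      and cp: "\<forall>g\<in>carrier G. char_poly (R0 g) = map_poly (reduction v \<phi>) (endo_char_poly V (\<rho> g))"
      and P: "P (form_rep.vec_form F0)"
    for R0 :: "'g \<Rightarrow> 'k mat" and F0 \<epsilon> P
  proof -
    interpret form_rep G N R0 F0 \<epsilon> by (rule rep)
    show ?thesis
      using vec_form_bilinear vec_form_nondegenerate P vec_action_hom vec_action_inj faithful
        vec_action_char_poly cp
      by (intro exI[of _ vec_form] exI[of _ vec_action]) auto
  qed
  show ?thesis
  proof (intro conjI impI)
    assume alt: "alternating_form V f"
    have "f y x = of_int (-1) * f x y" if x: "x \<in> carrier V" and y: "y \<in> carrier V" for x y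
    proof -
      have "f (x \<oplus>\<^bsub>V\<^esub> y) (x \<oplus>\<^bsub>V\<^esub> y) = f x x + f y x + (f x y + f y y)"
        using assms(10) x y by (simp add: bilinear_form_def)
      moreover have "f (x \<oplus>\<^bsub>V\<^esub> y) (x \<oplus>\<^bsub>V\<^esub> y) = 0" "f x x = 0" "f y y = 0"
        using alt x y by (simp_all add: alternating_form_def)
      ultimately have "f y x + f x y = 0" by simp
      then show ?thesis by (simp add: eq_neg_iff_add_eq_0)
    qed
    from reduced_pair[OF _ this] obtain F0 R0 where rep: "form_rep G N R0 F0 (-1)"
      and rest: "\<forall>g\<in>carrier G. R0 g = 1\<^sub>m N \<longrightarrow> g = \<one>\<^bsub>G\<^esub>"
        "\<forall>g\<in>carrier G. char_poly (R0 g) = map_poly (reduction v \<phi>) (endo_char_poly V (\<rho> g))"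
      and diag: "\<forall>i<N. F0 $$ (i, i) = 0" by auto
    show "\<exists>f\<^sub>0 \<rho>'. bilinear_form (module_vec TYPE('k) N) f\<^sub>0 \<and>
          nondegenerate_form (module_vec TYPE('k) N) f\<^sub>0 \<and>
          alternating_form (module_vec TYPE('k) N) f\<^sub>0 \<and>
          \<rho>' \<in> hom G (form_aut_group (module_vec TYPE('k) N) f\<^sub>0) \<and>
          inj_on \<rho>' (carrier G) \<and>
          (\<forall>g\<in>carrier G. endo_char_poly (module_vec TYPE('k) N) (\<rho>' g) =
             map_poly (reduction v \<phi>) (endo_char_poly V (\<rho> g)))"
      by (rule transfer[OF rep rest]) (use form_rep.vec_form_alternating[OF rep] diag in auto)
  next
    assume "symmetric_form V f"
    then have "f y x = of_int 1 * f x y" if "x \<in> carrier V" "y \<in> carrier V" for x y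
      using that by (simp add: symmetric_form_def)
    from reduced_pair[OF _ this] obtain F0 R0 where rep: "form_rep G N R0 F0 1"
      and rest: "\<forall>g\<in>carrier G. R0 g = 1\<^sub>m N \<longrightarrow> g = \<one>\<^bsub>G\<^esub>"
        "\<forall>g\<in>carrier G. char_poly (R0 g) = map_poly (reduction v \<phi>) (endo_char_poly V (\<rho> g))"
      by auto
    show "\<exists>f\<^sub>0 \<rho>'. bilinear_form (module_vec TYPE('k) N) f\<^sub>0 \<and>
          nondegenerate_form (module_vec TYPE('k) N) f\<^sub>0 \<and>
          symmetric_form (module_vec TYPE('k) N) f\<^sub>0 \<and>
          \<rho>' \<in> hom G (form_aut_group (module_vec TYPE('k) N) f\<^sub>0) \<and>
          inj_on \<rho>' (carrier G) \<and>
          (\<forall>g\<in>carrier G. endo_char_poly (module_vec TYPE('k) N) (\<rho>' g) =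
             map_poly (reduction v \<phi>) (endo_char_poly V (\<rho> g)))"
      by (rule transfer[OF rep rest]) (use form_rep.vec_form_symmetric[OF rep] in auto)
  qed
qed

end
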